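(* Let $(\lambda,\mu,\pi)$ be simplex-like with $|\lambda|=|\mu|=|\pi|=n$, let $r$ be the largest integer with $r(r+1)(r+2)/6\le n$, and suppose $\lambda,\mu,\pi$ have at most $r+1$ columns each. Let $a\ge0$ and $b,c\ge r+1$ be integers and define $\tilde\lambda=(a^{bc})+\lambda$, $\tilde\mu=(b^{ac},\mu)$, $\tilde\pi=(c^{ab},\pi)$. Then $k^{\tilde\lambda}_{\tilde\mu,\tilde\pi}=t^{\tilde\lambda}_{\tilde\mu,\tilde\pi}=t^\lambda_{\mu,\pi}=k^\lambda_{\mu,\pi}$.
   Context: $k^\lambda_{\mu,\pi}$ is the Kronecker coefficient (multiplicity of the Specht module $[\lambda]$ in $[\mu]\otimes[\pi]$). $\alpha^T=(\alpha^T_0,\alpha^T_1,\dots)$ denotes the column lengths of a partition $\alpha$ (columns indexed from $0$). For finite $P\subseteq\mathbb{N}^3$, its marginals are $(x_P,y_P,z_P)$ where $x_P(i)$ is the number of points with $x$-coordinate $i$, and similarly for $y,z$; $t^\lambda_{\mu,\pi}$ is the number of finite $P\subseteq\mathbb{N}^3$ with marginals $(\lambda^T,\mu^T,\pi^T)$. For $s\ge1$ let $P_s=\{(x,y,z)\in\mathbb{N}^3:x+y+z\le s-1\}$ and $b_s=\sum_{v\in P_s}v$; for $n\ge1$ with $r$ maximal such that $|P_r|\le n$, set $p(n)=b_r\cdot(1,1,1)+r(n-|P_r|)$. A triple with $|\lambda|=|\mu|=|\pi|=n\ne0$ is simplex-like if $\sum_i i\lambda^T_i+\sum_j j\mu^T_j+\sum_k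 k\pi^T_k=p(n)$. Notation: $(a^{bc})+\lambda$ is the partition obtained by adding $a$ to each of the first $bc$ parts of $\lambda$ (padded with zeros); $(b^{ac},\mu)$ is the partition with $ac$ parts equal to $b$ followed by the parts of $\mu$; similarly for $(c^{ab},\pi)$. *)

theory Defs
  imports
    Complex_Main
    "HOL-Combinatorics.Permutations"
    "HOL-Library.Function_Algebras"
    "HOL-Library.Product_Plus"
begin

section \<open>Partitions\<close>

text \<open>A partition is its sequence of parts, padded with zeros: \<open>\<alpha> i\<close> is the length of row \<open>i\<close>
  of the Young diagram, rows and columns being indexed from \<open>0\<close>.\<close>

definition partition :: "(nat \<Rightarrow> nat) \<Rightarrow> bool" where
  "partition \<alpha> \<longleftrightarrow> antimono \<alpha> \<and> finite {i. \<alpha> i \<noteq> 0}"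

definition psize :: "(nat \<Rightarrow> nat) \<Rightarrow> nat" where
  "psize \<alpha> = (\<Sum>i | \<alpha> i \<noteq> 0. \<alpha> i)"

definition col_length :: "(nat \<Rightarrow> nat) \<Rightarrow> nat \<Rightarrow> nat" where
  "col_length \<alpha> j = card {i. j < \<alpha> i}"

text \<open>Row \<open>0\<close> is the longest one, and it meets every column.\<close>

definition num_columns :: "(nat \<Rightarrow> nat) \<Rightarrow> nat" where
  "num_columns \<alpha> = \<alpha> 0"

definition add_to_first :: "nat \<Rightarrow> nat \<Rightarrow> (nat \<Rightarrow> nat) \<Rightarrow> nat \<Rightarrow> nat" where
  "add_to_first m a \<alpha> = (\<lambda>i. (if i < m then a else 0) + \<alpha> i)"

definition prepend_parts :: "nat \<Rightarrow> nat \<Rightarrow> (nat \<Rightarrow> nat) \<Rightarrow> nat \<Rightarrow> nat" where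
  "prepend_parts m b \<alpha> = (\<lambda>i. if i < m then b else \<alpha> (i - m))"


section \<open>Complex representations on spaces of functions\<close>

definition fun_scale :: "complex \<Rightarrow> ('x \<Rightarrow> complex) \<Rightarrow> 'x \<Rightarrow> complex" where
  "fun_scale c f = (\<lambda>x. c * f x)"

interpretation fun_space: vector_space "fun_scale :: complex \<Rightarrow> ('x \<Rightarrow> complex) \<Rightarrow> 'x \<Rightarrow> complex"
  by unfold_locales (auto simp: fun_scale_def algebra_simps fun_eq_iff)

text \<open>In this section \<open>G\<close> is a set of group elements and \<open>act g\<close> the operator by which \<open>g\<close> acts.\<close>

definition invariant_subspace ::
    "'g set \<Rightarrow> ('g \<Rightarrow> ('x \<Rightarrow> complex) \<Rightarrow> 'x \<Rightarrow> complex) \<Rightarrow> ('x \<Rightarrow> complex) set \<Rightarrow> bool" where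
  "invariant_subspace G act U \<longleftrightarrow>
     fun_space.subspace U \<and> (\<forall>g\<in>G. \<forall>u\<in>U. act g u \<in> U)"

definition irreducible_subspace ::
    "'g set \<Rightarrow> ('g \<Rightarrow> ('x \<Rightarrow> complex) \<Rightarrow> 'x \<Rightarrow> complex) \<Rightarrow> ('x \<Rightarrow> complex) set \<Rightarrow> bool" where
  "irreducible_subspace G act U \<longleftrightarrow>
     invariant_subspace G act U \<and> U \<noteq> {0} \<and>
     (\<forall>U'. invariant_subspace G act U' \<and> U' \<subseteq> U \<longrightarrow> U' = {0} \<or> U' = U)"

definition isomorphic_reps ::
    "'g set \<Rightarrow> ('g \<Rightarrow> ('x \<Rightarrow> complex) \<Rightarrow> 'x \<Rightarrow> complex) \<Rightarrow> ('x \<Rightarrow> complex) set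
            \<Rightarrow> ('g \<Rightarrow> ('y \<Rightarrow> complex) \<Rightarrow> 'y \<Rightarrow> complex) \<Rightarrow> ('y \<Rightarrow> complex) set \<Rightarrow> bool" where
  "isomorphic_reps G actU U actV V \<longleftrightarrow>
     (\<exists>\<phi>. bij_betw \<phi> U V \<and>
          (\<forall>u\<in>U. \<forall>u'\<in>U. \<phi> (u + u') = \<phi> u + \<phi> u') \<and>
          (\<forall>c. \<forall>u\<in>U. \<phi> (fun_scale c u) = fun_scale c (\<phi> u)) \<and>
          (\<forall>g\<in>G. \<forall>u\<in>U. \<phi> (actU g u) = actV g (\<phi> u)))"

text \<open>\<open>W\<close> is the internal direct sum of the members of \<open>D\<close>, all irreducible. The summands of an
  internal direct sum are nonzero and independent, hence pairwise distinct, so a set suffices.\<close>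

definition irreducible_decomposition ::
    "'g set \<Rightarrow> ('g \<Rightarrow> ('x \<Rightarrow> complex) \<Rightarrow> 'x \<Rightarrow> complex) \<Rightarrow> ('x \<Rightarrow> complex) set
            \<Rightarrow> ('x \<Rightarrow> complex) set set \<Rightarrow> bool" where
  "irreducible_decomposition G act W D \<longleftrightarrow>
     finite D \<and> (\<forall>U\<in>D. irreducible_subspace G act U) \<and>
     fun_space.span (\<Union>D) = W \<and>
     (\<forall>u. (\<forall>U\<in>D. u U \<in> U) \<and> (\<Sum>U\<in>D. u U) = 0 \<longrightarrow> (\<forall>U\<in>D. u U = 0))"

text \<open>The number of summands isomorphic to \<open>V\<close> in a decomposition of \<open>W\<close> into irreducibles. For a
  finite group and finite-dimensional \<open>W\<close>, a decomposition exists (Maschke) and this number is the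
  same for all of them (Krull-Schmidt).\<close>

definition irr_multiplicity ::
    "'g set \<Rightarrow> ('g \<Rightarrow> ('y \<Rightarrow> complex) \<Rightarrow> 'y \<Rightarrow> complex) \<Rightarrow> ('y \<Rightarrow> complex) set
            \<Rightarrow> ('g \<Rightarrow> ('x \<Rightarrow> complex) \<Rightarrow> 'x \<Rightarrow> complex) \<Rightarrow> ('x \<Rightarrow> complex) set \<Rightarrow> nat" where
  "irr_multiplicity G actV V actW W =
     (THE m. \<exists>D. irreducible_decomposition G actW W D \<and>
                 m = card {U \<in> D. isomorphic_reps G actW U actV V})"


section \<open>Specht modules and Kronecker coefficients\<close>

text \<open>The symmetric group is \<open>{\<sigma>. \<sigma> permutes {..<n}}\<close>. We use James's construction, in which the
  Specht module of \<open>(n)\<close> is trivial and that of \<open>(1, \<dots>, 1)\<close> is the sign representation.\<close>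

definition cells :: "(nat \<Rightarrow> nat) \<Rightarrow> (nat \<times> nat) set" where
  "cells \<alpha> = {(i, j). j < \<alpha> i}"

definition tableaux :: "(nat \<Rightarrow> nat) \<Rightarrow> (nat \<times> nat \<Rightarrow> nat) set" where
  "tableaux \<alpha> = {t. bij_betw t (cells \<alpha>) {..<psize \<alpha>}}"

text \<open>The tabloid of a tableau, as the sequence of its row contents.\<close>

definition tabloid :: "(nat \<Rightarrow> nat) \<Rightarrow> (nat \<times> nat \<Rightarrow> nat) \<Rightarrow> nat \<Rightarrow> nat set" where
  "tabloid \<alpha> t = (\<lambda>i. {t (i, j) | j. j < \<alpha> i})"

definition column_stabilizer :: "(nat \<Rightarrow> nat) \<Rightarrow> (nat \<times> nat \<Rightarrow> nat) \<Rightarrow> (nat \<Rightarrow> nat) set" where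
  "column_stabilizer \<alpha> t =
     {\<sigma>. \<sigma> permutes {..<psize \<alpha>} \<and>
         (\<forall>j. \<sigma> ` {t (i, j) | i. j < \<alpha> i} = {t (i, j) | i. j < \<alpha> i})}"

text \<open>Elements of the permutation module on tabloids are represented by their coefficient functions;
  \<open>polytabloid \<alpha> t\<close> is the signed sum of the tabloids of \<open>\<sigma> \<circ> t\<close> over the column stabilizer of \<open>t\<close>.\<close>

definition polytabloid :: "(nat \<Rightarrow> nat) \<Rightarrow> (nat \<times> nat \<Rightarrow> nat) \<Rightarrow> (nat \<Rightarrow> nat set) \<Rightarrow> complex" where
  "polytabloid \<alpha> t =
     (\<lambda>R. \<Sum>\<sigma>\<in>column_stabilizer \<alpha> t. if tabloid \<alpha> (\<sigma> \<circ> t) = R then of_int (sign \<sigma>) else 0)"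

definition specht :: "(nat \<Rightarrow> nat) \<Rightarrow> ((nat \<Rightarrow> nat set) \<Rightarrow> complex) set" where
  "specht \<alpha> = fun_space.span (polytabloid \<alpha> ` tableaux \<alpha>)"

text \<open>The inverse makes \<open>\<sigma>\<close> send the basis vector of a tabloid \<open>R\<close> to that of \<open>\<sigma> R\<close>.\<close>

definition specht_act ::
    "(nat \<Rightarrow> nat) \<Rightarrow> ((nat \<Rightarrow> nat set) \<Rightarrow> complex) \<Rightarrow> (nat \<Rightarrow> nat set) \<Rightarrow> complex" where
  "specht_act \<sigma> f = (\<lambda>R. f (\<lambda>i. inv \<sigma> ` R i))"

text \<open>For spaces of functions \<open>V\<close> on \<open>X\<close> and \<open>W\<close> on \<open>Y\<close>, the tensor product is realized inside the
  functions on \<open>X \<times> Y\<close>, with \<open>f \<otimes> g\<close> the function \<open>(x, y) \<mapsto> f x * g y\<close>. The symmetric group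
  acts diagonally: \<open>\<sigma> (f \<otimes> g) = \<sigma> f \<otimes> \<sigma> g\<close>.\<close>

definition tensor_space ::
    "('x \<Rightarrow> complex) set \<Rightarrow> ('y \<Rightarrow> complex) set \<Rightarrow> ('x \<times> 'y \<Rightarrow> complex) set" where
  "tensor_space V W = fun_space.span {(\<lambda>(x, y). f x * g y) | f g. f \<in> V \<and> g \<in> W}"

definition tensor_act ::
    "(nat \<Rightarrow> nat) \<Rightarrow> ((nat \<Rightarrow> nat set) \<times> (nat \<Rightarrow> nat set) \<Rightarrow> complex)
                \<Rightarrow> (nat \<Rightarrow> nat set) \<times> (nat \<Rightarrow> nat set) \<Rightarrow> complex" where
  "tensor_act \<sigma> F = (\<lambda>(R, S). F (\<lambda>i. inv \<sigma> ` R i, \<lambda>i. inv \<sigma> ` S i))"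

text \<open>Meaningful for partitions \<open>\<lambda>\<close>, \<open>\<mu>\<close>, \<open>\<pi>\<close> of the same size.\<close>

definition kronecker_coeff :: "(nat \<Rightarrow> nat) \<Rightarrow> (nat \<Rightarrow> nat) \<Rightarrow> (nat \<Rightarrow> nat) \<Rightarrow> nat" where
  "kronecker_coeff l m p =
     irr_multiplicity {\<sigma>. \<sigma> permutes {..<psize l}}
       specht_act (specht l) tensor_act (tensor_space (specht m) (specht p))"


section \<open>Point sets with given marginals\<close>

definition x_marginal :: "(nat \<times> nat \<times> nat) set \<Rightarrow> nat \<Rightarrow> nat" where
  "x_marginal P i = card {(x, y, z) \<in> P. x = i}"

definition y_marginal :: "(nat \<times> nat \<times> nat) set \<Rightarrow> nat \<Rightarrow> nat" where
  "y_marginal P j = card {(x, y, z) \<in> P. y = j}"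

definition z_marginal :: "(nat \<times> nat \<times> nat) set \<Rightarrow> nat \<Rightarrow> nat" where
  "z_marginal P k = card {(x, y, z) \<in> P. z = k}"

definition t_count :: "(nat \<Rightarrow> nat) \<Rightarrow> (nat \<Rightarrow> nat) \<Rightarrow> (nat \<Rightarrow> nat) \<Rightarrow> nat" where
  "t_count l m p =
     card {P. finite P \<and> x_marginal P = col_length l \<and>
              y_marginal P = col_length m \<and> z_marginal P = col_length p}"


section \<open>Simplex-like triples\<close>

text \<open>Written with \<open>< s\<close> instead of \<open>\<le> s - 1\<close>, since subtraction on \<^typ>\<open>nat\<close> truncates; in particular
  \<open>simplex 0\<close> is empty.\<close>

definition simplex :: "nat \<Rightarrow> (nat \<times> nat \<times> nat) set" where
  "simplex s = {(x, y, z). x + y + z < s}"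

definition simplex_sum :: "nat \<Rightarrow> nat \<times> nat \<times> nat" where
  "simplex_sum s = (\<Sum>v\<in>simplex s. v)"

definition p_min :: "nat \<Rightarrow> nat" where
  "p_min n =
     (let r = (GREATEST s. card (simplex s) \<le> n);
          (b1, b2, b3) = simplex_sum r
      in (b1 + b2 + b3) + r * (n - card (simplex r)))"

definition simplex_like :: "(nat \<Rightarrow> nat) \<Rightarrow> (nat \<Rightarrow> nat) \<Rightarrow> (nat \<Rightarrow> nat) \<Rightarrow> bool" where
  "simplex_like l m p \<longleftrightarrow>
     partition l \<and> partition m \<and> partition p \<and>
     psize l = psize m \<and> psize m = psize p \<and> psize l \<noteq> 0 \<and>
     (\<Sum>i<num_columns l. i * col_length l i)
       + (\<Sum>j<num_columns m. j * col_length m j)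
       + (\<Sum>k<num_columns p. k * col_length p k) = p_min (psize l)"

end

(* The tensor product of three copies of the column-word model turns the multiplicity of the Specht
   module of l in that of m tensor that of p into a space of alternating functions on words of points
   of N^3. Words w with w(0), ..., w(n-1) pairwise distinct are enumerations of point sets P, and the
   contents of the three coordinate words are the marginals of P; so the alternating functions on
   words with coordinate contents the column lengths of l, m, p have a basis indexed by the point
   sets counted by t. Every homomorphism from the Specht module of l to the tensor product gives such
   a function, injectively; this is the inequality k <= t. A function comes from a homomorphism as
   soon as it is a highest weight vector in each of the three coordinates, that is, killed by the
   raising operators. A raising operator produces an alternating function on words in which one
   marginal is raised by e_i - e_(i+1), and this vanishes if no point set has such marginals
   ("rigid" below). Then k = t.

   A raised marginal lowers the sum of all coordinates by one. For a simplex-like triple that sum is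
   already the minimum p(n), so the triple is rigid. For the stretched triple, a point set with these
   (possibly raised) marginals lies over a b * c rectangle, and its first a slices are forced to be
   full; removing them gives a point set for the original triple, so rigidity and t carry over. *)

theory Submission
  imports Defs
begin

section \<open>Highest weight functions on words\<close>

text \<open>Everything is expressed by one kernel, \<open>asgn (zip c \<rho>)\<close>, in a column
  word \<open>c\<close> and a row word \<open>\<rho>\<close>. For fixed \<open>c\<close> it is a
  polytabloid up to a scalar, and these span the Specht module; for fixed \<open>\<rho>\<close> it
  is a highest weight function. Under a permutation each of three such kernels contributes a sign,
  and the product of three equal signs is that sign: this is why column words lead to alternating
  functions, hence to sets of points and not to multisets. The equality k = t rests on the converse
  that the kernel yields all highest weight functions, so that one orthogonal to it for every
  \<open>\<rho>\<close> is zero. This is proved by eliminating leading words; a leading word can be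
  matched because every suffix of it has a partition as content, which comes from a norm
  computation. Since the kernel is real, bilinear and Hermitian orthogonality agree on its span.
  That endomorphisms of a Specht module are scalar is seen without eigenvalues: the functions on
  tabloids that alternate under a column stabilizer form a line.\<close>

definition words :: "nat \<Rightarrow> (nat \<Rightarrow> nat) \<Rightarrow> nat list set" where
  "words n a = {xs. length xs = n \<and> count_list xs = a}"

text \<open>Functions on words of length \<open>n\<close> are tensors in the \<open>n\<close>-th power of a space with basis the letters;
  \<open>raising\<close> and \<open>lowering\<close> are the actions of the standard generators of the general linear Lie
  algebra, and the content of a word is its weight.\<close>

definition raising :: "nat \<Rightarrow> (nat list \<Rightarrow> complex) \<Rightarrow> nat list \<Rightarrow> complex" where
  "raising i f d = (\<Sum>p | p < length d \<and> d ! p = i. f (d[p := Suc i]))"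

definition lowering :: "nat \<Rightarrow> (nat list \<Rightarrow> complex) \<Rightarrow> nat list \<Rightarrow> complex" where
  "lowering i f d = (\<Sum>p | p < length d \<and> d ! p = Suc i. f (d[p := i]))"

lemma letter_positions_Cons:
  "{p. p < length (k # xs) \<and> (k # xs) ! p = j} =
     (if k = j then {0} else {}) \<union> Suc ` {p. p < length xs \<and> xs ! p = j}"
proof -
  have "p \<in> Suc ` {p. p < length xs \<and> xs ! p = j} \<longleftrightarrow>
      (\<exists>q. p = Suc q \<and> q < length xs \<and> xs ! q = j)" for p by auto
  then show ?thesis
    by (intro set_eqI) (case_tac x, auto)
qed

lemma raising_Nil [simp]: "raising i f [] = 0"
  and lowering_Nil [simp]: "lowering i f [] = 0"
  by (simp_all add: raising_def lowering_def)

lemma raising_Cons: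
  "raising i f (k # xs) = (if k = i then f (Suc i # xs) else 0) + raising i (\<lambda>ys. f (k # ys)) xs"
  unfolding raising_def letter_positions_Cons
  by (subst sum.union_disjoint) (auto simp: sum.reindex)

lemma lowering_Cons:
  "lowering i f (k # xs) = (if k = Suc i then f (i # xs) else 0) + lowering i (\<lambda>ys. f (k # ys)) xs"
  unfolding lowering_def letter_positions_Cons
  by (subst sum.union_disjoint) (auto simp: sum.reindex)

lemma raising_add: "raising i (\<lambda>x. f x + g x) d = raising i f d + raising i g d"
  by (simp add: raising_def sum.distrib)

lemma raising_0 [simp]: "raising i (\<lambda>x. 0) d = 0"
  by (simp add: raising_def)

lemma lowering_add: "lowering i (\<lambda>x. f x + g x) d = lowering i f d + lowering i g d"
  by (simp add: lowering_def sum.distrib)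

lemma lowering_0 [simp]: "lowering i (\<lambda>x. 0) d = 0"
  by (simp add: lowering_def)

text \<open>The relation [E, F] = H of sl_2. Changes at two different positions commute and cancel;
  a position that is changed and changed back contributes +1 for a letter \<open>i\<close> and -1
  for a letter \<open>Suc i\<close>.\<close>

lemma raising_lowering_commute:
  "raising i (lowering i f) xs =
     lowering i (raising i f) xs + (of_nat (count_list xs i) - of_nat (count_list xs (Suc i))) * f xs"
proof (induction xs arbitrary: f)
  case Nil
  then show ?case by simp
next
  case (Cons k xs)
  have "raising i (\<lambda>ys. if k = Suc i then f (i # ys) else 0) xs =
      (if k = Suc i then raising i (\<lambda>ys. f (i # ys)) xs else 0)"
    "lowering i (\<lambda>ys. if k = i then f (Suc i # ys) else 0) xs =
      (if k = i then lowering i (\<lambda>ys. f (Suc i # ys)) xs else 0)"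
    by auto
  then show ?case
    using Cons[of "\<lambda>ys. f (k # ys)"]
    by (auto simp: raising_Cons lowering_Cons raising_add lowering_add algebra_simps)
qed

lemma sum_lists_Suc:
  fixes h :: "nat list \<Rightarrow> complex"
  shows "(\<Sum>xs | set xs \<subseteq> {..<N} \<and> length xs = Suc n. h xs) =
    (\<Sum>k<N. \<Sum>xs | set xs \<subseteq> {..<N} \<and> length xs = n. h (k # xs))"
proof -
  let ?L = "\<lambda>n. {xs. set xs \<subseteq> {..<N} \<and> length xs = n}"
  have "?L (Suc n) = (\<lambda>(k, xs). k # xs) ` ({..<N} \<times> ?L n)"
    by (auto simp: length_Suc_conv image_iff)
  moreover have "inj_on (\<lambda>(k, xs). k # xs) ({..<N} \<times> ?L n)"
    by (auto simp: inj_on_def)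
  ultimately have "sum h (?L (Suc n)) = (\<Sum>(k, xs)\<in>{..<N} \<times> ?L n. h (k # xs))"
    by (simp add: sum.reindex case_prod_unfold)
  then show ?thesis
    by (simp add: sum.cartesian_product)
qed

text \<open>Both sides sum over the pairs of words that agree except at one position, where one has
  \<open>i\<close> and the other \<open>Suc i\<close>. The alphabet is cut off at \<open>N\<close>
  to make the sums finite; \<open>Suc i < N\<close> keeps both members of each pair.\<close>

lemma raising_lowering_adjoint:
  assumes "Suc i < N"
  shows "(\<Sum>xs | set xs \<subseteq> {..<N} \<and> length xs = n. raising i f xs * g xs) =
         (\<Sum>xs | set xs \<subseteq> {..<N} \<and> length xs = n. f xs * lowering i g xs)"
proof (induction n arbitrary: f g)
  case 0
  then show ?case by (auto intro!: sum.neutral)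
next
  case (Suc n)
  let ?L = "{xs. set xs \<subseteq> {..<N} \<and> length xs = n}"
  have [simp]: "(\<Sum>xs\<in>A. if P then h xs else 0) = (if P then sum h A else (0::complex))"
    for P h and A :: "nat list set" by auto
  show ?case
    using Suc assms
    by (simp add: sum_lists_Suc raising_Cons lowering_Cons distrib_left distrib_right sum.distrib
        if_distrib[of "\<lambda>x. x * _"] if_distrib[of "\<lambda>x. _ * x"] sum.delta cong: if_cong)
qed

definition highest_weight :: "nat \<Rightarrow> (nat \<Rightarrow> nat) \<Rightarrow> (nat list \<Rightarrow> complex) \<Rightarrow> bool" where
  "highest_weight n a f \<longleftrightarrow> (\<forall>xs. f xs \<noteq> 0 \<longrightarrow> xs \<in> words n a) \<and> (\<forall>i d. raising i f d = 0)"

lemma words_set_eq: "xs \<in> words n a \<Longrightarrow> ys \<in> words n a \<Longrightarrow> set xs = set ys"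
  unfolding words_def by (metis (mono_tags, lifting) count_list_0_iff mem_Collect_eq subsetI subset_antisym)

lemma finite_words [simp, intro]: "finite (words n a)"
proof (cases "words n a = {}")
  case False
  then obtain xs0 where "xs0 \<in> words n a" by auto
  then have "words n a \<subseteq> {xs. set xs \<subseteq> set xs0 \<and> length xs = n}"
    using words_set_eq[of _ n a xs0] unfolding words_def[of n a] by blast
  then show ?thesis
    using finite_lists_length_eq[of "set xs0" n] finite_subset by auto
qed simp

text \<open>By adjointness and the commutation relation, the squared norm of \<open>lowering i f\<close> is
  \<open>a i - a (Suc i)\<close> times that of \<open>f\<close>.\<close>

lemma highest_weight_antimono:
  assumes f: "highest_weight n a f" and "f \<noteq> (\<lambda>_. 0)"
  shows "antimono a"
proof -
  obtain xs0 where xs0: "f xs0 \<noteq> 0" using assms(2) by auto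
  have supp: "f xs \<noteq> 0 \<Longrightarrow> xs \<in> words n a" for xs
    using f by (auto simp: highest_weight_def)
  have "a (Suc i) \<le> a i" for i
  proof (rule ccontr)
    assume *: "\<not> a (Suc i) \<le> a i"
    \<comment> \<open>The alphabet contains \<open>Suc i\<close> for the adjointness, and the
      letters of \<open>xs0\<close> so that the squared norm of \<open>f\<close> over
      \<open>?L\<close> is positive.\<close>
    define N where "N = Suc (Max (insert (Suc i) (set xs0)))"
    let ?L = "{xs. set xs \<subseteq> {..<N} \<and> length xs = n}"
    have fin: "finite ?L" by (rule finite_lists_length_eq) simp
    have N: "Suc i < N" "set xs0 \<subseteq> {..<N}"
      by (auto simp: N_def less_Suc_eq_le)
    then have xs0L: "xs0 \<in> ?L" using supp[OF xs0] by (auto simp: words_def)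
    have "(\<Sum>xs\<in>?L. lowering i f xs * cnj (lowering i f xs)) =
        (\<Sum>xs\<in>?L. lowering i f xs * lowering i (\<lambda>x. cnj (f x)) xs)"
      by (simp add: lowering_def)
    also have "\<dots> = (\<Sum>xs\<in>?L. raising i (lowering i f) xs * cnj (f xs))"
      using raising_lowering_adjoint[OF N(1)] by simp
    also have "\<dots> = (\<Sum>xs\<in>?L. of_real ((real (a i) - real (a (Suc i))) * (cmod (f xs))\<^sup>2))"
    proof (rule sum.cong[OF refl])
      fix xs
      have "raising i f = (\<lambda>_. 0)" using f by (auto simp: highest_weight_def)
      then have "lowering i (raising i f) xs = 0" by simp
      moreover have "f xs \<noteq> 0 \<Longrightarrow> count_list xs = a" using supp by (auto simp: words_def)
      ultimately show "raising i (lowering i f) xs * cnj (f xs) =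
          of_real ((real (a i) - real (a (Suc i))) * (cmod (f xs))\<^sup>2)"
        by (cases "f xs = 0") (simp_all add: raising_lowering_commute mult.assoc complex_norm_square del: of_real_power)
    qed
    finally have "complex_of_real (\<Sum>xs\<in>?L. (cmod (lowering i f xs))\<^sup>2) =
        of_real (\<Sum>xs\<in>?L. (real (a i) - real (a (Suc i))) * (cmod (f xs))\<^sup>2)"
      by (simp only: of_real_sum complex_norm_square[symmetric])
    then have "(\<Sum>xs\<in>?L. (cmod (lowering i f xs))\<^sup>2) =
        (real (a i) - real (a (Suc i))) * (\<Sum>xs\<in>?L. (cmod (f xs))\<^sup>2)"
      by (simp only: of_real_eq_iff sum_distrib_left)
    moreover have "(\<Sum>xs\<in>?L. (cmod (lowering i f xs))\<^sup>2) \<ge> 0" by (simp add: sum_nonneg)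
    moreover have "(\<Sum>xs\<in>?L. (cmod (f xs))\<^sup>2) > 0"
      by (rule sum_pos2[OF fin xs0L]) (use xs0 in auto)
    ultimately show False using * by (auto simp: zero_le_mult_iff)
  qed
  then show ?thesis
    by (simp add: antimono_iff_le_Suc)
qed

text \<open>Yamanouchi words: every suffix has a partition as content. Read from the right as column
  indices, such a word builds a Young diagram cell by cell.\<close>

primrec ballot :: "nat list \<Rightarrow> bool" where
  "ballot [] \<longleftrightarrow> True"
| "ballot (k # xs) \<longleftrightarrow> ballot xs \<and> antimono (count_list (k # xs))"

text \<open>The leading word is built greedily: take the largest letter \<open>j\<close> that starts
  a word of the support and restrict \<open>f\<close> to the words starting with \<open>j\<close>.
  The restriction is again a highest weight function, with the weight lowered at \<open>j\<close>,
  so the induction applies, and \<open>highest_weight_antimono\<close> supplies the partition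
  condition at every suffix.\<close>

lemma highest_weight_leading_word:
  assumes "highest_weight n a f" "f \<noteq> (\<lambda>_. 0)"
  shows "\<exists>c. f c \<noteq> 0 \<and> ballot c \<and> (\<forall>c'. f c' \<noteq> 0 \<longrightarrow> c' = c \<or> (c', c) \<in> lex less_than)"
  using assms
proof (induction n arbitrary: a f)
  case 0
  then have "f xs \<noteq> 0 \<Longrightarrow> xs = []" for xs by (auto simp: highest_weight_def words_def)
  with 0 show ?case by (intro exI[of _ "[]"]) auto
next
  case (Suc n)
  have supp: "f xs \<noteq> 0 \<Longrightarrow> xs \<in> words (Suc n) a" for xs
    using Suc.prems by (auto simp: highest_weight_def)
  have rais: "raising i f d = 0" for i d
    using Suc.prems by (auto simp: highest_weight_def)
  have anti: "antimono a" using highest_weight_antimono Suc.prems by blast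
  define K where "K = {k. \<exists>xs. f (k # xs) \<noteq> 0}"
  obtain xs0 where xs0: "f xs0 \<noteq> 0" using Suc.prems by auto
  then obtain k0 ys0 where k0: "xs0 = k0 # ys0"
    using supp[OF xs0] by (auto simp: words_def length_Suc_conv)
  have "K \<subseteq> set xs0"
    unfolding K_def using supp words_set_eq[OF _ supp[OF xs0]] by force
  then have finK: "finite K" by (rule finite_subset) simp
  have neK: "K \<noteq> {}" using k0 xs0 by (auto simp: K_def)
  define j where "j = Max K"
  have jK: "j \<in> K" unfolding j_def using finK neK by (rule Max_in)
  have jmax: "f (k # xs) \<noteq> 0 \<Longrightarrow> k \<le> j" for k xs
    unfolding j_def using finK by (intro Max_ge) (auto simp: K_def)
  define g where "g = (\<lambda>xs. f (j # xs))"
  have gne: "g \<noteq> (\<lambda>_. 0)" using jK by (auto simp: K_def g_def fun_eq_iff)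
  have "highest_weight n (\<lambda>i. a i - (if j = i then 1 else 0)) g"
    unfolding highest_weight_def
  proof (intro conjI allI impI)
    fix xs assume "g xs \<noteq> 0"
    then have "j # xs \<in> words (Suc n) a" using supp by (simp add: g_def)
    then show "xs \<in> words n (\<lambda>i. a i - (if j = i then 1 else 0))"
      unfolding words_def by (auto simp del: count_list.simps(2)) (auto intro!: ext)
  next
    fix i d
    \<comment> \<open>For \<open>i = j\<close> the raising operator also acts on the first letter;
      that term starts with \<open>Suc j\<close> and vanishes by maximality of
      \<open>j\<close>.\<close>
    have "f (Suc j # d) = 0" using jmax[of "Suc j" d] by auto
    then show "raising i g d = 0"
      using rais[of i "j # d"] by (auto simp: raising_Cons g_def split: if_splits)
  qed
  from Suc.IH[OF this gne] obtain c where c: "g c \<noteq> 0" "ballot c"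
    "\<And>c'. g c' \<noteq> 0 \<Longrightarrow> c' = c \<or> (c', c) \<in> lex less_than" by blast
  have cw: "j # c \<in> words (Suc n) a" using c(1) supp by (simp add: g_def)
  show ?case
  proof (intro exI[of _ "j # c"] conjI allI impI)
    show "f (j # c) \<noteq> 0" using c(1) by (simp add: g_def)
    show "ballot (j # c)"
      using cw anti c(2) by (simp add: words_def del: count_list.simps)
    fix c' assume c': "f c' \<noteq> 0"
    have "length c' = Suc n" using supp[OF c'] by (simp add: words_def)
    then obtain k ys where kys: "c' = k # ys" "length ys = n"
      by (cases c') auto
    have "length c = n" using cw by (simp add: words_def)
    show "c' = j # c \<or> (c', j # c) \<in> lex less_than"
    proof (cases "k = j")
      case True
      then have "g ys \<noteq> 0" using c' kys(1) by (simp add: g_def)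
      then show ?thesis using c(3)[of ys] True kys by auto
    next
      case False
      have "k \<le> j" using jmax[of k ys] c' kys(1) by simp
      then show ?thesis using False kys \<open>length c = n\<close> by simp
    qed
  qed
qed

section \<open>Alternating functions of lists\<close>

definition alternating :: "nat \<Rightarrow> ('a list \<Rightarrow> complex) \<Rightarrow> bool" where
  "alternating n F \<longleftrightarrow> (\<forall>xs \<sigma>. length xs = n \<longrightarrow> \<sigma> permutes {..<n} \<longrightarrow>
     F (permute_list \<sigma> xs) = of_int (sign \<sigma>) * F xs)"

lemma alternatingD:
  "alternating n F \<Longrightarrow> length xs = n \<Longrightarrow> \<sigma> permutes {..<n} \<Longrightarrow>
     F (permute_list \<sigma> xs) = of_int (sign \<sigma>) * F xs"
  by (simp add: alternating_def)

lemma permute_list_transpose: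
  assumes "p < length xs" "q < length xs"
  shows "permute_list (Transposition.transpose p q) xs = xs[p := xs ! q, q := xs ! p]"
  using assms by (intro nth_equalityI) (auto simp: permute_list_def nth_list_update Transposition.transpose_def)

lemma permute_list_transpose_eq:
  assumes "p < length xs" "q < length xs" "xs ! p = xs ! q"
  shows "permute_list (Transposition.transpose p q) xs = xs"
  using permute_list_transpose[OF assms(1,2)] assms(3) list_update_id by metis

lemma permutes_transpose_lessThan:
  "p < n \<Longrightarrow> q < n \<Longrightarrow> Transposition.transpose p q permutes {..<n::nat}"
  by (intro permutes_swap_id) auto

lemma alternating_eq_0:
  assumes "alternating n F" "length xs = n" "\<not> distinct xs"
  shows "F xs = 0"
proof -
  obtain p q where pq: "p < n" "q < n" "p \<noteq> q" "xs ! p = xs ! q"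
    using assms(2,3) by (auto simp: distinct_conv_nth)
  have "permute_list (Transposition.transpose p q) xs = xs"
    using pq assms(2) by (intro permute_list_transpose_eq) auto
  moreover have "Transposition.transpose p q permutes {..<n}"
    using pq by (intro permutes_transpose_lessThan)
  ultimately have "F xs = - F xs"
    using alternatingD[OF assms(1,2), of "Transposition.transpose p q"] pq
    by (simp add: sign_swap_id)
  then show ?thesis by simp
qed

definition ref_list :: "'a set \<Rightarrow> 'a list" where
  "ref_list S = (SOME xs. set xs = S \<and> distinct xs)"

lemma ref_list:
  assumes "finite S"
  shows "set (ref_list S) = S" "distinct (ref_list S)"
  using someI_ex[OF finite_distinct_list[OF assms]] by (auto simp: ref_list_def)

lemma length_ref_list: "finite S \<Longrightarrow> length (ref_list S) = card S"
  using ref_list[of S] distinct_card[of "ref_list S"] by simp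

text \<open>The order of the entries enters only through the arbitrary choice of a reference order,
  so no linear order is needed on them.\<close>

definition asgn :: "'a list \<Rightarrow> complex" where
  "asgn xs = (if distinct xs
     then of_int (sign (SOME \<sigma>. \<sigma> permutes {..<length xs} \<and> permute_list \<sigma> (ref_list (set xs)) = xs))
     else 0)"

lemma distinct_permutation:
  assumes "distinct xs" "distinct ys" "set xs = set ys" "length ys = n"
  obtains \<sigma> where "\<sigma> permutes {..<n}" "permute_list \<sigma> ys = xs"
  using mset_eq_permutation[of xs ys] assms set_eq_iff_mset_eq_distinct by blast

lemma permute_list_distinct_inj:
  assumes "distinct xs" "length xs = n" "\<sigma> permutes {..<n}" "\<tau> permutes {..<n}"
    "permute_list \<sigma> xs = permute_list \<tau> xs"
  shows "\<sigma> = \<tau>"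
proof
  fix p
  show "\<sigma> p = \<tau> p"
  proof (cases "p < n")
    case True
    then have "xs ! \<sigma> p = xs ! \<tau> p" using assms by (metis permute_list_nth)
    moreover have "\<sigma> p < n" "\<tau> p < n"
      using True assms(3,4) permutes_in_image[of _ "{..<n}" p] by auto
    ultimately show ?thesis using assms(1,2) by (simp add: nth_eq_iff_index_eq)
  next
    case False
    then show ?thesis using assms(3,4) by (simp add: permutes_def)
  qed
qed

lemma asgn_eqI:
  assumes "distinct xs" "length xs = n" "\<sigma> permutes {..<n}" "permute_list \<sigma> (ref_list (set xs)) = xs"
  shows "asgn xs = of_int (sign \<sigma>)"
proof -
  have len: "length (ref_list (set xs)) = n"
    using length_ref_list[of "set xs"] distinct_card[OF assms(1)] assms(2) by simp
  have "(SOME \<sigma>. \<sigma> permutes {..<length xs} \<and> permute_list \<sigma> (ref_list (set xs)) = xs) = \<sigma>"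
    using assms len permute_list_distinct_inj[OF _ len] ref_list[of "set xs"]
    by (intro some_equality) auto
  then show ?thesis using assms(1) by (simp add: asgn_def)
qed

lemma asgn_cases:
  assumes "distinct xs"
  obtains \<sigma> where "\<sigma> permutes {..<length xs}" "permute_list \<sigma> (ref_list (set xs)) = xs"
    "asgn xs = of_int (sign \<sigma>)"
proof -
  have "length (ref_list (set xs)) = length xs"
    using length_ref_list[of "set xs"] distinct_card[OF assms(1)] by simp
  then obtain \<sigma> where "\<sigma> permutes {..<length xs}" "permute_list \<sigma> (ref_list (set xs)) = xs"
    using distinct_permutation[of xs "ref_list (set xs)"] assms ref_list[of "set xs"] by auto
  then show thesis using that asgn_eqI[OF assms] by blast
qed

lemma asgn_eq_0_iff [simp]: "asgn xs = 0 \<longleftrightarrow> \<not> distinct xs"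
  by (cases "distinct xs") (auto simp: asgn_def)

lemma sign_square: "of_int (sign \<sigma>) * of_int (sign \<sigma>) = (1::complex)"
  by (metis of_int_1 of_int_mult sign_idempotent)

lemma sign_square_left: "of_int (sign \<sigma>) * (of_int (sign \<sigma>) * x) = (x::complex)"
  by (simp add: sign_square flip: mult.assoc)

lemma asgn_square: "distinct xs \<Longrightarrow> asgn xs * asgn xs = 1"
  by (metis asgn_cases sign_square)

lemma cnj_asgn [simp]: "cnj (asgn xs) = asgn xs"
  by (simp add: asgn_def)

lemma permutes_permutation: "\<sigma> permutes {..<n::nat} \<Longrightarrow> permutation \<sigma>"
  by (rule permutes_imp_permutation) simp_all

lemma alternating_asgn: "alternating n asgn"
  unfolding alternating_def
proof (intro allI impI)
  fix xs :: "'a list" and \<sigma> assume \<sigma>: "length xs = n" "\<sigma> permutes {..<n}"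
  show "asgn (permute_list \<sigma> xs) = of_int (sign \<sigma>) * asgn xs"
  proof (cases "distinct xs")
    case True
    then obtain \<tau> where \<tau>: "\<tau> permutes {..<n}" "permute_list \<tau> (ref_list (set xs)) = xs"
      "asgn xs = of_int (sign \<tau>)"
      using asgn_cases \<sigma>(1) by metis
    have len: "length (ref_list (set xs)) = n"
      using length_ref_list[of "set xs"] distinct_card[OF True] \<sigma> by simp
    have "asgn (permute_list \<sigma> xs) = of_int (sign (\<tau> \<circ> \<sigma>))"
      using True \<sigma> \<tau> len
      by (intro asgn_eqI[of _ n]) (auto intro: permutes_compose simp: permute_list_compose)
    also have "sign (\<tau> \<circ> \<sigma>) = sign \<sigma> * sign \<tau>"
      using \<sigma> \<tau> by (simp add: sign_compose permutes_permutation)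
    finally show ?thesis using \<tau>(3) by simp
  next
    case False
    then show ?thesis using \<sigma> by (auto simp: asgn_def)
  qed
qed

lemma asgn_permute_list:
  "length xs = n \<Longrightarrow> \<sigma> permutes {..<n} \<Longrightarrow> asgn (permute_list \<sigma> xs) = of_int (sign \<sigma>) * asgn xs"
  using alternatingD[OF alternating_asgn] by blast

text \<open>On the orderings of one finite set an alternating function is determined by a single
  value, so it is a multiple of \<open>asgn\<close>; cross-multiplication saves a division.\<close>

lemma alternating_proportional:
  assumes "alternating n F" "distinct xs" "distinct ys" "set xs = set ys" "length ys = n"
  shows "F xs * asgn ys = F ys * asgn xs"
proof -
  obtain \<sigma> where "\<sigma> permutes {..<n}" "permute_list \<sigma> ys = xs"
    using distinct_permutation[OF assms(2-)] .
  then have "F xs = of_int (sign \<sigma>) * F ys" "asgn xs = of_int (sign \<sigma>) * asgn ys"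
    using alternatingD[OF assms(1)] asgn_permute_list assms(5) by blast+
  then show ?thesis by simp
qed

lemma count_list_permute_list [simp]:
  assumes "\<sigma> permutes {..<length xs}"
  shows "count_list (permute_list \<sigma> xs) = count_list xs"
  using mset_permute_list[OF assms] by (simp flip: count_mset_0_iff add: fun_eq_iff flip: count_mset)

lemma permute_list_in_words:
  "\<sigma> permutes {..<n} \<Longrightarrow> xs \<in> words n a \<Longrightarrow> permute_list \<sigma> xs \<in> words n a"
  by (auto simp: words_def)

lemma length_words: "xs \<in> words n a \<Longrightarrow> length xs = n"
  by (simp add: words_def)

lemma permute_list_inv:
  "\<sigma> permutes {..<n} \<Longrightarrow> length xs = n \<Longrightarrow> permute_list \<sigma> (permute_list (inv \<sigma>) xs) = xs"
  "\<sigma> permutes {..<n} \<Longrightarrow> length xs = n \<Longrightarrow> permute_list (inv \<sigma>) (permute_list \<sigma> xs) = xs"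
  using permute_list_compose[of \<sigma> xs "inv \<sigma>"] permute_list_compose[of "inv \<sigma>" xs \<sigma>]
  by (simp_all add: permutes_inv permutes_inv_o)

lemma bij_betw_permute_list_words:
  assumes "\<sigma> permutes {..<n}"
  shows "bij_betw (permute_list \<sigma>) (words n a) (words n a)"
  using assms
  by (intro bij_betw_byWitness[where f' = "permute_list (inv \<sigma>)"])
    (auto simp: permute_list_inv permute_list_in_words permutes_inv length_words)

lemma sum_permute_list_words:
  assumes "\<sigma> permutes {..<n}"
  shows "(\<Sum>xs\<in>words n a. g (permute_list \<sigma> xs)) = (\<Sum>xs\<in>words n a. g xs)"
  using sum.reindex_bij_betw[OF bij_betw_permute_list_words[OF assms]] .

lemma count_list_map_card:
  assumes "distinct w"
  shows "count_list (map f w) i = card {v \<in> set w. f v = i}"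
  using assms by (simp add: count_list_eq_length_filter filter_map o_def eq_commute
      distinct_card[OF distinct_filter, symmetric])

lemma count_list_map_fst:
  assumes "distinct (zs :: ('a \<times> 'b) list)"
  shows "count_list (map fst zs) i = card {v. (i, v) \<in> set zs}"
proof -
  have "{z \<in> set zs. fst z = i} = Pair i ` {v. (i, v) \<in> set zs}" by force
  then show ?thesis by (simp add: count_list_map_card[OF assms] card_image inj_on_def)
qed

lemma count_list_map_snd:
  assumes "distinct (zs :: ('a \<times> 'b) list)"
  shows "count_list (map snd zs) i = card {v. (v, i) \<in> set zs}"
proof -
  have "{z \<in> set zs. snd z = i} = (\<lambda>v. (v, i)) ` {v. (v, i) \<in> set zs}" by force
  then show ?thesis by (simp add: count_list_map_card[OF assms] card_image inj_on_def)
qed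

section \<open>Young diagrams and the spanning set of highest weight functions\<close>

lemma finite_column: "partition l \<Longrightarrow> finite {r. j < l r}"
  unfolding partition_def by (elim conjE) (erule finite_subset[rotated], auto)

lemma column_eq: "partition l \<Longrightarrow> {r. j < l r} = {..<col_length l j}"
proof -
  assume l: "partition l"
  have fin: "finite {r. j < l r}" using finite_column[OF l] .
  have dn: "r \<le> r' \<Longrightarrow> r' \<in> {r. j < l r} \<Longrightarrow> r \<in> {r. j < l r}" for r r'
    using l unfolding partition_def by (auto dest: antimonoD[of l r r'])
  obtain k where "{r. j < l r} = {..<k}"
  proof -
    define k where "k = (LEAST r. \<not> j < l r)"
    have ex: "\<exists>r. \<not> j < l r" using fin ex_new_if_finite[of "{r. j < l r}"] infinite_UNIV_nat by auto
    have "\<not> j < l k" unfolding k_def using ex by (rule LeastI_ex)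
    then have "r \<in> {r. j < l r} \<longleftrightarrow> r < k" for r
      using dn[of k r] not_less_Least[of r "\<lambda>r. \<not> j < l r"] unfolding k_def[symmetric]
      by (meson mem_Collect_eq not_le)
    then show thesis using that by blast
  qed
  then show ?thesis by (simp add: col_length_def)
qed

text \<open>Both inequalities place the cell in row \<open>r\<close> and column \<open>j\<close> in
  the Young diagram: the rows that meet a column form an initial segment because the parts
  decrease.\<close>

lemma less_col_length_iff: "partition l \<Longrightarrow> r < col_length l j \<longleftrightarrow> j < l r"
  using column_eq[of l j] by auto

text \<open>For every \<open>m\<close>, the column condition bounds the number of pairs in the first \<open>m\<close> rows by that of
  the Young diagram, and the row condition makes the two numbers equal; so equality holds in every
  column.\<close>

lemma zip_eq_diagram:
  assumes l: "partition l" and c: "c \<in> words n (col_length l)" and \<rho>: "\<rho> \<in> words n l"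
    and d: "distinct (zip c \<rho>)"
  shows "set (zip c \<rho>) = {(j, r). j < l r}"
proof -
  define S where "S = set (zip c \<rho>)"
  have len: "length c = n" "length \<rho> = n" using c \<rho> by (auto simp: words_def)
  have colS: "card {r. (j, r) \<in> S} = col_length l j" for j
    using count_list_map_fst[OF d, of j] c len by (simp add: S_def words_def)
  have rowS: "card {j. (j, r) \<in> S} = l r" for r
    using count_list_map_snd[OF d, of r] \<rho> len by (simp add: S_def words_def)
  have finS: "finite S" by (simp add: S_def)
  have finc: "finite {r. (j, r) \<in> S}" for j
    using finS by (rule finite_surj[of _ _ snd]) force
  have finr: "finite {j. (j, r) \<in> S}" for r
    using finS by (rule finite_surj[of _ _ fst]) force
  have bound: "j < l 0" if "(j, r) \<in> S" for j r
  proof -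
    have "card {r. (j, r) \<in> S} > 0" using that finc by (auto simp: card_gt_0_iff)
    then show ?thesis using colS[of j] less_col_length_iff[OF l, of 0 j] by simp
  qed
  have rowcount: "(\<Sum>j<l 0. card {r. r < m \<and> (j, r) \<in> T}) = (\<Sum>r<m. card {j. (j, r) \<in> T})"
    if "\<And>j r. (j, r) \<in> T \<Longrightarrow> j < l 0" for m and T :: "(nat \<times> nat) set"
  proof -
    have "(\<Sum>j<l 0. card {r. r < m \<and> (j, r) \<in> T}) = (\<Sum>j<l 0. \<Sum>r<m. if (j, r) \<in> T then 1 else 0)"
      by (intro sum.cong refl) (simp add: sum.If_cases Int_def)
    also have "\<dots> = (\<Sum>r<m. \<Sum>j<l 0. if (j, r) \<in> T then 1 else 0)"
      by (rule sum.swap)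
    also have "\<dots> = (\<Sum>r<m. card {j. (j, r) \<in> T})"
      using that by (intro sum.cong refl) (auto simp: sum.If_cases Int_def intro!: arg_cong[of _ _ card])
    finally show ?thesis .
  qed
  have eq: "card {r. r < m \<and> (j, r) \<in> S} = card {r. r < m \<and> j < l r}" for m j
  proof (cases "j < l 0")
    case True
    let ?D = "{(j, r). j < l r}"
    have le: "card {r. r < m \<and> (i, r) \<in> S} \<le> card {r. r < m \<and> i < l r}" for i
    proof -
      have "{r. r < m \<and> i < l r} = {..<min m (col_length l i)}"
        using less_col_length_iff[OF l] by auto
      moreover have "card {r. r < m \<and> (i, r) \<in> S} \<le> card {..<m}" by (intro card_mono) auto
      moreover have "card {r. r < m \<and> (i, r) \<in> S} \<le> col_length l i"
        unfolding colS[symmetric] by (intro card_mono finc) auto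
      ultimately show ?thesis by simp
    qed
    have "(\<Sum>j<l 0. card {r. r < m \<and> (j, r) \<in> S}) = (\<Sum>r<m. l r)"
      using rowcount[of S m] bound rowS by simp
    moreover have "(\<Sum>j<l 0. card {r. r < m \<and> (j, r) \<in> ?D}) = (\<Sum>r<m. l r)"
    proof -
      have "j < l r \<Longrightarrow> j < l 0" for j r
        using l antimonoD[of l 0 r] unfolding partition_def by simp
      then show ?thesis using rowcount[of ?D m] by simp
    qed
    ultimately show ?thesis
      using sum_mono_inv[of "\<lambda>j. card {r. r < m \<and> (j, r) \<in> S}" "{..<l 0}"
          "\<lambda>j. card {r. r < m \<and> j < l r}" j] le True by simp
  next
    case False
    then have "\<not> j < l r" for r
      using l unfolding partition_def by (auto dest: antimonoD[of l 0 r])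
    then show ?thesis using False bound by auto
  qed
  have step: "card {r. r < Suc m \<and> P r} = card {r. r < m \<and> P r} + (if P m then 1 else 0)"
    for m and P :: "nat \<Rightarrow> bool"
  proof -
    have "{r. r < Suc m \<and> P r} = {r. r < m \<and> P r} \<union> (if P m then {m} else {})"
      by (auto simp: less_Suc_eq)
    then show ?thesis by simp
  qed
  \<comment> \<open>Membership of row \<open>r\<close> is the difference of the counts below
    \<open>Suc r\<close> and below \<open>r\<close>.\<close>
  have "(j, r) \<in> S \<longleftrightarrow> j < l r" for j r
    using eq[of r j] eq[of "Suc r" j] by (simp add: step split: if_splits)
  then show ?thesis unfolding S_def by auto
qed

text \<open>If some term of \<open>raising i ?h d\<close> is nonzero, the assumption gives two
  positions at which the pairs of \<open>zip d ys\<close> coincide. Terms that change any other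
  position vanish, since the coincidence remains, and the terms at these two positions differ by a
  transposition and cancel.\<close>

lemma alternating_highest_weight:
  assumes F: "alternating n F" and ys: "length ys = n"
    and no: "\<And>d p i. p < n \<Longrightarrow> d ! p = i \<Longrightarrow> d[p := Suc i] \<in> words n a \<Longrightarrow>
      F (zip (d[p := Suc i]) ys) \<noteq> 0 \<Longrightarrow> \<not> distinct (zip d ys)"
  shows "highest_weight n a (\<lambda>d. if d \<in> words n a then F (zip d ys) else 0)"
    (is "highest_weight n a ?h")
  unfolding highest_weight_def
proof (intro conjI allI impI)
  show "xs \<in> words n a" if "?h xs \<noteq> 0" for xs using that by (simp split: if_splits)
next
  fix i :: nat and d :: "nat list"
  let ?I = "{p. p < length d \<and> d ! p = i}"
  show "raising i ?h d = 0"
  proof (cases "\<forall>k\<in>?I. ?h (d[k := Suc i]) = 0")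
    case True
    then show ?thesis unfolding raising_def by (intro sum.neutral)
  next
    case False
    then obtain k0 where k0: "k0 < length d" "d ! k0 = i" "?h (d[k0 := Suc i]) \<noteq> 0" by blast
    then have w: "d[k0 := Suc i] \<in> words n a" "F (zip (d[k0 := Suc i]) ys) \<noteq> 0"
      by (auto split: if_splits)
    have len: "length d = n" using length_words[OF w(1)] by simp
    have "\<not> distinct (zip d ys)" using no[of k0 d i] k0(1,2) w len by blast
    then obtain p q where pq: "p < n" "q < n" "p \<noteq> q" "d ! p = d ! q" "ys ! p = ys ! q"
      using len ys by (auto simp: distinct_conv_nth)
    have rest: "?h (d[k := Suc i]) = 0" if "k \<in> ?I" "k \<notin> {p, q}" for k
    proof -
      have "zip (d[k := Suc i]) ys ! p = zip (d[k := Suc i]) ys ! q"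
        using that pq len ys by simp
      then have "\<not> distinct (zip (d[k := Suc i]) ys)"
        using pq(1-3) len ys by (auto simp: distinct_conv_nth)
      then have "F (zip (d[k := Suc i]) ys) = 0" using len ys by (intro alternating_eq_0[OF F]) simp
      then show ?thesis by simp
    qed
    \<comment> \<open>A nonzero term must destroy the coincidence, so it changes \<open>p\<close> or
      \<open>q\<close>; then both positions carry the letter \<open>i\<close>.\<close>
    have "k0 \<in> {p, q}" using rest[of k0] k0 by blast
    then have pI: "p \<in> ?I" and qI: "q \<in> ?I" using pq len k0 by auto
    let ?t = "Transposition.transpose p q"
    have t: "?t permutes {..<n}" using pq by (intro permutes_transpose_lessThan)
    have dt: "permute_list ?t (d[p := Suc i]) = d[q := Suc i]"
    proof -
      have "permute_list ?t (d[p := Suc i]) = d[p := Suc i, p := d[p := Suc i] ! q, q := d[p := Suc i] ! p]"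
        using pq len by (intro permute_list_transpose) auto
      also have "\<dots> = d[p := d ! p, q := Suc i]" using pq len by simp
      finally show ?thesis by simp
    qed
    have yt: "permute_list ?t ys = ys" using pq ys by (intro permute_list_transpose_eq) auto
    have "d[q := Suc i] \<in> words n a \<longleftrightarrow> d[p := Suc i] \<in> words n a"
      using t len unfolding dt[symmetric] by (simp add: words_def)
    moreover have "permute_list ?t (zip (d[p := Suc i]) ys) = zip (d[q := Suc i]) ys"
      using t len ys by (subst permute_list_zip[of _ "{..<n}"]) (auto simp: dt yt)
    then have "F (zip (d[q := Suc i]) ys) = - F (zip (d[p := Suc i]) ys)"
      using alternatingD[OF F _ t, of "zip (d[p := Suc i]) ys"] len ys pq(3) by (simp add: sign_swap_id)
    ultimately have neg: "?h (d[q := Suc i]) = - ?h (d[p := Suc i])" by auto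
    have "raising i ?h d = (\<Sum>k\<in>{p, q}. ?h (d[k := Suc i]))"
      unfolding raising_def
    proof (rule sum.mono_neutral_right)
      show "{p, q} \<subseteq> ?I" using pI qI by blast
      show "\<forall>k\<in>?I - {p, q}. ?h (d[k := Suc i]) = 0" using rest by blast
    qed simp
    also have "\<dots> = ?h (d[p := Suc i]) + ?h (d[q := Suc i])" using pq(3) by simp
    also have "\<dots> = 0" unfolding neg by (rule add.right_inverse)
    finally show ?thesis .
  qed
qed

definition dual_polytab :: "nat \<Rightarrow> (nat \<Rightarrow> nat) \<Rightarrow> nat list \<Rightarrow> nat list \<Rightarrow> complex" where
  "dual_polytab n l \<rho> c = (if c \<in> words n (col_length l) then asgn (zip c \<rho>) else 0)"

text \<open>The pairs of a word in the support fill the Young diagram. Moving one cell a column to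
  the left lands on another cell of the diagram, which is already taken; this is the repetition that
  \<open>alternating_highest_weight\<close> asks for.\<close>

lemma highest_weight_dual_polytab:
  assumes l: "partition l" and \<rho>: "\<rho> \<in> words n l"
  shows "highest_weight n (col_length l) (dual_polytab n l \<rho>)"
  unfolding dual_polytab_def
proof (rule alternating_highest_weight[OF alternating_asgn])
  show len\<rho>: "length \<rho> = n" using \<rho> by (rule length_words)
  fix d p i assume p: "p < n" "d ! p = i" and w: "d[p := Suc i] \<in> words n (col_length l)"
    and "asgn (zip (d[p := Suc i]) \<rho>) \<noteq> 0"
  then have diag: "set (zip (d[p := Suc i]) \<rho>) = {(j, r). j < l r}"
    by (intro zip_eq_diagram[OF l w \<rho>]) simp
  have len: "length d = n" using length_words[OF w] by simp
  have "(Suc i, \<rho> ! p) \<in> set (zip (d[p := Suc i]) \<rho>)"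
    using p(1) len len\<rho> by (auto simp: in_set_zip intro!: exI[of _ p])
  then have "(i, \<rho> ! p) \<in> set (zip (d[p := Suc i]) \<rho>)" unfolding diag by simp
  then obtain q where q: "q < n" "d[p := Suc i] ! q = i" "\<rho> ! q = \<rho> ! p"
    using len len\<rho> by (auto simp: in_set_zip)
  then have "q \<noteq> p" "d ! q = i" using p len by (auto simp: nth_list_update split: if_splits)
  then show "\<not> distinct (zip d \<rho>)"
    using nth_eq_iff_index_eq[of "zip d \<rho>" p q] p q(1,3) len len\<rho> by auto
qed

text \<open>Each position receives as its row the number of later occurrences of its letter, so from
  right to left every column is filled from the top. For a ballot word each new cell is the last one
  of its row among the cells placed so far.\<close>

primrec row_word :: "nat list \<Rightarrow> nat list" where
  "row_word [] = []"
| "row_word (k # xs) = count_list xs k # row_word xs"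

lemma length_row_word [simp]: "length (row_word c) = length c"
  by (induction c) auto

lemma set_zip_row_word: "set (zip c (row_word c)) = {(j, r). r < count_list c j}"
  by (induction c) (auto split: if_splits)

lemma distinct_zip_row_word: "distinct (zip c (row_word c))"
  by (induction c) (auto simp: set_zip_row_word)

lemma row_word_in_words:
  assumes l: "partition l" and c: "c \<in> words n (col_length l)"
  shows "row_word c \<in> words n l"
proof -
  have "count_list (row_word c) r = l r" for r
  proof -
    have "count_list (row_word c) r = card {j. (j, r) \<in> set (zip c (row_word c))}"
      using count_list_map_snd[OF distinct_zip_row_word[of c], of r] by simp
    also have "{j. (j, r) \<in> set (zip c (row_word c))} = {..<l r}"
      using c less_col_length_iff[OF l] by (auto simp: set_zip_row_word words_def)
    finally show ?thesis by simp
  qed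
  then show ?thesis using c by (auto simp: words_def)
qed

text \<open>In a filling whose rows are prescribed by \<open>row_word c\<close>, the first entry can only be moved to the
  left, because it sits at the end of its row.\<close>

lemma row_word_leading:
  assumes "ballot c" "length c' = length c" "distinct (zip c' (row_word c))"
    "set (zip c' (row_word c)) = set (zip c (row_word c))"
  shows "c' = c \<or> (c', c) \<in> lex less_than"
  using assms
proof (induction c arbitrary: c')
  case Nil
  then show ?case by simp
next
  case (Cons k xs)
  obtain k' ys where c': "c' = k' # ys" "length ys = length xs"
    using Cons.prems(2) by (cases c') auto
  show ?case
  proof (cases "k' = k")
    case True
    have "(k, count_list xs k) \<notin> set (zip xs (row_word xs))" by (simp add: set_zip_row_word)
    moreover have "(k, count_list xs k) \<notin> set (zip ys (row_word xs))"
      using Cons.prems(3) c' True by simp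
    ultimately have "set (zip ys (row_word xs)) = set (zip xs (row_word xs))"
      using Cons.prems(4) c' True by (simp add: insert_ident)
    then have "ys = xs \<or> (ys, xs) \<in> lex less_than"
      using Cons.IH[of ys] Cons.prems c' by simp
    then show ?thesis using True c' by auto
  next
    case False
    have "(k', count_list xs k) \<in> set (zip (k # xs) (row_word (k # xs)))"
      using Cons.prems(4) c' by (metis row_word.simps(2) zip_Cons_Cons list.set_intros(1))
    \<comment> \<open>Column \<open>k'\<close> contains row \<open>count_list xs k\<close> in the
      diagram of \<open>k # xs\<close>, and it has the same length in the diagram of
      \<open>xs\<close> because the extra cell lies in column \<open>k\<close>.\<close>
    then have "count_list xs k < count_list xs k'"
      unfolding set_zip_row_word using False by simp
    moreover have "antimono (count_list xs)"
      using Cons.prems(1) by (cases xs) (auto simp: antimono_def)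
    ultimately have "k' < k" using antimonoD[of "count_list xs" k k'] by linarith
    then show ?thesis using c' by simp
  qed
qed

lemma fun_scale_apply: "fun_scale c f x = c * f x"
  by (simp add: fun_scale_def)

lemma raising_diff_scale:
  "raising i (\<lambda>x. f x - k * g x) d = raising i f d - k * raising i g d"
  by (simp add: raising_def sum_subtractf sum_distrib_left)

lemma highest_weight_diff:
  assumes "highest_weight n a f" "highest_weight n a g"
  shows "highest_weight n a (\<lambda>x. f x - k * g x)"
  unfolding highest_weight_def
proof (intro conjI allI impI)
  fix x assume "f x - k * g x \<noteq> 0"
  then have "f x \<noteq> 0 \<or> g x \<noteq> 0" by auto
  then show "x \<in> words n a" using assms by (auto simp: highest_weight_def)
next
  show "raising i (\<lambda>x. f x - k * g x) d = 0" for i d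
    using assms by (simp add: raising_diff_scale highest_weight_def)
qed

text \<open>Elimination on the leading word. It is a ballot word \<open>c\<close>, and
  \<open>dual_polytab n l (row_word c)\<close> has the same leading word; subtracting the right
  multiple leaves zero or a function with a smaller leading word. This terminates because
  \<open>lex less_than\<close> is well-founded.\<close>

lemma highest_weight_in_span:
  assumes l: "partition l" and f: "highest_weight n (col_length l) f"
  shows "f \<in> fun_space.span (dual_polytab n l ` words n l)"
proof (cases "f = (\<lambda>_. 0)")
  case True
  then show ?thesis using fun_space.span_zero by (simp add: zero_fun_def)
next
  case False
  define leading where "leading = (\<lambda>f c. f c \<noteq> 0 \<and> ballot c \<and>
     (\<forall>c'. f c' \<noteq> (0::complex) \<longrightarrow> c' = c \<or> (c', c) \<in> lex less_than))"
  have "wf (lex less_than)" by (intro wf_lex) simp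
  then have main: "\<forall>f. highest_weight n (col_length l) f \<longrightarrow> leading f c \<longrightarrow>
      f \<in> fun_space.span (dual_polytab n l ` words n l)" for c
  proof (induction c rule: wf_induct_rule)
    case (less c)
    show ?case
    proof (intro allI impI)
      fix f assume f: "highest_weight n (col_length l) f" and lead: "leading f c"
      define b where "b = dual_polytab n l (row_word c)"
      define g where "g = (\<lambda>x. f x - f c / b c * b x)"
      have cw: "c \<in> words n (col_length l)"
        using f lead by (auto simp: highest_weight_def leading_def)
      have \<rho>: "row_word c \<in> words n l" using row_word_in_words[OF l cw] .
      have bc: "b c \<noteq> 0" using cw distinct_zip_row_word by (simp add: b_def dual_polytab_def)
      have bS: "b \<in> fun_space.span (dual_polytab n l ` words n l)"
        unfolding b_def using \<rho> by (intro fun_space.span_base) auto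
      have hwg: "highest_weight n (col_length l) g"
        unfolding g_def b_def
        using highest_weight_diff[OF f highest_weight_dual_polytab[OF l \<rho>]] by blast
      \<comment> \<open>The words in the support of \<open>b\<close> fill the diagram when paired
        with \<open>row_word c\<close>; as \<open>c\<close> is a ballot word,
        \<open>row_word_leading\<close> bounds them by \<open>c\<close>.\<close>
      have b_lead: "c' = c \<or> (c', c) \<in> lex less_than" if "b c' \<noteq> 0" for c'
      proof -
        have c': "c' \<in> words n (col_length l)" "distinct (zip c' (row_word c))"
          using that by (auto simp: b_def dual_polytab_def split: if_splits)
        show ?thesis
          using row_word_leading[of c c'] lead c' cw zip_eq_diagram[OF l _ \<rho>] distinct_zip_row_word
          by (simp add: leading_def length_words)
      qed
      have "g \<in> fun_space.span (dual_polytab n l ` words n l)"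
      proof (cases "g = (\<lambda>_. 0)")
        case True
        then show ?thesis using fun_space.span_zero by (simp add: zero_fun_def)
      next
        case False
        obtain c2 where c2: "leading g c2"
          using highest_weight_leading_word[OF hwg False] unfolding leading_def by blast
        have "g c = 0" using bc by (simp add: g_def)
        then have "c2 \<noteq> c" using c2 by (auto simp: leading_def)
        moreover have "f c2 \<noteq> 0 \<or> b c2 \<noteq> 0"
          using c2 by (auto simp: leading_def g_def)
        ultimately have "(c2, c) \<in> lex less_than"
          using b_lead lead by (auto simp: leading_def)
        then show ?thesis using less hwg c2 by blast
      qed
      moreover have "f = g + fun_scale (f c / b c) b"
        by (auto simp: g_def fun_scale_apply)
      ultimately show "f \<in> fun_space.span (dual_polytab n l ` words n l)"
        using bS by (metis fun_space.span_add fun_space.span_scale)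
    qed
  qed
  show ?thesis
    using highest_weight_leading_word[OF f False] main f unfolding leading_def by blast
qed

lemma linear_maps_span:
  assumes L: "\<And>f g. L (f + g) = L f + L g" "\<And>k f. L (fun_scale k f) = fun_scale k (L f)"
    and S: "fun_space.subspace S" and B: "\<And>b. b \<in> B \<Longrightarrow> L b \<in> S" and f: "f \<in> fun_space.span B"
  shows "L f \<in> S"
proof -
  have "L 0 = 0" using L(1)[of 0 0] by simp
  then have "fun_space.subspace {f. L f \<in> S}"
    using L fun_space.subspace_0[OF S] fun_space.subspace_add[OF S] fun_space.subspace_scale[OF S]
    by (intro fun_space.subspaceI) (simp_all only: mem_Collect_eq)
  then have "fun_space.span B \<subseteq> {f. L f \<in> S}"
    using B by (intro fun_space.span_minimal) blast+
  then show ?thesis using f by blast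
qed

definition ip :: "'x set \<Rightarrow> ('x \<Rightarrow> complex) \<Rightarrow> ('x \<Rightarrow> complex) \<Rightarrow> complex" where
  "ip X f g = (\<Sum>x\<in>X. f x * cnj (g x))"

lemma ip_add_left: "ip X (f + f') g = ip X f g + ip X f' g"
  and ip_diff_left: "ip X (f - f') g = ip X f g - ip X f' g"
  and ip_scale_left: "ip X (fun_scale k f) g = k * ip X f g"
  and ip_add_right: "ip X f (g + g') = ip X f g + ip X f g'"
  and ip_diff_right: "ip X f (g - g') = ip X f g - ip X f g'"
  and ip_scale_right: "ip X f (fun_scale k g) = cnj k * ip X f g"
  by (simp_all add: ip_def fun_scale_apply algebra_simps sum.distrib sum_subtractf sum_distrib_left)

lemma ip_zero [simp]: "ip X 0 g = 0" "ip X f 0 = 0"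
  by (simp_all add: ip_def)

lemma ip_eq_0_imp:
  assumes "finite X" "ip X f f = 0" "x \<in> X"
  shows "f x = 0"
proof -
  have "complex_of_real (\<Sum>x\<in>X. (cmod (f x))\<^sup>2) = 0"
    using assms(2) by (simp only: of_real_sum complex_norm_square ip_def)
  then have "(\<Sum>x\<in>X. (cmod (f x))\<^sup>2) = 0" by (simp only: of_real_eq_0_iff)
  then have "\<forall>x\<in>X. f x = 0" using assms(1) by (simp add: sum_nonneg_eq_0_iff)
  then show ?thesis using assms(3) by blast
qed

lemma ip_span_right_0:
  assumes "\<And>b. b \<in> B \<Longrightarrow> ip X w b = 0" "v \<in> fun_space.span B"
  shows "ip X w v = 0"
  using assms(2)
  by (induction rule: fun_space.span_induct)
    (intro fun_space.subspaceI, simp_all add: ip_add_right ip_scale_right assms(1))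

text \<open>The hypothesis uses the bilinear pairing, which is not definite over the complex
  numbers. For real \<open>b\<close> it coincides with the Hermitian one, so \<open>f\<close> is
  orthogonal to the span of \<open>B\<close>, hence to itself.\<close>

lemma real_span_orthogonal_eq_0:
  assumes f: "f \<in> fun_space.span B" and X: "finite X"
    and real: "\<And>b x. b \<in> B \<Longrightarrow> cnj (b x) = b x"
    and orth: "\<And>b. b \<in> B \<Longrightarrow> (\<Sum>x\<in>X. b x * f x) = 0"
    and supp: "\<And>x. x \<notin> X \<Longrightarrow> f x = 0"
  shows "f x = 0"
proof -
  have "ip X f b = 0" if "b \<in> B" for b
    using orth[OF that] real[OF that] by (simp add: ip_def mult.commute)
  then have "ip X f f = 0" using f by (rule ip_span_right_0)
  then show ?thesis using ip_eq_0_imp[OF X] supp by blast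
qed

text \<open>The functions used for testing are the ones that span, by
  \<open>highest_weight_in_span\<close>. Injectivity of \<open>form_hom\<close> is obtained from
  this one coordinate at a time.\<close>

lemma highest_weight_orthogonal_eq_0:
  assumes l: "partition l" and f: "highest_weight n (col_length l) f"
    and orth: "\<And>\<rho>. \<rho> \<in> words n l \<Longrightarrow> (\<Sum>c\<in>words n (col_length l). asgn (zip c \<rho>) * f c) = 0"
  shows "f c = 0"
proof (rule real_span_orthogonal_eq_0[OF highest_weight_in_span[OF l f] finite_words[of n "col_length l"]])
  show "cnj (b x) = b x" if "b \<in> dual_polytab n l ` words n l" for b x
    using that by (auto simp: dual_polytab_def)
  show "(\<Sum>x\<in>words n (col_length l). b x * f x) = 0" if b: "b \<in> dual_polytab n l ` words n l" for b
  proof -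
    obtain \<rho> where "\<rho> \<in> words n l" "b = dual_polytab n l \<rho>" using b by auto
    then show ?thesis using orth[of \<rho>] by (simp add: dual_polytab_def)
  qed
  show "f x = 0" if "x \<notin> words n (col_length l)" for x
    using f that by (auto simp: highest_weight_def)
qed

section \<open>Complete reducibility and multiplicities\<close>

text \<open>A finite spanning set is required because \<open>dim\<close> is not informative on
  infinite-dimensional spaces.\<close>

lemma fun_space_dim_less:
  assumes U: "fun_space.subspace U" "U \<subseteq> W" "U \<noteq> W"
    and fin: "finite B" "W \<subseteq> fun_space.span B"
  shows "fun_space.dim U < fun_space.dim W"
proof -
  obtain BU where BU: "BU \<subseteq> U" "fun_space.independent BU" "U \<subseteq> fun_space.span BU" "card BU = fun_space.dim U"
    using fun_space.basis_exists by blast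
  obtain BW where BW: "BW \<subseteq> W" "fun_space.independent BW" "W \<subseteq> fun_space.span BW" "card BW = fun_space.dim W"
    using fun_space.basis_exists by blast
  obtain w where w: "w \<in> W" "w \<notin> U" using U by blast
  have "fun_space.span BU = U"
    using fun_space.span_subspace[OF BU(1,3) U(1)] .
  then have ind: "fun_space.independent (insert w BU)"
    using w BU(2) by (intro fun_space.independent_insertI) auto
  have "BW \<subseteq> fun_space.span B" using BW(1) fin(2) by simp
  then have "finite BW"
    using fun_space.independent_span_bound[OF fin(1) BW(2)] by simp
  moreover have "insert w BU \<subseteq> fun_space.span BW" using w(1) BU(1) U(2) BW(3) by auto
  ultimately have "finite (insert w BU) \<and> card (insert w BU) \<le> card BW"
    by (intro fun_space.independent_span_bound[OF _ ind])
  moreover have "w \<notin> BU" using w(2) BU(1) by auto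
  ultimately show ?thesis using BU(4) BW(4) by (metis card_insert_disjoint finite_insert not_less_eq_eq not_le)
qed

text \<open>Gram-Schmidt along \<open>B\<close>: project \<open>w\<close> and the new vector
  \<open>b\<close> to the old span and correct by the component along \<open>d = b - p\<close>. The
  form \<open>ip X\<close> ignores values outside \<open>X\<close>, so it is only
  semidefinite.\<close>

lemma orthogonal_projection_exists:
  assumes X: "finite X" and "finite B"
  shows "\<exists>u\<in>fun_space.span B. \<forall>b\<in>B. ip X (w - u) b = 0"
  using assms(2)
proof (induction B arbitrary: w rule: finite_induct)
  case empty
  then show ?case by (auto intro: fun_space.span_zero)
next
  case (insert b B)
  obtain p where p: "p \<in> fun_space.span B" "\<And>b'. b' \<in> B \<Longrightarrow> ip X (b - p) b' = 0"
    using insert.IH[of b] by blast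
  obtain q where q: "q \<in> fun_space.span B" "\<And>b'. b' \<in> B \<Longrightarrow> ip X (w - q) b' = 0"
    using insert.IH[of w] by blast
  define d where "d = b - p"
  define k where "k = ip X (w - q) d / ip X d d"
  define u where "u = q + fun_scale k d"
  have sub: "fun_space.span B \<subseteq> fun_space.span (insert b B)"
    by (intro fun_space.span_mono) auto
  have "d \<in> fun_space.span (insert b B)"
    unfolding d_def using p(1) sub fun_space.span_base[of b "insert b B"]
    by (intro fun_space.span_diff) auto
  then have "u \<in> fun_space.span (insert b B)"
    unfolding u_def using q(1) sub by (intro fun_space.span_add fun_space.span_scale) auto
  moreover have orthB: "ip X (w - u) b' = 0" if "b' \<in> B" for b'
    using that p(2) q(2) by (simp add: u_def d_def ip_diff_left ip_add_left ip_scale_left)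
  moreover have "ip X (w - u) b = 0"
  proof -
    have "ip X (w - u) d = 0"
    proof (cases "ip X d d = 0")
      \<comment> \<open>Here \<open>d\<close> vanishes on \<open>X\<close> and pairs to zero with
        everything; \<open>k\<close> is 0 as a quotient by zero, so no correction is made.\<close>
      case True
      then have "ip X f d = 0" for f
        using ip_eq_0_imp[OF X True] by (simp add: ip_def)
      then show ?thesis .
    next
      case False
      have "w - u = (w - q) - fun_scale k d" by (simp add: u_def)
      then have "ip X (w - u) d = ip X (w - q) d - k * ip X d d"
        by (simp only: ip_diff_left ip_scale_left)
      then show ?thesis using False by (simp add: k_def)
    qed
    moreover have "ip X (w - u) p = 0"
      using ip_span_right_0[OF orthB p(1)] by blast
    ultimately show ?thesis
      using ip_add_right[of X "w - u" d p] by (simp add: d_def)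
  qed
  ultimately show ?case by blast
qed

lemma sum_apply: "(\<Sum>i\<in>I. h i) x = (\<Sum>i\<in>I. h i x)" for h :: "'i \<Rightarrow> 'x \<Rightarrow> complex"
  by (induction I rule: infinite_finite_induct) auto

lemma finite_support_in_span:
  assumes "finite X" "\<And>x. x \<notin> X \<Longrightarrow> f x = 0"
  shows "f \<in> fun_space.span ((\<lambda>x y. if y = x then 1 else 0) ` X)"
proof -
  have "f = (\<Sum>x\<in>X. fun_scale (f x) (\<lambda>y. if y = x then 1 else 0))"
  proof
    fix y
    show "f y = (\<Sum>x\<in>X. fun_scale (f x) (\<lambda>y. if y = x then 1 else 0)) y"
      using assms by (cases "y \<in> X") (auto simp: sum_apply fun_scale_apply if_distrib sum.delta cong: if_cong)
  qed
  also have "\<dots> \<in> fun_space.span ((\<lambda>x y. if y = x then 1 else 0) ` X)"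
    by (intro fun_space.span_sum fun_space.span_scale fun_space.span_base) auto
  finally show ?thesis .
qed

text \<open>In the application the adjoint of \<open>act g\<close> is the action of the inverse of \<open>g\<close>.\<close>

definition unitary_action :: "'g set \<Rightarrow> ('g \<Rightarrow> ('x \<Rightarrow> complex) \<Rightarrow> 'x \<Rightarrow> complex) \<Rightarrow> 'x set \<Rightarrow> bool" where
  "unitary_action G act X \<longleftrightarrow>
     (\<forall>g\<in>G. \<exists>h\<in>G. \<forall>u v. ip X (act g u) v = ip X u (act h v))"

text \<open>The core of Maschke's theorem, with an inner product in place of averaging: pairing
  \<open>act g w\<close> with a vector of \<open>U\<close> amounts to pairing \<open>w\<close> with
  its image under \<open>act h\<close>, which lies in \<open>U\<close> again.\<close>

lemma invariant_complement:
  assumes act: "unitary_action G act X" and W: "invariant_subspace G act W" and U: "invariant_subspace G act U"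
  shows "invariant_subspace G act {w\<in>W. \<forall>u\<in>U. ip X w u = 0}"
  unfolding invariant_subspace_def
proof (intro conjI ballI)
  have W': "fun_space.subspace W" using W by (simp add: invariant_subspace_def)
  show "fun_space.subspace {w\<in>W. \<forall>u\<in>U. ip X w u = 0}"
    using fun_space.subspace_0[OF W'] fun_space.subspace_add[OF W'] fun_space.subspace_scale[OF W']
    by (intro fun_space.subspaceI) (auto simp: ip_add_left ip_scale_left)
  fix g w assume g: "g \<in> G" and w: "w \<in> {w\<in>W. \<forall>u\<in>U. ip X w u = 0}"
  obtain h where h: "h \<in> G" "\<And>u v. ip X (act g u) v = ip X u (act h v)"
    using act g unfolding unitary_action_def by blast
  show "act g w \<in> {w\<in>W. \<forall>u\<in>U. ip X w u = 0}"
    using g w h W U unfolding invariant_subspace_def by auto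
qed

text \<open>A nonzero invariant subspace of least dimension has no smaller one inside.\<close>

lemma irreducible_subspace_exists:
  assumes W: "invariant_subspace G act W" "W \<noteq> {0}" and fin: "finite B" "W \<subseteq> fun_space.span B"
  shows "\<exists>U\<subseteq>W. irreducible_subspace G act U"
proof -
  let ?P = "\<lambda>U. invariant_subspace G act U \<and> U \<noteq> {0} \<and> U \<subseteq> W"
  have "?P W" using W by simp
  from ex_has_least_nat[of ?P, OF this, of fun_space.dim]
  obtain U where U: "?P U" "\<And>U'. ?P U' \<Longrightarrow> fun_space.dim U \<le> fun_space.dim U'" by blast
  have "U' = {0} \<or> U' = U" if "invariant_subspace G act U'" "U' \<subseteq> U" for U'
  proof (rule ccontr)
    assume *: "\<not> ?thesis"
    then have "fun_space.dim U' < fun_space.dim U"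
      using that U(1) fin by (intro fun_space_dim_less[OF _ _ _ fin(1)]) (auto simp: invariant_subspace_def)
    moreover have "fun_space.dim U \<le> fun_space.dim U'" using U * that by blast
    ultimately show False by simp
  qed
  then show ?thesis using U(1) unfolding irreducible_subspace_def by blast
qed

text \<open>Split off an irreducible subspace and decompose its orthogonal complement
  \<open>C\<close>, whose dimension is smaller. Functions in \<open>W\<close> vanish outside
  \<open>X\<close>, which makes \<open>ip X\<close> definite on \<open>W\<close> and the sum of
  \<open>U\<close> and \<open>C\<close> direct.\<close>

lemma irreducible_decomposition_exists:
  assumes act: "unitary_action G act X" and X: "finite X"
    and "invariant_subspace G act W" and "\<And>w x. w \<in> W \<Longrightarrow> x \<notin> X \<Longrightarrow> w x = 0"
  shows "\<exists>D. irreducible_decomposition G act W D"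
  using assms(3,4)
proof (induction "fun_space.dim W" arbitrary: W rule: less_induct)
  case (less W)
  let ?E = "(\<lambda>x y. if y = x then 1 else (0::complex)) ` X"
  have fin: "finite ?E" using X by simp
  have sp: "W \<subseteq> fun_space.span ?E" using finite_support_in_span[OF X] less.prems(2) by blast
  have Wsub: "fun_space.subspace W" using less.prems(1) by (simp add: invariant_subspace_def)
  show ?case
  proof (cases "W = {0}")
    case True
    then have "irreducible_decomposition G act W {}"
      by (simp add: irreducible_decomposition_def)
    then show ?thesis by blast
  next
    case False
    obtain U where U: "U \<subseteq> W" "irreducible_subspace G act U"
      using irreducible_subspace_exists[OF less.prems(1) False fin sp] by blast
    then have Uinv: "invariant_subspace G act U" and U0: "U \<noteq> {0}"
      by (auto simp: irreducible_subspace_def)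
    then have Usub: "fun_space.subspace U" by (simp add: invariant_subspace_def)
    define C where "C = {w\<in>W. \<forall>u\<in>U. ip X w u = 0}"
    have Cinv: "invariant_subspace G act C"
      unfolding C_def by (rule invariant_complement[OF act less.prems(1) Uinv])
    then have Csub: "fun_space.subspace C" by (simp add: invariant_subspace_def)
    have UC: "u = 0" if "u \<in> U" "u \<in> C" for u
    proof
      fix x
      show "u x = 0 x"
        using that U(1) less.prems(2)[of u x] ip_eq_0_imp[OF X, of u x] by (auto simp: C_def)
    qed
    have "C \<noteq> W"
      using UC U(1) U0 fun_space.subspace_0[OF Usub] by auto
    then have "fun_space.dim C < fun_space.dim W"
      by (intro fun_space_dim_less[OF Csub _ _ fin sp]) (auto simp: C_def)
    then obtain D where D: "irreducible_decomposition G act C D"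
      using less.hyps[OF _ Cinv] less.prems(2) by (auto simp: C_def)
    have spanD: "fun_space.span (\<Union>D) = C" and finD: "finite D"
      using D by (auto simp: irreducible_decomposition_def)
    have subC: "U' \<subseteq> C" if "U' \<in> D" for U'
      using that spanD fun_space.span_superset[of "\<Union>D"] by auto
    have notin: "U \<notin> D"
      using subC UC U0 fun_space.subspace_0[OF Usub] by auto
    have "irreducible_decomposition G act W (insert U D)"
      unfolding irreducible_decomposition_def
    proof (intro conjI)
      show "finite (insert U D)" using finD by simp
      show "\<forall>U\<in>insert U D. irreducible_subspace G act U"
        using D U(2) by (auto simp: irreducible_decomposition_def)
      show "fun_space.span (\<Union> (insert U D)) = W"
      proof
        show "fun_space.span (\<Union> (insert U D)) \<subseteq> W"
        proof (rule fun_space.span_minimal[OF _ Wsub])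
          have "C \<subseteq> W" by (auto simp: C_def)
          then show "\<Union> (insert U D) \<subseteq> W" using U(1) subC by blast
        qed
        show "W \<subseteq> fun_space.span (\<Union> (insert U D))"
        proof
          fix w assume w: "w \<in> W"
          obtain B where B: "B \<subseteq> U" "fun_space.independent B" "U \<subseteq> fun_space.span B"
            by (rule fun_space.basis_exists)
          have "finite B"
            using fun_space.independent_span_bound[OF fin B(2)] B(1) U(1) sp by blast
          then obtain u where u: "u \<in> fun_space.span B" "\<And>b. b \<in> B \<Longrightarrow> ip X (w - u) b = 0"
            using orthogonal_projection_exists[OF X] by blast
          have uU: "u \<in> U" using u(1) B(1) Usub fun_space.span_minimal by blast
          have "ip X (w - u) v = 0" if "v \<in> U" for v
            using ip_span_right_0[of B X "w - u" v] u(2) B(3) that by blast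
          then have "w - u \<in> C"
            using w uU U(1) fun_space.subspace_diff[OF Wsub] by (auto simp: C_def)
          then have "w - u \<in> fun_space.span (\<Union> (insert U D))"
            unfolding spanD[symmetric] by (rule subsetD[OF fun_space.span_mono, rotated]) auto
          moreover have "u \<in> fun_space.span (\<Union> (insert U D))"
            using uU by (intro fun_space.span_base) auto
          ultimately show "w \<in> fun_space.span (\<Union> (insert U D))"
            using fun_space.span_add by fastforce
        qed
      qed
      show "\<forall>u. (\<forall>V\<in>insert U D. u V \<in> V) \<and> (\<Sum>V\<in>insert U D. u V) = 0 \<longrightarrow> (\<forall>V\<in>insert U D. u V = 0)"
      proof (intro allI impI, elim conjE)
        fix u assume u: "\<forall>V\<in>insert U D. u V \<in> V" and s: "(\<Sum>V\<in>insert U D. u V) = 0"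
        have s': "u U + (\<Sum>V\<in>D. u V) = 0" using s finD notin by simp
        have "(\<Sum>V\<in>D. u V) \<in> C"
          using u subC by (intro fun_space.subspace_sum[OF Csub]) auto
        moreover have "u U = - (\<Sum>V\<in>D. u V)" using s' by (simp add: eq_neg_iff_add_eq_0)
        ultimately have "u U \<in> C" using fun_space.subspace_neg[OF Csub] by simp
        then have U0: "u U = 0" using u UC by blast
        then have "(\<Sum>V\<in>D. u V) = 0" using s' by (metis add.left_neutral)
        moreover have "\<forall>u. (\<forall>V\<in>D. u V \<in> V) \<and> (\<Sum>V\<in>D. u V) = 0 \<longrightarrow> (\<forall>V\<in>D. u V = 0)"
          using D unfolding irreducible_decomposition_def by (elim conjE)
        ultimately have "\<forall>V\<in>D. u V = 0" using u by (metis insertCI)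
        with U0 show "\<forall>V\<in>insert U D. u V = 0" by blast
      qed
    qed
    then show ?thesis by blast
  qed
qed

section \<open>Homomorphisms, Schur's lemma and counting isomorphic summands\<close>

definition linear_action :: "'g set \<Rightarrow> ('g \<Rightarrow> ('x \<Rightarrow> complex) \<Rightarrow> 'x \<Rightarrow> complex) \<Rightarrow> bool" where
  "linear_action G act \<longleftrightarrow>
     (\<forall>g\<in>G. (\<forall>u v. act g (u + v) = act g u + act g v) \<and>
            (\<forall>k u. act g (fun_scale k u) = fun_scale k (act g u)))"

lemma linear_action_zero: "linear_action G act \<Longrightarrow> g \<in> G \<Longrightarrow> act g 0 = 0"
  unfolding linear_action_def by (metis add_cancel_left_left)

lemma linear_action_sum:
  "linear_action G act \<Longrightarrow> g \<in> G \<Longrightarrow> act g (\<Sum>i\<in>I. f i) = (\<Sum>i\<in>I. act g (f i))"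
  by (induction I rule: infinite_finite_induct) (auto simp: linear_action_zero linear_action_def)

definition rep_hom ::
    "'g set \<Rightarrow> ('g \<Rightarrow> ('x \<Rightarrow> complex) \<Rightarrow> 'x \<Rightarrow> complex) \<Rightarrow> ('x \<Rightarrow> complex) set
            \<Rightarrow> ('g \<Rightarrow> ('y \<Rightarrow> complex) \<Rightarrow> 'y \<Rightarrow> complex) \<Rightarrow> ('y \<Rightarrow> complex) set
            \<Rightarrow> (('x \<Rightarrow> complex) \<Rightarrow> 'y \<Rightarrow> complex) \<Rightarrow> bool" where
  "rep_hom G actU U actV V \<phi> \<longleftrightarrow>
     (\<forall>u\<in>U. \<phi> u \<in> V) \<and>
     (\<forall>u\<in>U. \<forall>u'\<in>U. \<phi> (u + u') = \<phi> u + \<phi> u') \<and>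
     (\<forall>c. \<forall>u\<in>U. \<phi> (fun_scale c u) = fun_scale c (\<phi> u)) \<and>
     (\<forall>g\<in>G. \<forall>u\<in>U. \<phi> (actU g u) = actV g (\<phi> u))"

lemma rep_homD:
  assumes "rep_hom G actU U actV V \<phi>"
  shows "u \<in> U \<Longrightarrow> \<phi> u \<in> V"
    and "u \<in> U \<Longrightarrow> u' \<in> U \<Longrightarrow> \<phi> (u + u') = \<phi> u + \<phi> u'"
    and "u \<in> U \<Longrightarrow> \<phi> (fun_scale c u) = fun_scale c (\<phi> u)"
    and "g \<in> G \<Longrightarrow> u \<in> U \<Longrightarrow> \<phi> (actU g u) = actV g (\<phi> u)"
  using assms by (auto simp: rep_hom_def)

lemma isomorphic_reps_iff:
  "isomorphic_reps G actU U actV V \<longleftrightarrow> (\<exists>\<phi>. rep_hom G actU U actV V \<phi> \<and> bij_betw \<phi> U V)"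
  unfolding isomorphic_reps_def rep_hom_def by (intro ex_cong1) (auto dest: bij_betwE)

lemma rep_hom_zero:
  assumes "rep_hom G actU U actV V \<phi>" "fun_space.subspace U"
  shows "\<phi> 0 = 0"
  using rep_homD(2)[OF assms(1), of 0 0] fun_space.subspace_0[OF assms(2)] by simp

lemma rep_hom_diff:
  assumes "rep_hom G actU U actV V \<phi>" "fun_space.subspace U" "u \<in> U" "v \<in> U"
  shows "\<phi> (u - v) = \<phi> u - \<phi> v"
  using rep_homD(2)[OF assms(1), of "u - v" v] fun_space.subspace_diff[OF assms(2)] assms(3,4)
  by (simp add: eq_diff_eq)

lemma rep_hom_compose:
  "rep_hom G actU U actV V \<phi> \<Longrightarrow> rep_hom G actV V actW W \<psi> \<Longrightarrow> rep_hom G actU U actW W (\<psi> \<circ> \<phi>)"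
  by (auto simp: rep_hom_def)

lemma rep_hom_inv_into:
  assumes \<phi>: "rep_hom G actU U actV V \<phi>" and bij: "bij_betw \<phi> U V" and U: "invariant_subspace G actU U"
  shows "rep_hom G actV V actU U (inv_into U \<phi>)"
proof -
  let ?\<psi> = "inv_into U \<phi>"
  have in_U: "?\<psi> v \<in> U" and f: "\<phi> (?\<psi> v) = v" if "v \<in> V" for v
    using bij that by (auto simp: bij_betw_def inv_into_into f_inv_into_f)
  have eqI: "?\<psi> (\<phi> u) = u" if "u \<in> U" for u
    using bij that by (auto simp: bij_betw_def)
  have sub: "fun_space.subspace U" and inv: "g \<in> G \<Longrightarrow> u \<in> U \<Longrightarrow> actU g u \<in> U" for g u
    using U by (auto simp: invariant_subspace_def)
  have "?\<psi> (v + v') = ?\<psi> v + ?\<psi> v'" if "v \<in> V" "v' \<in> V" for v v'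
    using eqI[of "?\<psi> v + ?\<psi> v'"] fun_space.subspace_add[OF sub] in_U f that rep_homD(2)[OF \<phi>] by auto
  moreover have "?\<psi> (fun_scale c v) = fun_scale c (?\<psi> v)" if "v \<in> V" for c v
    using eqI[of "fun_scale c (?\<psi> v)"] fun_space.subspace_scale[OF sub] in_U f that rep_homD(3)[OF \<phi>] by auto
  moreover have "?\<psi> (actV g v) = actU g (?\<psi> v)" if "v \<in> V" "g \<in> G" for g v
    using eqI[of "actU g (?\<psi> v)"] inv in_U f that rep_homD(4)[OF \<phi>] by auto
  ultimately show ?thesis using in_U by (auto simp: rep_hom_def)
qed

text \<open>One half of Schur's lemma: kernel and image are invariant, and for a nonzero map
  irreducibility leaves only the zero kernel and the full image.\<close>

lemma rep_hom_irreducible_bij: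
  assumes V: "irreducible_subspace G actV V" and U: "irreducible_subspace G actU U"
    and \<theta>: "rep_hom G actV V actU U \<theta>" and lin: "linear_action G actU"
    and "v0 \<in> V" "\<theta> v0 \<noteq> 0"
  shows "bij_betw \<theta> V U"
proof -
  have Vinv: "invariant_subspace G actV V"
    using V by (auto simp: irreducible_subspace_def)
  then have Vsub: "fun_space.subspace V" and Vact: "\<And>g v. g \<in> G \<Longrightarrow> v \<in> V \<Longrightarrow> actV g v \<in> V"
    by (auto simp: invariant_subspace_def)
  have "invariant_subspace G actV {v\<in>V. \<theta> v = 0}"
    unfolding invariant_subspace_def
  proof (intro conjI ballI)
    show "fun_space.subspace {v \<in> V. \<theta> v = 0}"
      using fun_space.subspace_0[OF Vsub] fun_space.subspace_add[OF Vsub] fun_space.subspace_scale[OF Vsub]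
        rep_hom_zero[OF \<theta> Vsub] rep_homD(2,3)[OF \<theta>]
      by (intro fun_space.subspaceI) auto
    show "actV g u \<in> {v \<in> V. \<theta> v = 0}" if "g \<in> G" "u \<in> {v \<in> V. \<theta> v = 0}" for g u
      using that Vact rep_homD(4)[OF \<theta>] linear_action_zero[OF lin] by auto
  qed
  then have "{v\<in>V. \<theta> v = 0} = {0} \<or> {v\<in>V. \<theta> v = 0} = V"
    using V unfolding irreducible_subspace_def by blast
  then have ker: "{v\<in>V. \<theta> v = 0} = {0}" using assms(5,6) by blast
  have inj: "inj_on \<theta> V"
  proof (rule inj_onI)
    fix u v assume uv: "u \<in> V" "v \<in> V" "\<theta> u = \<theta> v"
    then have "u - v \<in> {v\<in>V. \<theta> v = 0}"
      using rep_hom_diff[OF \<theta> Vsub] fun_space.subspace_diff[OF Vsub] by auto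
    then show "u = v" unfolding ker by simp
  qed
  have "invariant_subspace G actU (\<theta> ` V)"
    unfolding invariant_subspace_def
  proof (intro conjI ballI)
    show "fun_space.subspace (\<theta> ` V)"
    proof (rule fun_space.subspaceI)
      show "0 \<in> \<theta> ` V"
        using rep_hom_zero[OF \<theta> Vsub] fun_space.subspace_0[OF Vsub] by (metis image_eqI)
      show "x + y \<in> \<theta> ` V" if "x \<in> \<theta> ` V" "y \<in> \<theta> ` V" for x y
        using that rep_homD(2)[OF \<theta>] fun_space.subspace_add[OF Vsub] by (auto simp: image_iff) metis
      show "fun_scale c x \<in> \<theta> ` V" if "x \<in> \<theta> ` V" for c x
        using that rep_homD(3)[OF \<theta>] fun_space.subspace_scale[OF Vsub] by (auto simp: image_iff) metis
    qed
    show "actU g u \<in> \<theta> ` V" if "g \<in> G" "u \<in> \<theta> ` V" for g u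
      using that Vact rep_homD(4)[OF \<theta>] by (auto simp: image_iff) metis
  qed
  moreover have "\<theta> ` V \<subseteq> U" using rep_homD(1)[OF \<theta>] by auto
  ultimately have "\<theta> ` V = {0} \<or> \<theta> ` V = U"
    using U unfolding irreducible_subspace_def by blast
  then show ?thesis using assms(5,6) inj by (auto simp: bij_betw_def)
qed

text \<open>Applying \<open>act g\<close> to the parts of \<open>w\<close> decomposes
  \<open>act g w\<close>, and decompositions are unique, so the projections to the summands commute
  with the action. Each property of \<open>comp\<close> is proved by exhibiting a second
  decomposition of the same vector.\<close>

lemma direct_sum_component:
  assumes D: "irreducible_decomposition G act W D" and lin: "linear_action G act"
  shows "\<exists>comp. (\<forall>w\<in>W. w = (\<Sum>U\<in>D. comp U w)) \<and> (\<forall>U\<in>D. rep_hom G act W act U (comp U))"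
proof -
  have finD: "finite D" and span: "fun_space.span (\<Union>D) = W"
    and irr: "\<And>U. U \<in> D \<Longrightarrow> irreducible_subspace G act U"
    and direct: "\<And>u U. (\<And>U. U \<in> D \<Longrightarrow> u U \<in> U) \<Longrightarrow> (\<Sum>U\<in>D. u U) = 0 \<Longrightarrow> U \<in> D \<Longrightarrow> u U = 0"
    using D unfolding irreducible_decomposition_def by blast+
  have sub: "fun_space.subspace U" and inv: "g \<in> G \<Longrightarrow> u \<in> U \<Longrightarrow> act g u \<in> U" if "U \<in> D" for U g u
    using irr[OF that] by (auto simp: irreducible_subspace_def invariant_subspace_def)
  have ex: "\<exists>u. (\<forall>U\<in>D. u U \<in> U) \<and> w = (\<Sum>U\<in>D. u U)" if "w \<in> W" for w
    using that unfolding span[symmetric]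
  proof (induction rule: fun_space.span_induct_alt)
    case base
    define z :: "('b \<Rightarrow> complex) set \<Rightarrow> 'b \<Rightarrow> complex" where "z = (\<lambda>_. 0)"
    have "\<forall>U\<in>D. z U \<in> U" unfolding z_def using fun_space.subspace_0[OF sub] by blast
    moreover have "0 = sum z D" unfolding z_def by (rule sum.neutral_const[symmetric])
    ultimately show ?case by blast
  next
    case (step c x y)
    obtain u where u: "\<forall>U\<in>D. u U \<in> U" "y = (\<Sum>U\<in>D. u U)" using step by blast
    obtain U0 where U0: "U0 \<in> D" "x \<in> U0" using step by blast
    define v where "v = (\<lambda>U. (if U = U0 then fun_scale c x else 0) + u U)"
    have "fun_scale c x + y = sum v D"
      using u U0 finD by (simp add: v_def sum.distrib)
    moreover have "\<forall>U\<in>D. v U \<in> U"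
      using u U0 fun_space.subspace_add[OF sub] fun_space.subspace_scale[OF sub] by (simp add: v_def)
    ultimately show ?case by blast
  qed
  define Q where "Q = (\<lambda>w u. (\<forall>U\<in>D. u U \<in> U) \<and> w = (\<Sum>U\<in>D. u U))"
  have uniq: "u U = u' U" if "Q w u" "Q w u'" "U \<in> D" for w u u' U
  proof -
    define d where "d = (\<lambda>U. u U - u' U)"
    have "d V \<in> V" if "V \<in> D" for V
      unfolding d_def using \<open>Q w u\<close> \<open>Q w u'\<close> that fun_space.subspace_diff[OF sub[OF that]] by (simp add: Q_def)
    moreover have "sum d D = 0"
      using \<open>Q w u\<close> \<open>Q w u'\<close> by (simp add: Q_def d_def sum_subtractf)
    ultimately have "d U = 0" using direct that(3) by blast
    then show ?thesis by (simp add: d_def)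
  qed
  define comp where "comp = (\<lambda>U w. (SOME u. Q w u) U)"
  have P: "Q w (\<lambda>U. comp U w)" if "w \<in> W" for w
    unfolding comp_def using someI_ex[of "Q w"] ex[OF that] unfolding Q_def .
  have compU: "comp U w \<in> U" if "w \<in> W" "U \<in> D" for w U
    using P[OF that(1)] that(2) by (simp add: Q_def)
  have compS: "w = (\<Sum>U\<in>D. comp U w)" if "w \<in> W" for w
    using P[OF that(1)] by (simp add: Q_def)
  have W: "fun_space.subspace W" unfolding span[symmetric] by (rule fun_space.subspace_span)
  have UW: "U \<subseteq> W" if "U \<in> D" for U
    unfolding span[symmetric] using that fun_space.span_superset[of "\<Union>D"] by blast
  have actQ: "Q (act g w) (\<lambda>U. act g (comp U w))" if "g \<in> G" "w \<in> W" for g w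
  proof -
    have "act g w = act g (\<Sum>U\<in>D. comp U w)" using compS[OF that(2)] by simp
    then show ?thesis
      using compU that inv unfolding Q_def linear_action_sum[OF lin that(1)] by blast
  qed
  \<comment> \<open>Invariance of \<open>W\<close> is inherited from that of its summands.\<close>
  have actW: "act g w \<in> W" if "g \<in> G" "w \<in> W" for g w
  proof -
    have "(\<Sum>U\<in>D. act g (comp U w)) \<in> W"
      using actQ[OF that] UW unfolding Q_def by (intro fun_space.subspace_sum[OF W]) blast
    then show ?thesis using actQ[OF that] unfolding Q_def by (elim conjE) simp
  qed
  have "rep_hom G act W act U (comp U)" if U: "U \<in> D" for U
    unfolding rep_hom_def
  proof (intro conjI ballI allI)
    show "comp U w \<in> U" if "w \<in> W" for w using compU that U by blast
    show "comp U (w + w') = comp U w + comp U w'" if "w \<in> W" "w' \<in> W" for w w'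
    proof (rule uniq[OF P[OF fun_space.subspace_add[OF W that]] _ U])
      show "Q (w + w') (\<lambda>U. comp U w + comp U w')"
        using compU[OF that(1)] compU[OF that(2)] compS[OF that(1)] compS[OF that(2)]
          fun_space.subspace_add[OF sub] unfolding Q_def sum.distrib by metis
    qed
    show "comp U (fun_scale c w) = fun_scale c (comp U w)" if "w \<in> W" for c w
    proof (rule uniq[OF P[OF fun_space.subspace_scale[OF W that]] _ U])
      show "Q (fun_scale c w) (\<lambda>U. fun_scale c (comp U w))"
        using compU[OF that] compS[OF that] fun_space.subspace_scale[OF sub]
        unfolding Q_def fun_space.scale_sum_right[symmetric] by metis
    qed
    show "comp U (act g w) = act g (comp U w)" if "g \<in> G" "w \<in> W" for g w
      by (rule uniq[OF P[OF actW[OF that]] actQ[OF that] U])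
  qed
  moreover have "\<forall>w\<in>W. w = (\<Sum>U\<in>D. comp U w)" using compS by blast
  ultimately show ?thesis by (intro exI[of _ comp]) blast
qed

text \<open>The usual bound on independent sets, for indexed families: independence of the family
  forces \<open>x\<close> to be injective, while \<open>y\<close> may take a value twice.\<close>

lemma card_le_of_independent_family:
  assumes fin: "finite I" "finite J" and span: "\<And>i. i \<in> I \<Longrightarrow> x i \<in> fun_space.span (y ` J)"
    and ind: "\<And>a i. (\<Sum>i\<in>I. fun_scale (a i) (x i)) = 0 \<Longrightarrow> i \<in> I \<Longrightarrow> a i = 0"
  shows "card I \<le> card J"
proof -
  have inj: "inj_on x I"
  proof (rule inj_onI, rule ccontr)
    fix i j assume ij: "i \<in> I" "j \<in> I" "x i = x j" "i \<noteq> j"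
    let ?a = "\<lambda>k. if k = i then 1 else if k = j then -1 else (0::complex)"
    have "(\<Sum>k\<in>I. fun_scale (?a k) (x k)) = (\<Sum>k\<in>{i, j}. fun_scale (?a k) (x k))"
      using ij fin by (intro sum.mono_neutral_right) auto
    also have "\<dots> = 0" using ij by simp
    finally show False using ind[of ?a i] ij by simp
  qed
  have "fun_space.independent (x ` I)"
  proof (rule fun_space.independent_if_scalars_zero)
    show "finite (x ` I)" using fin by simp
    fix f v assume *: "(\<Sum>v\<in>x ` I. fun_scale (f v) v) = 0" "v \<in> x ` I"
    then have "(\<Sum>i\<in>I. fun_scale (f (x i)) (x i)) = 0" using inj by (simp add: sum.reindex)
    then show "f v = 0" using ind[of "\<lambda>i. f (x i)"] * by auto
  qed
  then have "card (x ` I) \<le> card (y ` J)"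
    using fun_space.independent_span_bound[of "y ` J" "x ` I"] fin span by auto
  then show ?thesis using card_image[OF inj] card_image_le[OF fin(2), of y] by simp
qed

lemma rep_hom_sum:
  assumes lin: "linear_action G actW" and W: "fun_space.subspace W"
    and \<theta>: "\<And>i. i \<in> I \<Longrightarrow> rep_hom G actV V actW W (\<theta> i)"
  shows "rep_hom G actV V actW W (\<lambda>v. \<Sum>i\<in>I. fun_scale (a i) (\<theta> i v))"
  unfolding rep_hom_def
proof (intro conjI ballI allI)
  show "(\<Sum>i\<in>I. fun_scale (a i) (\<theta> i v)) \<in> W" if "v \<in> V" for v
    using rep_homD(1)[OF \<theta>] that W by (intro fun_space.subspace_sum fun_space.subspace_scale) auto
  show "(\<Sum>i\<in>I. fun_scale (a i) (\<theta> i (u + v))) =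
      (\<Sum>i\<in>I. fun_scale (a i) (\<theta> i u)) + (\<Sum>i\<in>I. fun_scale (a i) (\<theta> i v))" if "u \<in> V" "v \<in> V" for u v
    using rep_homD(2)[OF \<theta>] that by (simp add: fun_space.scale_right_distrib sum.distrib)
  show "(\<Sum>i\<in>I. fun_scale (a i) (\<theta> i (fun_scale c u))) = fun_scale c (\<Sum>i\<in>I. fun_scale (a i) (\<theta> i u))"
    if "u \<in> V" for c u
    using rep_homD(3)[OF \<theta>] that by (simp add: fun_space.scale_sum_right mult.commute)
  show "(\<Sum>i\<in>I. fun_scale (a i) (\<theta> i (actV g u))) = actW g (\<Sum>i\<in>I. fun_scale (a i) (\<theta> i u))"
    if g: "g \<in> G" and "u \<in> V" for g u
    using rep_homD(4)[OF \<theta>] that lin unfolding linear_action_sum[OF lin g]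
    by (simp add: linear_action_def)
qed

text \<open>By Schur's lemma both sides count the dimension of the space of homomorphisms from \<open>V\<close> to \<open>W\<close>,
  which are determined by their value at the generator \<open>e\<close>.\<close>

lemma card_isomorphic_summands:
  fixes W :: "('w \<Rightarrow> complex) set"
  assumes D: "irreducible_decomposition G actW W D" and lin: "linear_action G actW"
    and V: "irreducible_subspace G actV V" and e: "e \<in> V" "e \<noteq> 0"
    and schur: "\<And>\<psi>. rep_hom G actV V actV V \<psi> \<Longrightarrow> \<exists>k. \<psi> e = fun_scale k e"
    and I: "finite I"
    and \<theta>: "\<And>i. i \<in> I \<Longrightarrow> rep_hom G actV V actW W (\<theta> i)"
    and \<theta>_ind: "\<And>a i. (\<Sum>i\<in>I. fun_scale (a i) (\<theta> i e)) = 0 \<Longrightarrow> i \<in> I \<Longrightarrow> a i = 0"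
    and \<Phi>_span: "\<And>\<phi>. rep_hom G actV V actW W \<phi> \<Longrightarrow> \<Phi> \<phi> \<in> fun_space.span (y ` I)"
    and \<Phi>_sum: "\<And>(J :: ('w \<Rightarrow> complex) set set) a \<phi>.
       \<Phi> (\<lambda>v. \<Sum>j\<in>J. fun_scale (a j) (\<phi> j v)) = (\<Sum>j\<in>J. fun_scale (a j) (\<Phi> (\<phi> j)))"
    and \<Phi>_inj: "\<And>\<phi>. rep_hom G actV V actW W \<phi> \<Longrightarrow> \<Phi> \<phi> = 0 \<Longrightarrow> \<phi> e = 0"
  shows "card {U \<in> D. isomorphic_reps G actW U actV V} = card I"
proof -
  let ?DV = "{U \<in> D. isomorphic_reps G actW U actV V}"
  have finD: "finite D" and span: "fun_space.span (\<Union>D) = W"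
    and irr: "\<And>U. U \<in> D \<Longrightarrow> irreducible_subspace G actW U"
    and direct: "\<And>u U. (\<And>U. U \<in> D \<Longrightarrow> u U \<in> U) \<Longrightarrow> (\<Sum>U\<in>D. u U) = 0 \<Longrightarrow> U \<in> D \<Longrightarrow> u U = 0"
    using D unfolding irreducible_decomposition_def by blast+
  have inv: "invariant_subspace G actW U" and sub: "fun_space.subspace U" if "U \<in> D" for U
    using irr[OF that] by (auto simp: irreducible_subspace_def invariant_subspace_def)
  have Vinv: "invariant_subspace G actV V" and Vsub: "fun_space.subspace V"
    using V by (auto simp: irreducible_subspace_def invariant_subspace_def)
  have Wsub: "fun_space.subspace W" unfolding span[symmetric] by (rule fun_space.subspace_span)
  have UW: "U \<subseteq> W" if "U \<in> D" for U
    unfolding span[symmetric] using that fun_space.span_superset[of "\<Union>D"] by blast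
  have "\<exists>\<phi>. rep_hom G actV V actW U \<phi> \<and> bij_betw \<phi> V U" if UDV: "U \<in> ?DV" for U
  proof -
    obtain \<psi> where U: "U \<in> D" and \<psi>: "rep_hom G actW U actV V \<psi>" "bij_betw \<psi> U V"
      using UDV unfolding isomorphic_reps_iff by auto
    show ?thesis
      using rep_hom_inv_into[OF \<psi> inv[OF U]] bij_betw_inv_into[OF \<psi>(2)] by (intro exI conjI)
  qed
  note iso_ex = this
  define \<phi> where "\<phi> = (\<lambda>U. SOME \<phi>. rep_hom G actV V actW U \<phi> \<and> bij_betw \<phi> V U)"
  have \<phi>: "rep_hom G actV V actW U (\<phi> U)" "bij_betw (\<phi> U) V U" if "U \<in> ?DV" for U
    using someI_ex[OF iso_ex[OF that]] unfolding \<phi>_def by simp_all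
  have \<phi>W: "rep_hom G actV V actW W (\<phi> U)" if "U \<in> ?DV" for U
    using \<phi>(1)[OF that] UW that by (auto simp: rep_hom_def)
  have \<phi>_ind: "a U = 0" if "(\<Sum>U\<in>?DV. fun_scale (a U) (\<phi> U e)) = 0" and U: "U \<in> ?DV" for a U
  proof -
    let ?u = "\<lambda>U. if U \<in> ?DV then fun_scale (a U) (\<phi> U e) else 0"
    have "(\<Sum>U\<in>D. ?u U) = (\<Sum>U\<in>?DV. fun_scale (a U) (\<phi> U e))"
      using finD by (intro sum.mono_neutral_cong_right) auto
    moreover have "?u U' \<in> U'" if "U' \<in> D" for U'
      using that \<phi>(1) rep_homD(1) e(1) sub fun_space.subspace_0 fun_space.subspace_scale by simp blast
    ultimately have "?u U = 0"
      using that direct[of ?u U] by simp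
    then have "a U = 0 \<or> \<phi> U e = 0" using U by simp
    moreover have "\<phi> U e \<noteq> 0"
    proof
      assume "\<phi> U e = 0"
      then have "\<phi> U e = \<phi> U 0" using rep_hom_zero[OF \<phi>(1)[OF U] Vsub] by simp
      then show False
        using \<phi>(2)[OF U] e fun_space.subspace_0[OF Vsub] by (auto simp: bij_betw_def inj_on_def)
    qed
    ultimately show ?thesis by blast
  qed
  \<comment> \<open>Upper bound: the isomorphisms from \<open>V\<close> to the summands are
    independent, \<open>\<Phi>\<close> preserves this, and its values lie in the span of
    \<open>card I\<close> functions.\<close>
  have "card ?DV \<le> card I"
  proof (rule card_le_of_independent_family[of ?DV I "\<lambda>U. \<Phi> (\<phi> U)" y])
    fix a U assume *: "(\<Sum>U\<in>?DV. fun_scale (a U) (\<Phi> (\<phi> U))) = 0" "U \<in> ?DV"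
    then have "\<Phi> (\<lambda>v. \<Sum>U\<in>?DV. fun_scale (a U) (\<phi> U v)) = 0" by (simp only: \<Phi>_sum)
    then have "(\<Sum>U\<in>?DV. fun_scale (a U) (\<phi> U e)) = 0"
      using rep_hom_sum[OF lin Wsub \<phi>W] by (intro \<Phi>_inj)
    then show "a U = 0" using \<phi>_ind *(2) by blast
  qed (use finD I \<phi>W \<Phi>_span in auto)
  \<comment> \<open>Lower bound: each component of \<open>\<theta> i e\<close> is zero or, compared
    with \<open>\<phi> U\<close> by Schur's lemma, a multiple of \<open>\<phi> U e\<close>. So the
    independent vectors \<open>\<theta> i e\<close> lie in the span of \<open>card ?DV\<close>
    vectors.\<close>
  moreover have "card I \<le> card ?DV"
  proof (rule card_le_of_independent_family[of I ?DV "\<lambda>i. \<theta> i e" "\<lambda>U. \<phi> U e"])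
    fix i assume i: "i \<in> I"
    obtain comp where comp': "\<forall>w\<in>W. w = (\<Sum>U\<in>D. comp U w)"
      "\<forall>U\<in>D. rep_hom G actW W actW U (comp U)"
      using direct_sum_component[OF D lin] by (elim exE conjE)
    note comp = bspec[OF comp'(1)] bspec[OF comp'(2)]
    have "comp U (\<theta> i e) \<in> fun_space.span ((\<lambda>U. \<phi> U e) ` ?DV)" if U: "U \<in> D" for U
    proof (cases "comp U (\<theta> i e) = 0")
      case True
      then show ?thesis by (simp add: fun_space.span_zero)
    next
      case False
      have h: "rep_hom G actV V actW U (comp U \<circ> \<theta> i)"
        using rep_hom_compose[OF \<theta>[OF i] comp(2)[OF U]] .
      have b: "bij_betw (comp U \<circ> \<theta> i) V U"
        using rep_hom_irreducible_bij[OF V irr[OF U] h lin e(1)] False by simp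
      have UDV: "U \<in> ?DV"
        using U rep_hom_inv_into[OF h b Vinv] bij_betw_inv_into[OF b] by (auto simp: isomorphic_reps_iff)
      have "rep_hom G actV V actV V (inv_into V (\<phi> U) \<circ> (comp U \<circ> \<theta> i))"
        by (rule rep_hom_compose[OF h rep_hom_inv_into[OF \<phi>(1)[OF UDV] \<phi>(2)[OF UDV] Vinv]])
      then obtain k where k: "inv_into V (\<phi> U) (comp U (\<theta> i e)) = fun_scale k e"
        using schur by force
      have "comp U (\<theta> i e) \<in> U" using rep_homD(1)[OF h e(1)] by simp
      then have "comp U (\<theta> i e) = \<phi> U (fun_scale k e)"
        using k \<phi>(2)[OF UDV] by (metis bij_betw_inv_into_right)
      also have "\<dots> = fun_scale k (\<phi> U e)" using rep_homD(3)[OF \<phi>(1)[OF UDV] e(1)] .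
      finally show ?thesis
        using fun_space.span_scale[OF fun_space.span_base[OF imageI[OF UDV, of "\<lambda>U. \<phi> U e"]], of k]
        by simp
    qed
    then have "(\<Sum>U\<in>D. comp U (\<theta> i e)) \<in> fun_space.span ((\<lambda>U. \<phi> U e) ` ?DV)"
      by (intro fun_space.span_sum) auto
    then show "\<theta> i e \<in> fun_space.span ((\<lambda>U. \<phi> U e) ` ?DV)"
      using comp(1)[OF rep_homD(1)[OF \<theta>[OF i] e(1)]] by simp
  qed (use finD I \<theta>_ind in auto)
  ultimately show ?thesis by simp
qed

section \<open>Specht modules in terms of words\<close>

definition row_tabloid :: "nat list \<Rightarrow> nat \<Rightarrow> nat set" where
  "row_tabloid \<rho> = (\<lambda>i. {p. p < length \<rho> \<and> \<rho> ! p = i})"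

definition tabloids :: "nat \<Rightarrow> (nat \<Rightarrow> nat) \<Rightarrow> (nat \<Rightarrow> nat set) set" where
  "tabloids n l = row_tabloid ` words n l"

lemma row_tabloid_inj:
  assumes "row_tabloid \<rho> = row_tabloid \<rho>'" "length \<rho> = length \<rho>'"
  shows "\<rho> = \<rho>'"
proof (rule nth_equalityI[OF assms(2)])
  fix p assume "p < length \<rho>"
  then have "p \<in> row_tabloid \<rho> (\<rho> ! p)" by (simp add: row_tabloid_def)
  then show "\<rho> ! p = \<rho>' ! p" unfolding assms(1) by (simp add: row_tabloid_def)
qed

lemma finite_tabloids [simp]: "finite (tabloids n l)"
  by (simp add: tabloids_def)

lemma inj_on_row_tabloid: "inj_on row_tabloid (words n l)"
  by (rule inj_onI) (auto intro: row_tabloid_inj simp: words_def)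

lemma sum_tabloids: "(\<Sum>R\<in>tabloids n l. h R) = (\<Sum>\<rho>\<in>words n l. h (row_tabloid \<rho>))"
  unfolding tabloids_def using inj_on_row_tabloid by (simp add: sum.reindex)

definition shift_tabloid :: "(nat \<Rightarrow> nat) \<Rightarrow> (nat \<Rightarrow> nat set) \<Rightarrow> nat \<Rightarrow> nat set" where
  "shift_tabloid \<sigma> R = (\<lambda>i. inv \<sigma> ` R i)"

text \<open>Position \<open>p\<close> lies in a shifted row iff \<open>\<sigma> p\<close> lies in
  the original row. So the inverse in the action disappears, and \<open>specht_act \<sigma>\<close>
  becomes precomposition with \<open>permute_list \<sigma>\<close>.\<close>

lemma shift_row_tabloid:
  assumes \<sigma>: "\<sigma> permutes {..<n}" and len: "length \<rho> = n"
  shows "shift_tabloid \<sigma> (row_tabloid \<rho>) = row_tabloid (permute_list \<sigma> \<rho>)"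
proof
  fix i
  have "p \<in> inv \<sigma> ` row_tabloid \<rho> i \<longleftrightarrow> \<sigma> p \<in> row_tabloid \<rho> i" for p
    using permutes_inverses[OF \<sigma>] by (metis image_iff)
  moreover have "\<sigma> p < n \<longleftrightarrow> p < n" for p
    using permutes_in_image[OF \<sigma>, of p] by simp
  ultimately have "p \<in> inv \<sigma> ` row_tabloid \<rho> i \<longleftrightarrow> p \<in> row_tabloid (permute_list \<sigma> \<rho>) i" for p
    using \<sigma> len by (auto simp: row_tabloid_def permute_list_nth)
  then show "shift_tabloid \<sigma> (row_tabloid \<rho>) i = row_tabloid (permute_list \<sigma> \<rho>) i"
    unfolding shift_tabloid_def by (rule set_eqI)
qed

lemma shift_tabloid_inverse:
  assumes "\<sigma> permutes {..<n}"
  shows "shift_tabloid \<sigma> (shift_tabloid (inv \<sigma>) R) = R" "shift_tabloid (inv \<sigma>) (shift_tabloid \<sigma> R) = R"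
  using permutes_inv_o[OF assms] assms
  by (simp_all add: shift_tabloid_def permutes_inv_inv image_comp)

text \<open>Shifting reverses the order of composition; precomposition reverses it once more, which
  makes \<open>specht_act\<close> a left action.\<close>

lemma shift_tabloid_compose:
  assumes "\<sigma> permutes {..<n}" "\<tau> permutes {..<n}"
  shows "shift_tabloid \<sigma> (shift_tabloid \<tau> R) = shift_tabloid (\<tau> \<circ> \<sigma>) R"
  using assms by (simp add: shift_tabloid_def o_inv_distrib permutes_bij image_comp)

lemma shift_tabloid_in_iff:
  assumes "\<sigma> permutes {..<n}"
  shows "shift_tabloid \<sigma> R \<in> tabloids n l \<longleftrightarrow> R \<in> tabloids n l"
proof -
  have *: "shift_tabloid \<tau> R \<in> tabloids n l" if "R \<in> tabloids n l" "\<tau> permutes {..<n}" for R \<tau>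
    using that permute_list_in_words[OF that(2)] shift_row_tabloid[OF that(2)]
    by (auto simp: tabloids_def words_def)
  show ?thesis
    using *[of R \<sigma>] *[of "shift_tabloid \<sigma> R" "inv \<sigma>"] assms shift_tabloid_inverse[OF assms]
    by (metis permutes_inv)
qed

lemma specht_act_eq: "specht_act \<sigma> f = (\<lambda>R. f (shift_tabloid \<sigma> R))"
  by (simp add: specht_act_def shift_tabloid_def)

lemma specht_act_compose:
  "\<sigma> permutes {..<n} \<Longrightarrow> \<tau> permutes {..<n} \<Longrightarrow> specht_act \<tau> (specht_act \<sigma> f) = specht_act (\<tau> \<circ> \<sigma>) f"
  by (simp add: specht_act_eq shift_tabloid_compose)

lemma specht_act_linear:
  "specht_act \<sigma> (f + g) = specht_act \<sigma> f + specht_act \<sigma> g"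
  "specht_act \<sigma> (fun_scale k f) = fun_scale k (specht_act \<sigma> f)"
  by (auto simp: specht_act_eq fun_scale_def)

lemma linear_action_specht: "linear_action G specht_act"
  unfolding linear_action_def using specht_act_linear by blast

text \<open>Up to a nonzero scalar, this is the polytabloid of any tableau whose entries \<open>0, \<dots>, n - 1\<close> lie in
  the columns prescribed by \<open>c\<close>; the same kernel \<open>asgn (zip c \<rho>)\<close>, read as a function of \<open>c\<close>, is
  \<open>dual_polytab\<close>.\<close>

definition polytab :: "nat \<Rightarrow> (nat \<Rightarrow> nat) \<Rightarrow> nat list \<Rightarrow> (nat \<Rightarrow> nat set) \<Rightarrow> complex" where
  "polytab n l c R = (\<Sum>\<rho>\<in>words n l. if row_tabloid \<rho> = R then asgn (zip c \<rho>) else 0)"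

lemma polytab_row_tabloid:
  assumes "\<rho> \<in> words n l"
  shows "polytab n l c (row_tabloid \<rho>) = asgn (zip c \<rho>)"
proof -
  have "polytab n l c (row_tabloid \<rho>) = (\<Sum>\<rho>'\<in>words n l. if \<rho>' = \<rho> then asgn (zip c \<rho>') else 0)"
    unfolding polytab_def using inj_on_row_tabloid[of n l] assms
    by (intro sum.cong refl) (auto simp: inj_on_def)
  then show ?thesis using assms by simp
qed

lemma polytab_eq_0: "R \<notin> tabloids n l \<Longrightarrow> polytab n l c R = 0"
  by (auto simp: polytab_def tabloids_def intro!: sum.neutral)

lemma asgn_zip_permute:
  assumes "\<sigma> permutes {..<n}" "length c = n" "length \<rho> = n"
  shows "asgn (zip (permute_list \<sigma> c) (permute_list \<sigma> \<rho>)) = of_int (sign \<sigma>) * asgn (zip c \<rho>)"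
proof -
  have "zip (permute_list \<sigma> c) (permute_list \<sigma> \<rho>) = permute_list \<sigma> (zip c \<rho>)"
    using assms by (subst permute_list_zip[of _ "{..<n}"]) auto
  then show ?thesis using asgn_permute_list[of "zip c \<rho>" n \<sigma>] assms by simp
qed

text \<open>Permuting rows and columns together multiplies the kernel by the sign. The permuted word
  stands on the left so that no inverse occurs.\<close>

lemma specht_act_polytab:
  assumes \<sigma>: "\<sigma> permutes {..<n}" and c: "length c = n"
  shows "specht_act \<sigma> (polytab n l (permute_list \<sigma> c)) = fun_scale (of_int (sign \<sigma>)) (polytab n l c)"
proof
  fix R
  show "specht_act \<sigma> (polytab n l (permute_list \<sigma> c)) R = fun_scale (of_int (sign \<sigma>)) (polytab n l c) R"
  proof (cases "R \<in> tabloids n l")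
    case True
    then obtain \<rho> where \<rho>: "\<rho> \<in> words n l" "R = row_tabloid \<rho>" by (auto simp: tabloids_def)
    then show ?thesis
      using shift_row_tabloid[OF \<sigma>, of \<rho>] permute_list_in_words[OF \<sigma> \<rho>(1)] asgn_zip_permute[OF \<sigma> c, of \<rho>]
      by (simp add: specht_act_eq fun_scale_def polytab_row_tabloid length_words)
  next
    case False
    then show ?thesis
      using shift_tabloid_in_iff[OF \<sigma>] by (simp add: specht_act_eq fun_scale_def polytab_eq_0)
  qed
qed

definition fixes_word :: "nat \<Rightarrow> nat list \<Rightarrow> (nat \<Rightarrow> nat) set" where
  "fixes_word n c = {\<sigma>. \<sigma> permutes {..<n} \<and> permute_list \<sigma> c = c}"

lemma finite_fixes_word [simp]: "finite (fixes_word n c)"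
  unfolding fixes_word_def by (rule finite_subset[OF _ finite_permutations[of "{..<n}"]]) auto

lemma fixes_word_compose:
  "length c = n \<Longrightarrow> \<sigma> \<in> fixes_word n c \<Longrightarrow> \<tau> \<in> fixes_word n c \<Longrightarrow> \<sigma> \<circ> \<tau> \<in> fixes_word n c"
  by (auto simp: fixes_word_def permute_list_compose intro: permutes_compose)

lemma fixes_word_inv: "length c = n \<Longrightarrow> \<sigma> \<in> fixes_word n c \<Longrightarrow> inv \<sigma> \<in> fixes_word n c"
  using permute_list_inv(2)[of \<sigma> n c] by (auto simp: fixes_word_def permutes_inv)

lemma sum_fixes_word_compose:
  assumes "length c = n" "\<tau> \<in> fixes_word n c"
  shows "(\<Sum>\<sigma>\<in>fixes_word n c. h (\<tau> \<circ> \<sigma>)) = (\<Sum>\<sigma>\<in>fixes_word n c. h \<sigma>)"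
proof (rule sum.reindex_bij_betw)
  have \<tau>: "\<tau> \<circ> inv \<tau> = id" "inv \<tau> \<circ> \<tau> = id"
    using assms(2) by (auto simp: fixes_word_def permutes_inv_o)
  show "bij_betw ((\<circ>) \<tau>) (fixes_word n c) (fixes_word n c)"
    using fixes_word_compose[OF assms] fixes_word_compose[OF assms(1) fixes_word_inv[OF assms]] \<tau>
    by (intro bij_betw_byWitness[where f' = "(\<circ>) (inv \<tau>)"]) (auto simp flip: comp_assoc)
qed

definition stab_alternating :: "nat \<Rightarrow> nat list \<Rightarrow> ((nat \<Rightarrow> nat set) \<Rightarrow> complex) \<Rightarrow> bool" where
  "stab_alternating n c x \<longleftrightarrow>
     (\<forall>\<sigma>\<in>fixes_word n c. specht_act \<sigma> x = fun_scale (of_int (sign \<sigma>)) x)"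

lemma stab_alternating_polytab:
  assumes "length c = n"
  shows "stab_alternating n c (polytab n l c)"
  unfolding stab_alternating_def
proof
  fix \<sigma> assume "\<sigma> \<in> fixes_word n c"
  then have "\<sigma> permutes {..<n}" "permute_list \<sigma> c = c" by (auto simp: fixes_word_def)
  then show "specht_act \<sigma> (polytab n l c) = fun_scale (of_int (sign \<sigma>)) (polytab n l c)"
    using specht_act_polytab[of \<sigma> n c l] assms by simp
qed

text \<open>James's lemma on column antisymmetrizers. If \<open>zip c \<rho>\<close> is distinct,
  its pairs fill the diagram, so some permutation fixing \<open>c\<close> carries
  \<open>\<rho>0\<close> to \<open>\<rho>\<close> and the value at \<open>\<rho>0\<close> determines
  that at \<open>\<rho>\<close>. If a pair repeats, a transposition fixing both words forces the
  value to be zero.\<close>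

lemma stab_alternating_proportional:
  assumes l: "partition l" and c: "c \<in> words n (col_length l)"
    and x: "stab_alternating n c x" and supp: "\<And>R. R \<notin> tabloids n l \<Longrightarrow> x R = 0"
  shows "\<exists>k. x = fun_scale k (polytab n l c)"
proof -
  define \<rho>0 where "\<rho>0 = row_word c"
  have \<rho>0: "\<rho>0 \<in> words n l" "distinct (zip c \<rho>0)"
    using row_word_in_words[OF l c] distinct_zip_row_word by (auto simp: \<rho>0_def)
  have len: "length c = n" "length \<rho>0 = n" using c \<rho>0 by (auto simp: words_def)
  have xact: "x (row_tabloid (permute_list \<sigma> \<rho>)) = of_int (sign \<sigma>) * x (row_tabloid \<rho>)"
    if "\<sigma> \<in> fixes_word n c" "length \<rho> = n" for \<sigma> \<rho>
  proof -
    have \<sigma>: "\<sigma> permutes {..<n}" using that by (simp add: fixes_word_def)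
    have "specht_act \<sigma> x (row_tabloid \<rho>) = of_int (sign \<sigma>) * x (row_tabloid \<rho>)"
      using x that(1) by (simp add: stab_alternating_def fun_scale_def)
    then show ?thesis using shift_row_tabloid[OF \<sigma> that(2)] by (simp add: specht_act_eq)
  qed
  \<comment> \<open>The value at \<open>\<rho>0\<close> divided by that of the polytabloid there; a
    sign is its own inverse.\<close>
  define k where "k = x (row_tabloid \<rho>0) * asgn (zip c \<rho>0)"
  have "x R = fun_scale k (polytab n l c) R" for R
  proof (cases "R \<in> tabloids n l")
    case False
    then show ?thesis using supp by (simp add: fun_scale_def polytab_eq_0)
  next
    case True
    then obtain \<rho> where \<rho>: "\<rho> \<in> words n l" "R = row_tabloid \<rho>" by (auto simp: tabloids_def)
    have len\<rho>: "length \<rho> = n" using \<rho> by (simp add: words_def)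
    show ?thesis
    proof (cases "distinct (zip c \<rho>)")
      case True
      have "set (zip c \<rho>) = set (zip c \<rho>0)"
        using zip_eq_diagram[OF l c \<rho>(1) True] zip_eq_diagram[OF l c \<rho>0] by simp
      then obtain \<sigma> where \<sigma>: "\<sigma> permutes {..<n}" "permute_list \<sigma> (zip c \<rho>0) = zip c \<rho>"
        using distinct_permutation[OF True \<rho>0(2), of n] len by auto
      then have "zip (permute_list \<sigma> c) (permute_list \<sigma> \<rho>0) = zip c \<rho>"
        using len by (subst (asm) permute_list_zip[of _ "{..<n}"]) auto
      then have *: "permute_list \<sigma> c = c" "permute_list \<sigma> \<rho>0 = \<rho>"
        using len len\<rho> by (metis length_permute_list map_fst_zip, metis length_permute_list map_snd_zip)
      have "x R = of_int (sign \<sigma>) * x (row_tabloid \<rho>0)"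
        using xact[of \<sigma> \<rho>0] * \<sigma>(1) len \<rho>(2) by (simp add: fixes_word_def)
      moreover have "asgn (zip c \<rho>) = of_int (sign \<sigma>) * asgn (zip c \<rho>0)"
        using asgn_zip_permute[OF \<sigma>(1) len] * by simp
      ultimately show ?thesis
        using asgn_square[OF \<rho>0(2)] \<rho>
        by (simp add: fun_scale_def polytab_row_tabloid k_def)
    next
      case False
      then obtain p q where pq: "p < n" "q < n" "p \<noteq> q" "c ! p = c ! q" "\<rho> ! p = \<rho> ! q"
        using len len\<rho> by (auto simp: distinct_conv_nth)
      let ?t = "Transposition.transpose p q"
      have t: "?t permutes {..<n}" using pq by (intro permutes_transpose_lessThan)
      have "permute_list ?t c = c"
        using pq len by (intro permute_list_transpose_eq) auto
      moreover have "permute_list ?t \<rho> = \<rho>"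
        using pq len\<rho> by (intro permute_list_transpose_eq) auto
      ultimately have "x R = - x R"
        using xact[of ?t \<rho>] t len\<rho> \<rho>(2) pq(3) by (simp add: fixes_word_def sign_swap_id)
      then show ?thesis
        using False \<rho> by (simp add: fun_scale_def polytab_row_tabloid)
    qed
  qed
  then show ?thesis by (intro exI[of _ k] ext)
qed

definition colspan :: "nat \<Rightarrow> (nat \<Rightarrow> nat) \<Rightarrow> ((nat \<Rightarrow> nat set) \<Rightarrow> complex) set" where
  "colspan n l = fun_space.span (polytab n l ` words n (col_length l))"

lemma polytab_in_colspan: "c \<in> words n (col_length l) \<Longrightarrow> polytab n l c \<in> colspan n l"
  unfolding colspan_def by (rule fun_space.span_base) simp

lemma subspace_colspan: "fun_space.subspace (colspan n l)"
  unfolding colspan_def by (rule fun_space.subspace_span)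

lemma colspan_supp:
  assumes "u \<in> colspan n l" "R \<notin> tabloids n l"
  shows "u R = 0"
  using assms(1) unfolding colspan_def
proof (induction rule: fun_space.span_induct)
  case base
  show ?case by (rule fun_space.subspaceI) (simp_all add: fun_scale_def)
next
  case (step x)
  then show ?case using polytab_eq_0[OF assms(2)] by auto
qed

lemma specht_act_polytab':
  assumes "\<sigma> permutes {..<n}" "length c = n"
  shows "specht_act \<sigma> (polytab n l c) =
    fun_scale (of_int (sign \<sigma>)) (polytab n l (permute_list (inv \<sigma>) c))"
  using specht_act_polytab[OF assms(1), of "permute_list (inv \<sigma>) c" l] permute_list_inv(1)[OF assms] assms(2)
  by simp

lemma invariant_colspan: "invariant_subspace {\<sigma>. \<sigma> permutes {..<n}} specht_act (colspan n l)"
  unfolding invariant_subspace_def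
proof (intro conjI ballI subspace_colspan)
  fix \<sigma> u assume "\<sigma> \<in> {\<sigma>. \<sigma> permutes {..<n}}" and u: "u \<in> colspan n l"
  then have \<sigma>: "\<sigma> permutes {..<n}" by simp
  show "specht_act \<sigma> u \<in> colspan n l"
  proof (rule linear_maps_span[OF specht_act_linear subspace_colspan _ u[unfolded colspan_def]])
    fix x assume "x \<in> polytab n l ` words n (col_length l)"
    then obtain c where c: "c \<in> words n (col_length l)" "x = polytab n l c" by blast
    then show "specht_act \<sigma> x \<in> colspan n l"
      using specht_act_polytab'[OF \<sigma>, of c l] permute_list_in_words[OF permutes_inv[OF \<sigma>] c(1)]
        fun_space.subspace_scale[OF subspace_colspan polytab_in_colspan]
      by (simp only: length_words)
  qed
qed

lemma colspan_orthogonal_eq_0: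
  assumes u: "u \<in> colspan n l"
    and orth: "\<And>c. c \<in> words n (col_length l) \<Longrightarrow> (\<Sum>\<rho>\<in>words n l. asgn (zip c \<rho>) * u (row_tabloid \<rho>)) = 0"
  shows "u = 0"
proof
  fix R
  have "u R = 0"
  proof (rule real_span_orthogonal_eq_0[OF u[unfolded colspan_def] finite_tabloids[of n l]])
    show "cnj (b R) = b R" if "b \<in> polytab n l ` words n (col_length l)" for b R
      using that by (auto simp: polytab_def if_distrib cong: if_cong)
    show "(\<Sum>R\<in>tabloids n l. b R * u R) = 0" if "b \<in> polytab n l ` words n (col_length l)" for b
      using that orth by (auto simp: sum_tabloids polytab_row_tabloid)
    show "u R = 0" if "R \<notin> tabloids n l" for R using colspan_supp[OF u that] .
  qed
  then show "u R = 0 R" by simp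
qed

text \<open>The other half of Schur's lemma, at a generator: a homomorphism preserves
  \<open>stab_alternating\<close>, and the functions with this property form a line.\<close>

lemma colspan_endomorphism_scalar:
  assumes l: "partition l" and c: "c \<in> words n (col_length l)"
    and \<psi>: "rep_hom {\<sigma>. \<sigma> permutes {..<n}} specht_act (colspan n l) specht_act (colspan n l) \<psi>"
  shows "\<exists>k. \<psi> (polytab n l c) = fun_scale k (polytab n l c)"
proof (rule stab_alternating_proportional[OF l c])
  have e: "polytab n l c \<in> colspan n l" using polytab_in_colspan[OF c] .
  show "stab_alternating n c (\<psi> (polytab n l c))"
    unfolding stab_alternating_def
  proof
    fix \<sigma> assume \<sigma>: "\<sigma> \<in> fixes_word n c"
    then have "specht_act \<sigma> (\<psi> (polytab n l c)) = \<psi> (specht_act \<sigma> (polytab n l c))"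
      using rep_homD(4)[OF \<psi> _ e] by (simp add: fixes_word_def)
    also have "specht_act \<sigma> (polytab n l c) = fun_scale (of_int (sign \<sigma>)) (polytab n l c)"
      using stab_alternating_polytab[of c n l] c \<sigma> by (simp add: stab_alternating_def words_def)
    also have "\<psi> \<dots> = fun_scale (of_int (sign \<sigma>)) (\<psi> (polytab n l c))"
      using rep_homD(3)[OF \<psi> e] .
    finally show "specht_act \<sigma> (\<psi> (polytab n l c)) = fun_scale (of_int (sign \<sigma>)) (\<psi> (polytab n l c))" .
  qed
  show "\<psi> (polytab n l c) R = 0" if "R \<notin> tabloids n l" for R
    using colspan_supp[OF rep_homD(1)[OF \<psi> e] that] .
qed

text \<open>James's submodule theorem. If \<open>U\<close> is orthogonal to all
  \<open>polytab n l c\<close>, it is zero. Otherwise antisymmetrizing a suitable member over the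
  stabilizer of some \<open>c\<close> puts a nonzero multiple of \<open>polytab n l c\<close> into
  \<open>U\<close>, and its translates span everything.\<close>

lemma colspan_irreducible:
  assumes l: "partition l" and ne: "words n (col_length l) \<noteq> {}"
  shows "irreducible_subspace {\<sigma>. \<sigma> permutes {..<n}} specht_act (colspan n l)"
  unfolding irreducible_subspace_def
proof (intro conjI allI impI invariant_colspan)
  obtain c where c: "c \<in> words n (col_length l)" using ne by blast
  have "polytab n l c (row_tabloid (row_word c)) \<noteq> 0"
    using polytab_row_tabloid[OF row_word_in_words[OF l c]] distinct_zip_row_word by simp
  then have "polytab n l c \<noteq> 0" by (metis zero_fun_apply)
  then show "colspan n l \<noteq> {0}" using polytab_in_colspan[OF c] by blast
next
  let ?G = "{\<sigma>. \<sigma> permutes {..<n}}"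
  fix U assume "invariant_subspace ?G specht_act U \<and> U \<subseteq> colspan n l"
  then have Usub: "fun_space.subspace U" and Uinv: "\<And>\<sigma> u. \<sigma> permutes {..<n} \<Longrightarrow> u \<in> U \<Longrightarrow> specht_act \<sigma> u \<in> U"
    and US: "U \<subseteq> colspan n l" by (auto simp: invariant_subspace_def)
  show "U = {0} \<or> U = colspan n l"
  proof (cases "\<forall>u\<in>U. \<forall>c\<in>words n (col_length l). (\<Sum>\<rho>\<in>words n l. asgn (zip c \<rho>) * u (row_tabloid \<rho>)) = 0")
    case True
    then have "u = 0" if "u \<in> U" for u
      using colspan_orthogonal_eq_0[of u n l] that US by blast
    then show ?thesis using fun_space.subspace_0[OF Usub] by blast
  next
    case False
    then obtain u c where u: "u \<in> U" and c: "c \<in> words n (col_length l)"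
      and nz: "(\<Sum>\<rho>\<in>words n l. asgn (zip c \<rho>) * u (row_tabloid \<rho>)) \<noteq> 0" by blast
    have len: "length c = n" using c by (rule length_words)
    define x where "x = (\<Sum>\<sigma>\<in>fixes_word n c. fun_scale (of_int (sign \<sigma>)) (specht_act \<sigma> u))"
    have xU: "x \<in> U"
      unfolding x_def using Uinv u
      by (intro fun_space.subspace_sum[OF Usub] fun_space.subspace_scale[OF Usub]) (auto simp: fixes_word_def)
    have "stab_alternating n c x"
      unfolding stab_alternating_def
    proof
      fix \<tau> assume \<tau>: "\<tau> \<in> fixes_word n c"
      have "specht_act \<tau> x = (\<Sum>\<sigma>\<in>fixes_word n c. fun_scale (of_int (sign \<sigma>)) (specht_act (\<tau> \<circ> \<sigma>) u))"
        unfolding x_def linear_action_sum[OF linear_action_specht UNIV_I] specht_act_linear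
        using \<tau> by (intro sum.cong refl) (auto simp: specht_act_compose fixes_word_def)
      also have "\<dots> = (\<Sum>\<sigma>\<in>fixes_word n c. fun_scale (of_int (sign \<tau>))
          (fun_scale (of_int (sign (\<tau> \<circ> \<sigma>))) (specht_act (\<tau> \<circ> \<sigma>) u)))"
        using \<tau> by (intro sum.cong refl)
          (auto simp: fixes_word_def sign_compose permutes_permutation sign_square_left
            fun_scale_def mult.assoc)
      also have "\<dots> = fun_scale (of_int (sign \<tau>)) x"
        unfolding x_def fun_space.scale_sum_right
        by (rule sum_fixes_word_compose[OF len \<tau>])
      finally show "specht_act \<tau> x = fun_scale (of_int (sign \<tau>)) x" .
    qed
    then obtain k where k: "x = fun_scale k (polytab n l c)"
      using stab_alternating_proportional[OF l c] colspan_supp xU US by blast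
    \<comment> \<open>Antisymmetrization is self-adjoint and multiplies the polytabloid by the order
      of the stabilizer, so the pairing stays nonzero; this gives
      \<open>k \<noteq> 0\<close>.\<close>
    have "(\<Sum>\<rho>\<in>words n l. asgn (zip c \<rho>) * x (row_tabloid \<rho>)) =
        of_nat (card (fixes_word n c)) * (\<Sum>\<rho>\<in>words n l. asgn (zip c \<rho>) * u (row_tabloid \<rho>))"
    proof -
      have "(\<Sum>\<rho>\<in>words n l. asgn (zip c \<rho>) * x (row_tabloid \<rho>)) =
          (\<Sum>\<rho>\<in>words n l. \<Sum>\<sigma>\<in>fixes_word n c. asgn (zip c \<rho>) * (of_int (sign \<sigma>) * specht_act \<sigma> u (row_tabloid \<rho>)))"
        by (simp add: x_def sum_apply fun_scale_def sum_distrib_left)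
      also have "\<dots> = (\<Sum>\<sigma>\<in>fixes_word n c. \<Sum>\<rho>\<in>words n l.
          asgn (zip c \<rho>) * (of_int (sign \<sigma>) * specht_act \<sigma> u (row_tabloid \<rho>)))"
        by (rule sum.swap)
      also have "\<dots> = (\<Sum>\<sigma>\<in>fixes_word n c. \<Sum>\<rho>\<in>words n l. asgn (zip c \<rho>) * u (row_tabloid \<rho>))"
      proof (rule sum.cong[OF refl])
        fix \<sigma> assume "\<sigma> \<in> fixes_word n c"
        then have \<sigma>: "\<sigma> permutes {..<n}" "permute_list \<sigma> c = c" by (auto simp: fixes_word_def)
        have "(\<Sum>\<rho>\<in>words n l. asgn (zip c \<rho>) * (of_int (sign \<sigma>) * specht_act \<sigma> u (row_tabloid \<rho>))) =
            (\<Sum>\<rho>\<in>words n l. asgn (zip c (permute_list \<sigma> \<rho>)) * u (row_tabloid (permute_list \<sigma> \<rho>)))"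
        proof (rule sum.cong[OF refl])
          fix \<rho> assume "\<rho> \<in> words n l"
          then have "length \<rho> = n" by (rule length_words)
          then show "asgn (zip c \<rho>) * (of_int (sign \<sigma>) * specht_act \<sigma> u (row_tabloid \<rho>)) =
              asgn (zip c (permute_list \<sigma> \<rho>)) * u (row_tabloid (permute_list \<sigma> \<rho>))"
            using asgn_zip_permute[OF \<sigma>(1) len, of \<rho>] \<sigma>(2) shift_row_tabloid[OF \<sigma>(1), of \<rho>]
            by (simp add: specht_act_eq mult_ac)
        qed
        also have "\<dots> = (\<Sum>\<rho>\<in>words n l. asgn (zip c \<rho>) * u (row_tabloid \<rho>))"
          by (rule sum_permute_list_words[OF \<sigma>(1)])
        finally show "(\<Sum>\<rho>\<in>words n l. asgn (zip c \<rho>) * (of_int (sign \<sigma>) * specht_act \<sigma> u (row_tabloid \<rho>))) =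
            (\<Sum>\<rho>\<in>words n l. asgn (zip c \<rho>) * u (row_tabloid \<rho>))" .
      qed
      finally show ?thesis by simp
    qed
    moreover have "id \<in> fixes_word n c" by (simp add: fixes_word_def permutes_id)
    then have "card (fixes_word n c) \<noteq> 0" by auto
    ultimately have "(\<Sum>\<rho>\<in>words n l. asgn (zip c \<rho>) * x (row_tabloid \<rho>)) \<noteq> 0" using nz by simp
    then have "k \<noteq> 0" unfolding k by (auto simp: fun_scale_def)
    then have "polytab n l c = fun_scale (inverse k) x"
      unfolding k by (simp add: fun_scale_def fun_eq_iff)
    then have cU: "polytab n l c \<in> U" using fun_space.subspace_scale[OF Usub xU] by simp
    have "polytab n l c' \<in> U" if c': "c' \<in> words n (col_length l)" for c'
    proof -
      have "mset c' = mset c" using c c' by (simp add: words_def multiset_eq_iff count_mset)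
      then obtain \<sigma> where \<sigma>: "\<sigma> permutes {..<n}" "permute_list \<sigma> c = c'"
        using mset_eq_permutation[of c' c] len by auto
      have "specht_act \<sigma> (polytab n l c') = fun_scale (of_int (sign \<sigma>)) (polytab n l c)"
        using specht_act_polytab[OF \<sigma>(1) len, of l] \<sigma>(2) by simp
      then have "specht_act \<sigma> (polytab n l c') \<in> U" using fun_space.subspace_scale[OF Usub cU] by simp
      then have "specht_act (inv \<sigma>) (specht_act \<sigma> (polytab n l c')) \<in> U"
        using Uinv[OF permutes_inv[OF \<sigma>(1)]] by blast
      then show ?thesis
        unfolding specht_act_eq shift_tabloid_inverse[OF \<sigma>(1)] .
    qed
    then have "colspan n l \<subseteq> U"
      unfolding colspan_def by (intro fun_space.span_minimal[OF _ Usub]) auto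
    then show ?thesis using US by auto
  qed
qed

text \<open>\<open>c\<close> and \<open>\<rho>\<close> list the columns and the rows of the entries of the tableau \<open>t\<close>.\<close>

definition reads :: "nat \<Rightarrow> (nat \<Rightarrow> nat) \<Rightarrow> (nat \<times> nat \<Rightarrow> nat) \<Rightarrow> nat list \<Rightarrow> nat list \<Rightarrow> bool" where
  "reads n l t c \<rho> \<longleftrightarrow> length c = n \<and> length \<rho> = n \<and> bij_betw t (cells l) {..<n} \<and>
     (\<forall>p<n. (\<rho> ! p, c ! p) \<in> cells l \<and> t (\<rho> ! p, c ! p) = p)"

lemma readsD:
  assumes "reads n l t c \<rho>" "(i, j) \<in> cells l"
  shows "t (i, j) < n" "\<rho> ! t (i, j) = i" "c ! t (i, j) = j"
proof -
  have bij: "bij_betw t (cells l) {..<n}" using assms(1) by (simp add: reads_def)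
  then show lt: "t (i, j) < n" using assms(2) by (auto simp: bij_betw_def)
  have "t (\<rho> ! t (i, j), c ! t (i, j)) = t (i, j)" "(\<rho> ! t (i, j), c ! t (i, j)) \<in> cells l"
    using assms(1) lt by (auto simp: reads_def)
  then have "(\<rho> ! t (i, j), c ! t (i, j)) = (i, j)"
    using bij assms(2) by (auto simp: bij_betw_def inj_on_def)
  then show "\<rho> ! t (i, j) = i" "c ! t (i, j) = j" by simp_all
qed

lemma reads_zip:
  assumes "reads n l t c \<rho>"
  shows "distinct (zip c \<rho>)" "set (zip c \<rho>) = {(j, r). j < l r}"
proof -
  have len: "length c = n" "length \<rho> = n"
    and r: "\<And>p. p < n \<Longrightarrow> (\<rho> ! p, c ! p) \<in> cells l \<and> t (\<rho> ! p, c ! p) = p"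
    using assms by (auto simp: reads_def)
  show "distinct (zip c \<rho>)"
    unfolding distinct_conv_nth
  proof (intro allI impI)
    fix p q assume pq: "p < length (zip c \<rho>)" "q < length (zip c \<rho>)" "p \<noteq> q"
    then have "t (\<rho> ! p, c ! p) \<noteq> t (\<rho> ! q, c ! q)" using r len by simp
    then show "zip c \<rho> ! p \<noteq> zip c \<rho> ! q" using pq by auto
  qed
  show "set (zip c \<rho>) = {(j, r). j < l r}"
  proof (intro set_eqI, clarify)
    fix j i
    have "(j, i) \<in> set (zip c \<rho>) \<longleftrightarrow> (\<exists>p<n. c ! p = j \<and> \<rho> ! p = i)"
      using len by (auto simp: in_set_zip)
    also have "\<dots> \<longleftrightarrow> (i, j) \<in> cells l"
      using r readsD[OF assms, of i j] by blast
    finally show "(j, i) \<in> set (zip c \<rho>) \<longleftrightarrow> (j, i) \<in> {(j, r). j < l r}"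
      by (simp add: cells_def)
  qed
qed

lemma reads_words:
  assumes "reads n l t c \<rho>"
  shows "c \<in> words n (col_length l)" "\<rho> \<in> words n l"
proof -
  have len: "length c = n" "length \<rho> = n" using assms by (auto simp: reads_def)
  have "count_list c j = col_length l j" for j
    using count_list_map_fst[OF reads_zip(1)[OF assms], of j] len
    unfolding reads_zip(2)[OF assms] by (simp add: col_length_def)
  moreover have "count_list \<rho> i = l i" for i
    using count_list_map_snd[OF reads_zip(1)[OF assms], of i] len
    unfolding reads_zip(2)[OF assms] by (simp add: lessThan_def[symmetric])
  ultimately show "c \<in> words n (col_length l)" "\<rho> \<in> words n l"
    using len by (auto simp: words_def)
qed

lemma tableau_reads:
  assumes "t \<in> tableaux l"
  shows "\<exists>c \<rho>. reads (psize l) l t c \<rho>"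
proof -
  have bij: "bij_betw t (cells l) {..<psize l}" using assms by (simp add: tableaux_def)
  define s where "s = inv_into (cells l) t"
  have "s p \<in> cells l" "t (s p) = p" if "p < psize l" for p
    using bij that unfolding s_def by (auto simp: bij_betw_def intro: inv_into_into f_inv_into_f)
  then have "reads (psize l) l t (map (snd \<circ> s) [0..<psize l]) (map (fst \<circ> s) [0..<psize l])"
    using bij by (simp add: reads_def)
  then show ?thesis by blast
qed

text \<open>Pairing \<open>c\<close> with \<open>row_word c\<close> enumerates the cells of the
  diagram by positions; the tableau is the inverse of this enumeration.\<close>

lemma word_reads:
  assumes l: "partition l" and c: "c \<in> words (psize l) (col_length l)"
  shows "\<exists>t\<in>tableaux l. reads (psize l) l t c (row_word c)"
proof -
  let ?\<rho> = "row_word c"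
  have len: "length c = psize l" using c by (rule length_words)
  define f where "f = (\<lambda>p. (?\<rho> ! p, c ! p))"
  have d: "distinct (zip c ?\<rho>)" by (rule distinct_zip_row_word)
  have inj: "inj_on f {..<psize l}"
  proof (rule inj_onI)
    fix p q assume pq: "p \<in> {..<psize l}" "q \<in> {..<psize l}" "f p = f q"
    then have "zip c ?\<rho> ! p = zip c ?\<rho> ! q" using len by (simp add: f_def)
    moreover have "p < length (zip c ?\<rho>)" "q < length (zip c ?\<rho>)" using pq len by simp_all
    ultimately show "p = q" using nth_eq_iff_index_eq[OF d] by blast
  qed
  have "f ` {..<psize l} = cells l"
  proof (intro set_eqI, clarify)
    fix i j
    have "(i, j) \<in> f ` {..<psize l} \<longleftrightarrow> (j, i) \<in> set (zip c ?\<rho>)"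
      using len by (auto simp: f_def in_set_zip image_iff)
    then show "(i, j) \<in> f ` {..<psize l} \<longleftrightarrow> (i, j) \<in> cells l"
      using c less_col_length_iff[OF l] by (simp add: set_zip_row_word words_def cells_def)
  qed
  then have bij: "bij_betw f {..<psize l} (cells l)" using inj by (simp add: bij_betw_def)
  define t where "t = inv_into {..<psize l} f"
  have bt: "bij_betw t (cells l) {..<psize l}"
    unfolding t_def using bij by (rule bij_betw_inv_into)
  moreover have "t (f p) = p" "f p \<in> cells l" if "p < psize l" for p
    using that bij inj by (auto simp: t_def bij_betw_def)
  ultimately have "reads (psize l) l t c ?\<rho>"
    using len by (simp add: reads_def f_def)
  then show ?thesis using bt by (auto simp: tableaux_def)
qed

text \<open>\<open>stab_alternating_proportional\<close> applies to the polytabloid, so signs need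
  not be compared term by term. The scalar is nonzero because the polytabloid has coefficient 1 at
  its own tabloid, where only the identity contributes: a permutation that preserves all rows and
  all columns fixes every entry.\<close>

lemma polytabloid_proportional:
  assumes l: "partition l" and t: "reads (psize l) l t c \<rho>"
  shows "\<exists>k. k \<noteq> 0 \<and> polytabloid l t = fun_scale k (polytab (psize l) l c)"
proof -
  let ?n = "psize l"
  have cw: "c \<in> words ?n (col_length l)" and \<rho>w: "\<rho> \<in> words ?n l" using reads_words[OF t] .
  have len: "length c = ?n" "length \<rho> = ?n" using t by (auto simp: reads_def)
  have r: "(\<rho> ! p, c ! p) \<in> cells l" "t (\<rho> ! p, c ! p) = p" if "p < ?n" for p
    using t that by (auto simp: reads_def)
  have column: "{t (i, j) | i. j < l i} = {p. p < ?n \<and> c ! p = j}" for j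
  proof (intro set_eqI iffI)
    fix p assume "p \<in> {t (i, j) | i. j < l i}"
    then show "p \<in> {p. p < ?n \<and> c ! p = j}" using readsD[OF t] by (auto simp: cells_def)
  next
    fix p assume "p \<in> {p. p < ?n \<and> c ! p = j}"
    then show "p \<in> {t (i, j) | i. j < l i}"
      using r[of p] by (auto simp: cells_def intro!: exI[of _ "\<rho> ! p"])
  qed
  have row: "tabloid l t = row_tabloid \<rho>"
  proof (intro ext set_eqI iffI)
    fix i p assume "p \<in> tabloid l t i"
    then show "p \<in> row_tabloid \<rho> i" using readsD[OF t] len by (auto simp: cells_def tabloid_def row_tabloid_def)
  next
    fix i p assume "p \<in> row_tabloid \<rho> i"
    then show "p \<in> tabloid l t i"
      using r[of p] len by (auto simp: cells_def tabloid_def row_tabloid_def intro!: exI[of _ "c ! p"])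
  qed
  have stab: "column_stabilizer l t = fixes_word ?n c"
  proof -
    have "(\<forall>j. \<sigma> ` {p. p < ?n \<and> c ! p = j} = {p. p < ?n \<and> c ! p = j}) \<longleftrightarrow> permute_list \<sigma> c = c"
      if \<sigma>: "\<sigma> permutes {..<?n}" for \<sigma>
    proof
      assume *: "\<forall>j. \<sigma> ` {p. p < ?n \<and> c ! p = j} = {p. p < ?n \<and> c ! p = j}"
      have "c ! \<sigma> p = c ! p" if "p < ?n" for p
        using *[rule_format, of "c ! p"] that by blast
      then show "permute_list \<sigma> c = c"
        using \<sigma> len by (intro nth_equalityI) (auto simp: permute_list_nth)
    next
      assume *: "permute_list \<sigma> c = c"
      have c\<sigma>: "c ! \<sigma> p = c ! p" if "p < ?n" for p
        using * permute_list_nth[of \<sigma> c p] \<sigma> len that by simp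
      have in_iff: "\<sigma> p < ?n \<longleftrightarrow> p < ?n" for p using permutes_in_image[OF \<sigma>, of p] by simp
      show "\<forall>j. \<sigma> ` {p. p < ?n \<and> c ! p = j} = {p. p < ?n \<and> c ! p = j}"
      proof (intro allI set_eqI iffI)
        fix j p assume "p \<in> \<sigma> ` {p. p < ?n \<and> c ! p = j}"
        then show "p \<in> {p. p < ?n \<and> c ! p = j}" using c\<sigma> in_iff by auto
      next
        fix j p assume "p \<in> {p. p < ?n \<and> c ! p = j}"
        moreover obtain q where "p = \<sigma> q" using permutes_surj[OF \<sigma>] by (metis surjD)
        ultimately show "p \<in> \<sigma> ` {p. p < ?n \<and> c ! p = j}" using c\<sigma>[of q] in_iff by auto
      qed
    qed
    then show ?thesis unfolding column_stabilizer_def fixes_word_def column by auto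
  qed
  have tab_comp: "tabloid l (\<sigma> \<circ> t) = (\<lambda>i. \<sigma> ` tabloid l t i)" for \<sigma>
    by (auto simp: tabloid_def fun_eq_iff)
  have tab_shift: "tabloid l (\<sigma> \<circ> t) = shift_tabloid (inv \<sigma>) (row_tabloid \<rho>)" if "\<sigma> permutes {..<?n}" for \<sigma>
    using permutes_inv_inv[OF that] by (simp add: tab_comp row shift_tabloid_def)
  have pt: "polytabloid l t R =
      (\<Sum>\<sigma>\<in>fixes_word ?n c. if shift_tabloid (inv \<sigma>) (row_tabloid \<rho>) = R then of_int (sign \<sigma>) else 0)" for R
    unfolding polytabloid_def stab using tab_shift by (intro sum.cong refl) (simp add: fixes_word_def)
  have "stab_alternating ?n c (polytabloid l t)"
    unfolding stab_alternating_def
  proof (intro ballI ext)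
    fix \<tau> R assume \<tau>: "\<tau> \<in> fixes_word ?n c"
    then have \<tau>p: "\<tau> permutes {..<?n}" by (simp add: fixes_word_def)
    have eq: "shift_tabloid (inv \<sigma>) Q = shift_tabloid \<tau> R \<longleftrightarrow> shift_tabloid (inv (\<tau> \<circ> \<sigma>)) Q = R"
      if "\<sigma> permutes {..<?n}" for \<sigma> Q
    proof -
      have "shift_tabloid (inv (\<tau> \<circ> \<sigma>)) Q = shift_tabloid (inv \<tau>) (shift_tabloid (inv \<sigma>) Q)"
        using shift_tabloid_compose[OF permutes_inv[OF \<tau>p] permutes_inv[OF that]] that \<tau>p
        by (simp add: o_inv_distrib permutes_bij)
      then show ?thesis using shift_tabloid_inverse[OF \<tau>p] by metis
    qed
    have "specht_act \<tau> (polytabloid l t) R =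
        (\<Sum>\<sigma>\<in>fixes_word ?n c. of_int (sign \<tau>) * (if shift_tabloid (inv (\<tau> \<circ> \<sigma>)) (row_tabloid \<rho>) = R
           then of_int (sign (\<tau> \<circ> \<sigma>)) else 0))"
      unfolding specht_act_eq pt using eq \<tau>p
      by (intro sum.cong refl)
        (auto simp: fixes_word_def sign_compose permutes_permutation sign_square_left)
    also have "\<dots> = of_int (sign \<tau>) * polytabloid l t R"
      unfolding pt sum_distrib_left
      by (rule sum_fixes_word_compose[OF len(1) \<tau>])
    finally show "specht_act \<tau> (polytabloid l t) R = fun_scale (of_int (sign \<tau>)) (polytabloid l t) R"
      by (simp add: fun_scale_def)
  qed
  moreover have "polytabloid l t R = 0" if "R \<notin> tabloids ?n l" for R
  proof -
    have "row_tabloid \<rho> \<in> tabloids ?n l" using \<rho>w by (simp add: tabloids_def)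
    then have "shift_tabloid (inv \<sigma>) (row_tabloid \<rho>) \<noteq> R" if "\<sigma> permutes {..<?n}" for \<sigma>
      using shift_tabloid_in_iff[OF permutes_inv[OF that]] \<open>R \<notin> tabloids ?n l\<close> by blast
    then show ?thesis unfolding pt by (intro sum.neutral) (auto simp: fixes_word_def)
  qed
  ultimately obtain k where k: "polytabloid l t = fun_scale k (polytab ?n l c)"
    using stab_alternating_proportional[OF l cw] by blast
  have "polytabloid l t (row_tabloid \<rho>) = (\<Sum>\<sigma>\<in>fixes_word ?n c. if \<sigma> = id then 1 else 0)"
    unfolding pt
  proof (rule sum.cong[OF refl])
    fix \<sigma> assume \<sigma>: "\<sigma> \<in> fixes_word ?n c"
    have inv: "inv \<sigma> permutes {..<?n}" "permute_list (inv \<sigma>) c = c"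
      using fixes_word_inv[OF len(1) \<sigma>] by (auto simp: fixes_word_def)
    have "\<sigma> = id" if "shift_tabloid (inv \<sigma>) (row_tabloid \<rho>) = row_tabloid \<rho>"
    proof -
      have "permute_list (inv \<sigma>) \<rho> = \<rho>"
        using that shift_row_tabloid[OF inv(1) len(2)] by (intro row_tabloid_inj) simp_all
      then have "permute_list (inv \<sigma>) (zip c \<rho>) = permute_list id (zip c \<rho>)"
        using inv len by (subst permute_list_zip[of _ "{..<?n}"]) auto
      then have "inv \<sigma> = id"
        using permute_list_distinct_inj[OF reads_zip(1)[OF t] _ inv(1) permutes_id] len by simp
      moreover have "inv (inv \<sigma>) = \<sigma>"
        using \<sigma> by (intro permutes_inv_inv[of _ "{..<?n}"]) (simp add: fixes_word_def)
      ultimately show ?thesis by simp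
    qed
    then show "(if shift_tabloid (inv \<sigma>) (row_tabloid \<rho>) = row_tabloid \<rho> then of_int (sign \<sigma>) else 0) =
        (if \<sigma> = id then 1 else (0::complex))"
      by (auto simp: shift_tabloid_def)
  qed
  moreover have "id \<in> fixes_word ?n c" by (simp add: fixes_word_def permutes_id)
  ultimately have "polytabloid l t (row_tabloid \<rho>) = 1" by simp
  then have "k \<noteq> 0" unfolding k by (auto simp: fun_scale_def)
  then show ?thesis using k by blast
qed

text \<open>Nonzero scalars do not affect spans; \<open>tableau_reads\<close> and
  \<open>word_reads\<close> give the two inclusions.\<close>

lemma specht_eq_colspan:
  assumes l: "partition l"
  shows "specht l = colspan (psize l) l"
proof
  show "specht l \<subseteq> colspan (psize l) l"
    unfolding specht_def
  proof (rule fun_space.span_minimal[OF _ subspace_colspan], rule image_subsetI)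
    fix t assume "t \<in> tableaux l"
    then obtain c \<rho> where t: "reads (psize l) l t c \<rho>" using tableau_reads by blast
    then obtain k where "polytabloid l t = fun_scale k (polytab (psize l) l c)"
      using polytabloid_proportional[OF l] by blast
    then show "polytabloid l t \<in> colspan (psize l) l"
      using fun_space.subspace_scale[OF subspace_colspan polytab_in_colspan[OF reads_words(1)[OF t]]] by simp
  qed
  show "colspan (psize l) l \<subseteq> specht l"
    unfolding colspan_def specht_def
  proof (rule fun_space.span_minimal[OF _ fun_space.subspace_span], rule image_subsetI)
    fix c assume "c \<in> words (psize l) (col_length l)"
    then obtain t where t: "t \<in> tableaux l" "reads (psize l) l t c (row_word c)"
      using word_reads[OF l] by blast
    then obtain k where "k \<noteq> 0" "polytabloid l t = fun_scale k (polytab (psize l) l c)"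
      using polytabloid_proportional[OF l] by blast
    then have "polytab (psize l) l c = fun_scale (inverse k) (polytabloid l t)"
      by (simp add: fun_scale_def fun_eq_iff)
    then show "polytab (psize l) l c \<in> fun_space.span (polytabloid l ` tableaux l)"
      using t(1) by (simp add: fun_space.span_scale fun_space.span_base)
  qed
qed

lemma tableaux_nonempty:
  assumes l: "partition l"
  shows "tableaux l \<noteq> {}"
proof -
  have fin: "finite {i. l i \<noteq> 0}" using l by (simp add: partition_def)
  have eq: "cells l = (SIGMA i:{i. l i \<noteq> 0}. {..<l i})" by (auto simp: cells_def)
  have "finite (cells l)" unfolding eq using fin by (intro finite_SigmaI) auto
  moreover have "card (cells l) = psize l"
    unfolding eq psize_def using fin by (subst card_SigmaI) auto
  ultimately obtain h where "bij_betw h (cells l) {..<psize l}"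
    using finite_same_card_bij[of "cells l" "{..<psize l}"] by auto
  then show ?thesis by (auto simp: tableaux_def)
qed

lemma words_nonempty: "partition l \<Longrightarrow> words (psize l) (col_length l) \<noteq> {}"
  using tableaux_nonempty tableau_reads reads_words by (metis all_not_in_conv)

section \<open>Tensor products and alternating forms\<close>

text \<open>\<open>g\<close> arises from \<open>f\<close> by moving one unit from \<open>i + 1\<close> to \<open>i\<close>, stated without subtraction.\<close>

definition raised :: "(nat \<Rightarrow> nat) \<Rightarrow> nat \<Rightarrow> (nat \<Rightarrow> nat) \<Rightarrow> bool" where
  "raised f i g \<longleftrightarrow> (\<forall>j. g j + (if j = Suc i then 1 else 0) = f j + (if j = i then 1 else 0))"

lemma count_list_list_update:
  "p < length d \<Longrightarrow> count_list (d[p := y]) j + (if j = d ! p then 1 else 0) = count_list d j + (if j = y then 1 else 0)"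
proof (induction d arbitrary: p)
  case (Cons x d)
  show ?case
  proof (cases p)
    case 0
    then show ?thesis by auto
  next
    case (Suc p')
    then show ?thesis using Cons.IH[of p'] Cons.prems by (auto split: if_splits)
  qed
qed simp

lemma raised_count_list:
  assumes "p < length d" "d ! p = i" "count_list (d[p := Suc i]) = a"
  shows "raised a i (count_list d)"
  unfolding raised_def using count_list_list_update[OF assms(1), of "Suc i"] assms(2,3) by auto

lemma alternating_map:
  fixes f :: "'b \<Rightarrow> 'a"
  assumes "alternating n F"
  shows "alternating n (\<lambda>w. F (map f w))"
  unfolding alternating_def
proof (intro allI impI)
  fix xs :: "'b list" and \<sigma> assume *: "length xs = n" "\<sigma> permutes {..<n}"
  then have "map f (permute_list \<sigma> xs) = permute_list \<sigma> (map f xs)"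
    by (simp add: permute_list_map)
  then show "F (map f (permute_list \<sigma> xs)) = of_int (sign \<sigma>) * F (map f xs)"
    using alternatingD[OF assms, of "map f xs" \<sigma>] * by simp
qed

lemma highest_weight_sum:
  assumes "\<And>x. x \<in> A \<Longrightarrow> highest_weight n a (h x)"
  shows "highest_weight n a (\<lambda>c. \<Sum>x\<in>A. k x * h x c)"
  unfolding highest_weight_def
proof (intro conjI allI impI)
  fix c assume "(\<Sum>x\<in>A. k x * h x c) \<noteq> 0"
  then obtain x where "x \<in> A" "k x * h x c \<noteq> 0" by (rule sum.not_neutral_contains_not_neutral)
  then show "c \<in> words n a" using assms[of x] by (auto simp: highest_weight_def)
next
  fix i d
  have "raising i (\<lambda>c. \<Sum>x\<in>A. k x * h x c) d = (\<Sum>x\<in>A. k x * raising i (h x) d)"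
    unfolding raising_def by (subst sum.swap) (simp add: sum_distrib_left)
  also have "\<dots> = 0" using assms by (intro sum.neutral) (auto simp: highest_weight_def)
  finally show "raising i (\<lambda>c. \<Sum>x\<in>A. k x * h x c) d = 0" .
qed

definition proj1 :: "(nat \<times> nat \<times> nat) list \<Rightarrow> nat list" where "proj1 w = map fst w"
definition proj2 :: "(nat \<times> nat \<times> nat) list \<Rightarrow> nat list" where "proj2 w = map (fst \<circ> snd) w"
definition proj3 :: "(nat \<times> nat \<times> nat) list \<Rightarrow> nat list" where "proj3 w = map (snd \<circ> snd) w"

lemma length_proj [simp]: "length (proj1 w) = length w" "length (proj2 w) = length w" "length (proj3 w) = length w"
  by (simp_all add: proj1_def proj2_def proj3_def)

lemma zip_proj: "zip (proj1 w) (zip (proj2 w) (proj3 w)) = w"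
  by (induction w) (auto simp: proj1_def proj2_def proj3_def)

lemma proj_zip:
  assumes "length c1 = n" "length c2 = n" "length c3 = n"
  shows "proj1 (zip c1 (zip c2 c3)) = c1" "proj2 (zip c1 (zip c2 c3)) = c2" "proj3 (zip c1 (zip c2 c3)) = c3"
  using assms by (auto simp: proj1_def proj2_def proj3_def simp flip: map_map)

lemma proj_permute_list:
  assumes "\<sigma> permutes {..<length w}"
  shows "proj1 (permute_list \<sigma> w) = permute_list \<sigma> (proj1 w)"
    "proj2 (permute_list \<sigma> w) = permute_list \<sigma> (proj2 w)"
    "proj3 (permute_list \<sigma> w) = permute_list \<sigma> (proj3 w)"
  using assms by (simp_all add: proj1_def proj2_def proj3_def permute_list_map)

lemma marginals_distinct:
  assumes "distinct w"
  shows "count_list (proj1 w) = x_marginal (set w)" "count_list (proj2 w) = y_marginal (set w)"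
    "count_list (proj3 w) = z_marginal (set w)"
proof -
  have "{v \<in> set w. fst v = i} = {(x, y, z) \<in> set w. x = i}"
    "{v \<in> set w. (fst \<circ> snd) v = i} = {(x, y, z) \<in> set w. y = i}"
    "{v \<in> set w. (snd \<circ> snd) v = i} = {(x, y, z) \<in> set w. z = i}" for i by auto
  then show "count_list (proj1 w) = x_marginal (set w)" "count_list (proj2 w) = y_marginal (set w)"
    "count_list (proj3 w) = z_marginal (set w)"
    unfolding proj1_def proj2_def proj3_def x_marginal_def y_marginal_def z_marginal_def
    by (simp_all only: count_list_map_card[OF assms] fun_eq_iff simp_thms)
qed

lemma zip3_permute:
  assumes "\<sigma> permutes {..<n}" "length c1 = n" "length c2 = n" "length c3 = n"
  shows "zip (permute_list \<sigma> c1) (zip (permute_list \<sigma> c2) (permute_list \<sigma> c3)) =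
    permute_list \<sigma> (zip c1 (zip c2 c3))"
  using assms by (simp add: permute_list_zip[of \<sigma> "{..<n}"])

lemma tensor_act_eq: "tensor_act \<sigma> F = (\<lambda>(R, S). F (shift_tabloid \<sigma> R, shift_tabloid \<sigma> S))"
  by (simp add: tensor_act_def shift_tabloid_def)

lemma polytab_shift:
  assumes "\<sigma> permutes {..<n}" "length c = n"
  shows "polytab n l (permute_list \<sigma> c) (shift_tabloid \<sigma> R) = of_int (sign \<sigma>) * polytab n l c R"
  using specht_act_polytab[OF assms, of l] by (simp add: specht_act_eq fun_scale_def fun_eq_iff)

text \<open>The bilinear pairing of \<open>v\<close> with \<open>polytab n l c\<close>; it turns a
  function on tabloids into one on column words.\<close>

definition row_pairing :: "nat \<Rightarrow> (nat \<Rightarrow> nat) \<Rightarrow> ((nat \<Rightarrow> nat set) \<Rightarrow> complex) \<Rightarrow> nat list \<Rightarrow> complex" where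
  "row_pairing n l v c = (\<Sum>\<rho>\<in>words n l. asgn (zip c \<rho>) * v (row_tabloid \<rho>))"

lemma row_pairing_permute:
  assumes \<sigma>: "\<sigma> permutes {..<n}" and c: "length c = n"
  shows "row_pairing n l v (permute_list \<sigma> c) = of_int (sign \<sigma>) * row_pairing n l (specht_act \<sigma> v) c"
proof -
  have "row_pairing n l v (permute_list \<sigma> c) =
      (\<Sum>\<rho>\<in>words n l. asgn (zip (permute_list \<sigma> c) (permute_list \<sigma> \<rho>)) * v (row_tabloid (permute_list \<sigma> \<rho>)))"
    unfolding row_pairing_def by (rule sum_permute_list_words[OF \<sigma>, symmetric])
  also have "\<dots> = (\<Sum>\<rho>\<in>words n l. of_int (sign \<sigma>) * (asgn (zip c \<rho>) * specht_act \<sigma> v (row_tabloid \<rho>)))"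
  proof (rule sum.cong[OF refl])
    fix \<rho> assume "\<rho> \<in> words n l"
    then have "length \<rho> = n" by (rule length_words)
    then show "asgn (zip (permute_list \<sigma> c) (permute_list \<sigma> \<rho>)) * v (row_tabloid (permute_list \<sigma> \<rho>)) =
        of_int (sign \<sigma>) * (asgn (zip c \<rho>) * specht_act \<sigma> v (row_tabloid \<rho>))"
      using asgn_zip_permute[OF \<sigma> c, of \<rho>] shift_row_tabloid[OF \<sigma>, of \<rho>] by (simp add: specht_act_eq)
  qed
  finally show ?thesis by (simp add: row_pairing_def sum_distrib_left)
qed

lemma row_pairing_linear:
  "row_pairing n l (u + v) c = row_pairing n l u c + row_pairing n l v c"
  "row_pairing n l (fun_scale k v) c = k * row_pairing n l v c"
  by (simp_all add: row_pairing_def fun_scale_def distrib_left sum.distrib sum_distrib_left mult.left_commute)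

definition tens :: "('x \<Rightarrow> complex) \<Rightarrow> ('y \<Rightarrow> complex) \<Rightarrow> 'x \<times> 'y \<Rightarrow> complex" where
  "tens f g = (\<lambda>(x, y). f x * g y)"

lemma tens_linear:
  "tens (f + f') g = tens f g + tens f' g" "tens f (g + g') = tens f g + tens f g'"
  "tens (fun_scale k f) g = fun_scale k (tens f g)" "tens f (fun_scale k g) = fun_scale k (tens f g)"
  by (auto simp: tens_def fun_scale_def fun_eq_iff algebra_simps)

lemma tensor_space_alt: "tensor_space V W = fun_space.span {tens f g | f g. f \<in> V \<and> g \<in> W}"
  by (simp add: tensor_space_def tens_def)

lemma subspace_tensor_space: "fun_space.subspace (tensor_space V W)"
  unfolding tensor_space_def by (rule fun_space.subspace_span)

lemma tens_in_tensor_space: "f \<in> V \<Longrightarrow> g \<in> W \<Longrightarrow> tens f g \<in> tensor_space V W"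
  unfolding tensor_space_alt by (rule fun_space.span_base) blast

lemma tens_in_span_tens:
  assumes f: "f \<in> fun_space.span A" and g: "g \<in> fun_space.span B"
  shows "tens f g \<in> fun_space.span {tens a b | a b. a \<in> A \<and> b \<in> B}"
proof -
  note S = fun_space.subspace_span[of "{tens a b | a b. a \<in> A \<and> b \<in> B}"]
  show ?thesis
  proof (rule linear_maps_span[OF tens_linear(1,3) S _ f])
    fix a assume "a \<in> A"
    then show "tens a g \<in> fun_space.span {tens a b | a b. a \<in> A \<and> b \<in> B}"
      by (intro linear_maps_span[OF tens_linear(2,4) S _ g] fun_space.span_base) blast
  qed
qed

lemma tensor_space_span:
  "tensor_space (fun_space.span A) (fun_space.span B) = fun_space.span {tens a b | a b. a \<in> A \<and> b \<in> B}"
proof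
  show "tensor_space (fun_space.span A) (fun_space.span B) \<subseteq> fun_space.span {tens a b | a b. a \<in> A \<and> b \<in> B}"
    unfolding tensor_space_alt using tens_in_span_tens
    by (intro fun_space.span_minimal fun_space.subspace_span) blast
  show "fun_space.span {tens a b | a b. a \<in> A \<and> b \<in> B} \<subseteq> tensor_space (fun_space.span A) (fun_space.span B)"
    unfolding tensor_space_alt
  proof (intro fun_space.span_mono subsetI)
    fix x assume "x \<in> {tens a b | a b. a \<in> A \<and> b \<in> B}"
    then obtain a b where "x = tens a b" "a \<in> A" "b \<in> B" by (elim CollectE exE conjE)
    then show "x \<in> {tens f g | f g. f \<in> fun_space.span A \<and> g \<in> fun_space.span B}"
      using fun_space.span_base[of a A] fun_space.span_base[of b B] by (intro CollectI exI conjI)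
  qed
qed

lemma tensor_space_supp:
  assumes w: "w \<in> tensor_space V W" and V: "\<And>f x. f \<in> V \<Longrightarrow> x \<notin> X \<Longrightarrow> f x = 0"
    and W: "\<And>f x. f \<in> W \<Longrightarrow> x \<notin> Y \<Longrightarrow> f x = 0" and z: "z \<notin> X \<times> Y"
  shows "w z = 0"
  using w unfolding tensor_space_alt
proof (induction rule: fun_space.span_induct)
  case base
  show ?case by (rule fun_space.subspaceI) (simp_all add: fun_scale_def)
next
  case (step x)
  then obtain f g where x: "x = tens f g" "f \<in> V" "g \<in> W" by blast
  obtain a b where ab: "z = (a, b)" by (cases z)
  then have "a \<notin> X \<or> b \<notin> Y" using z by blast
  then show ?case using V[OF x(2)] W[OF x(3)] by (auto simp: x(1) ab tens_def)
qed

lemma tensor_act_tens: "tensor_act \<sigma> (tens f g) = tens (specht_act \<sigma> f) (specht_act \<sigma> g)"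
  by (auto simp: tensor_act_eq specht_act_eq tens_def)

lemma tensor_act_linear:
  "tensor_act \<sigma> (f + g) = tensor_act \<sigma> f + tensor_act \<sigma> g"
  "tensor_act \<sigma> (fun_scale k f) = fun_scale k (tensor_act \<sigma> f)"
  "tensor_act \<sigma> 0 = 0"
  by (auto simp: tensor_act_eq fun_scale_def fun_eq_iff)

lemma linear_action_tensor: "linear_action G tensor_act"
  unfolding linear_action_def using tensor_act_linear by blast

lemma invariant_tensor_space:
  assumes V: "\<And>\<sigma> f. \<sigma> \<in> G \<Longrightarrow> f \<in> V \<Longrightarrow> specht_act \<sigma> f \<in> V"
    and W: "\<And>\<sigma> f. \<sigma> \<in> G \<Longrightarrow> f \<in> W \<Longrightarrow> specht_act \<sigma> f \<in> W"
  shows "invariant_subspace G tensor_act (tensor_space V W)"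
  unfolding invariant_subspace_def
proof (intro conjI ballI subspace_tensor_space)
  fix \<sigma> w assume \<sigma>: "\<sigma> \<in> G" and w: "w \<in> tensor_space V W"
  show "tensor_act \<sigma> w \<in> tensor_space V W"
  proof (rule linear_maps_span[OF tensor_act_linear(1,2) subspace_tensor_space _ w[unfolded tensor_space_alt]])
    fix x assume "x \<in> {tens f g | f g. f \<in> V \<and> g \<in> W}"
    then obtain f g where "x = tens f g" "f \<in> V" "g \<in> W" by blast
    then show "tensor_act \<sigma> x \<in> tensor_space V W"
      using tens_in_tensor_space[OF V[OF \<sigma>] W[OF \<sigma>]] by (simp only: tensor_act_tens)
  qed
qed

lemma unitary_tensor:
  "unitary_action {\<sigma>. \<sigma> permutes {..<n}} tensor_act (tabloids n m \<times> tabloids n p)"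
  unfolding unitary_action_def
proof
  fix \<sigma> assume "\<sigma> \<in> {\<sigma>. \<sigma> permutes {..<n}}"
  then have \<sigma>: "\<sigma> permutes {..<n}" by simp
  let ?X = "tabloids n m \<times> tabloids n p"
  let ?s = "\<lambda>(R, S). (shift_tabloid \<sigma> R, shift_tabloid \<sigma> S)"
  have bij: "bij_betw ?s ?X ?X"
    using shift_tabloid_inverse[OF \<sigma>] shift_tabloid_in_iff[OF \<sigma>] shift_tabloid_in_iff[OF permutes_inv[OF \<sigma>]]
    by (intro bij_betw_byWitness[where f' = "\<lambda>(R, S). (shift_tabloid (inv \<sigma>) R, shift_tabloid (inv \<sigma>) S)"]) auto
  have "ip ?X (tensor_act \<sigma> u) v = ip ?X u (tensor_act (inv \<sigma>) v)" for u v
  proof -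
    have "ip ?X u (tensor_act (inv \<sigma>) v) = (\<Sum>z\<in>?X. u (?s z) * cnj (tensor_act (inv \<sigma>) v (?s z)))"
      unfolding ip_def by (rule sum.reindex_bij_betw[OF bij, symmetric])
    also have "\<dots> = ip ?X (tensor_act \<sigma> u) v"
      unfolding ip_def using shift_tabloid_inverse[OF \<sigma>]
      by (intro sum.cong refl) (auto simp: tensor_act_eq)
    finally show ?thesis by simp
  qed
  then show "\<exists>h\<in>{\<sigma>. \<sigma> permutes {..<n}}. \<forall>u v. ip ?X (tensor_act \<sigma> u) v = ip ?X u (tensor_act h v)"
    using permutes_inv[OF \<sigma>] by blast
qed

lemma sum2_permute_list_words:
  assumes \<sigma>: "\<sigma> permutes {..<n}"
  shows "(\<Sum>x\<in>words n a. \<Sum>y\<in>words n b. h (permute_list \<sigma> x) (permute_list \<sigma> y)) =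
    (\<Sum>x\<in>words n a. \<Sum>y\<in>words n b. h x y)"
proof -
  have "(\<Sum>y\<in>words n b. h x (permute_list \<sigma> y)) = (\<Sum>y\<in>words n b. h x y)" for x
    by (rule sum_permute_list_words[OF \<sigma>])
  then have "(\<Sum>x\<in>words n a. \<Sum>y\<in>words n b. h (permute_list \<sigma> x) (permute_list \<sigma> y)) =
    (\<Sum>x\<in>words n a. \<Sum>y\<in>words n b. h (permute_list \<sigma> x) y)" by simp
  also have "\<dots> = (\<Sum>x\<in>words n a. \<Sum>y\<in>words n b. h x y)"
    by (rule sum_permute_list_words[OF \<sigma>])
  finally show ?thesis .
qed

lemma sum3_permute_list_words:
  assumes \<sigma>: "\<sigma> permutes {..<n}"
  shows "(\<Sum>x\<in>words n a. \<Sum>y\<in>words n b. \<Sum>z\<in>words n d.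
      h (permute_list \<sigma> x) (permute_list \<sigma> y) (permute_list \<sigma> z)) =
    (\<Sum>x\<in>words n a. \<Sum>y\<in>words n b. \<Sum>z\<in>words n d. h x y z)"
proof -
  have "(\<Sum>y\<in>words n b. \<Sum>z\<in>words n d. h x (permute_list \<sigma> y) (permute_list \<sigma> z)) =
      (\<Sum>y\<in>words n b. \<Sum>z\<in>words n d. h x y z)" for x
    by (rule sum2_permute_list_words[OF \<sigma>])
  then have "(\<Sum>x\<in>words n a. \<Sum>y\<in>words n b. \<Sum>z\<in>words n d.
      h (permute_list \<sigma> x) (permute_list \<sigma> y) (permute_list \<sigma> z)) =
    (\<Sum>x\<in>words n a. \<Sum>y\<in>words n b. \<Sum>z\<in>words n d. h (permute_list \<sigma> x) y z)" by simp
  also have "\<dots> = (\<Sum>x\<in>words n a. \<Sum>y\<in>words n b. \<Sum>z\<in>words n d. h x y z)"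
    by (rule sum_permute_list_words[OF \<sigma>])
  finally show ?thesis .
qed

section \<open>Homomorphisms and alternating functions on words of points\<close>

locale kronecker_setting =
  fixes l m p :: "nat \<Rightarrow> nat" and n :: nat
  assumes part: "partition l" "partition m" "partition p"
    and size: "psize l = n" "psize m = n" "psize p = n"
begin

abbreviation "C1 \<equiv> words n (col_length l)"
abbreviation "C2 \<equiv> words n (col_length m)"
abbreviation "C3 \<equiv> words n (col_length p)"
abbreviation "symgroup \<equiv> {\<sigma>. \<sigma> permutes {..<n}}"
abbreviation "V \<equiv> colspan n l"
abbreviation "W \<equiv> tensor_space (colspan n m) (colspan n p)"

definition admissible :: "(nat \<times> nat \<times> nat) list \<Rightarrow> bool" where
  "admissible w \<longleftrightarrow> proj1 w \<in> C1 \<and> proj2 w \<in> C2 \<and> proj3 w \<in> C3"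

definition point_sets :: "(nat \<times> nat \<times> nat) set set" where
  "point_sets = {P. finite P \<and> x_marginal P = col_length l \<and>
     y_marginal P = col_length m \<and> z_marginal P = col_length p}"

definition orbit_fun :: "(nat \<times> nat \<times> nat) set \<Rightarrow> (nat \<times> nat \<times> nat) list \<Rightarrow> complex" where
  "orbit_fun P w = (if length w = n \<and> set w = P then asgn w else 0)"

lemma admissible_iff:
  assumes "distinct w" "length w = n"
  shows "admissible w \<longleftrightarrow> set w \<in> point_sets"
  using assms marginals_distinct[OF assms(1)]
  by (auto simp: admissible_def point_sets_def words_def)

lemma admissible_length: "admissible w \<Longrightarrow> length w = n"
  using length_words[of "proj1 w" n] by (auto simp: admissible_def)

lemma length_ref_list_point_set:
  assumes "P \<in> point_sets"
  shows "length (ref_list P) = n"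
proof -
  have fin: "finite P" using assms by (simp add: point_sets_def)
  \<comment> \<open>The size of \<open>P\<close> is read off from a word of length \<open>n\<close>
    whose content is the x-marginal of \<open>P\<close>.\<close>
  obtain c0 where c0: "c0 \<in> C1" using words_nonempty[OF part(1)] size by blast
  have "count_list (proj1 (ref_list P)) = count_list c0"
    using marginals_distinct(1)[OF ref_list(2)[OF fin]] ref_list(1)[OF fin] assms c0
    by (simp add: point_sets_def words_def)
  then have "mset (proj1 (ref_list P)) = mset c0" by (simp add: multiset_eq_iff count_mset)
  then have "length (proj1 (ref_list P)) = length c0" by (rule mset_eq_length)
  then show ?thesis using c0 by (simp add: words_def)
qed

lemma admissible_ref_list: "P \<in> point_sets \<Longrightarrow> admissible (ref_list P)"
  using admissible_iff[of "ref_list P"] length_ref_list_point_set ref_list[of P]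
  by (simp add: point_sets_def)

lemma finite_point_sets: "finite point_sets"
proof (rule finite_surj)
  show "finite (C1 \<times> C2 \<times> C3)" by simp
  show "point_sets \<subseteq> (\<lambda>(c1, c2, c3). set (zip c1 (zip c2 c3))) ` (C1 \<times> C2 \<times> C3)"
  proof
    fix P assume P: "P \<in> point_sets"
    then have "set (zip (proj1 (ref_list P)) (zip (proj2 (ref_list P)) (proj3 (ref_list P)))) = P"
      unfolding zip_proj by (simp add: point_sets_def ref_list)
    then show "P \<in> (\<lambda>(c1, c2, c3). set (zip c1 (zip c2 c3))) ` (C1 \<times> C2 \<times> C3)"
      using admissible_ref_list[OF P] unfolding admissible_def by (intro rev_image_eqI) auto
  qed
qed

lemma alternating_orbit_fun: "alternating n (orbit_fun P)"
  unfolding alternating_def orbit_fun_def by (auto simp: asgn_permute_list)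

text \<open>An alternating function is determined by one value for each point set, taken at
  \<open>ref_list P\<close>; the factor \<open>asgn (ref_list P)\<close> cancels the sign that
  \<open>orbit_fun P\<close> has there.\<close>

lemma alternating_expansion:
  assumes F: "alternating n F" and supp: "\<And>w. F w \<noteq> 0 \<Longrightarrow> admissible w"
  shows "F \<in> fun_space.span (orbit_fun ` point_sets)"
proof -
  have "F w = (\<Sum>P\<in>point_sets. F (ref_list P) * asgn (ref_list P) * orbit_fun P w)" for w
  proof (cases "distinct w \<and> admissible w")
    case True
    then have len: "length w = n" and P: "set w \<in> point_sets"
      using admissible_length admissible_iff by blast+
    have r: "distinct (ref_list (set w))" "set (ref_list (set w)) = set w" using ref_list[of "set w"] by auto
    have "F w * asgn (ref_list (set w)) = F (ref_list (set w)) * asgn w"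
      using True r length_ref_list_point_set[OF P]
      by (intro alternating_proportional[OF F]) auto
    then have "F w = F (ref_list (set w)) * asgn (ref_list (set w)) * asgn w"
      using asgn_square[OF r(1)] by (metis (no_types, lifting) mult.assoc mult.commute mult_1)
    also have "\<dots> = (\<Sum>P\<in>{set w}. F (ref_list P) * asgn (ref_list P) * orbit_fun P w)"
      using len by (simp add: orbit_fun_def)
    also have "\<dots> = (\<Sum>P\<in>point_sets. F (ref_list P) * asgn (ref_list P) * orbit_fun P w)"
      using P finite_point_sets by (intro sum.mono_neutral_left) (auto simp: orbit_fun_def)
    finally show ?thesis .
  next
    case False
    have "F w = 0"
      using False supp[of w] alternating_eq_0[OF F, of w] admissible_length by blast
    moreover have "orbit_fun P w = 0" if "P \<in> point_sets" for P
      using False that admissible_iff[of w] by (auto simp: orbit_fun_def)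
    ultimately show ?thesis by simp
  qed
  note expansion = this
  have "F = (\<Sum>P\<in>point_sets. fun_scale (F (ref_list P) * asgn (ref_list P)) (orbit_fun P))"
  proof
    show "F w = (\<Sum>P\<in>point_sets. fun_scale (F (ref_list P) * asgn (ref_list P)) (orbit_fun P)) w" for w
      unfolding sum_apply fun_scale_def by (rule expansion)
  qed
  also have "\<dots> \<in> fun_space.span (orbit_fun ` point_sets)"
    by (intro fun_space.span_sum fun_space.span_scale fun_space.span_base) simp
  finally show ?thesis .
qed

text \<open>The matrix coefficients of \<open>\<phi>\<close>: the image of the polytabloid of the
  first coordinate word, paired with the tensor product of the polytabloids of the other
  two.\<close>

definition hom_form ::
    "(((nat \<Rightarrow> nat set) \<Rightarrow> complex) \<Rightarrow> (nat \<Rightarrow> nat set) \<times> (nat \<Rightarrow> nat set) \<Rightarrow> complex)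
      \<Rightarrow> (nat \<times> nat \<times> nat) list \<Rightarrow> complex" where
  "hom_form \<phi> w = (if admissible w then
     \<Sum>\<rho>2\<in>words n m. \<Sum>\<rho>3\<in>words n p. \<phi> (polytab n l (proj1 w)) (row_tabloid \<rho>2, row_tabloid \<rho>3)
       * (asgn (zip (proj2 w) \<rho>2) * asgn (zip (proj3 w) \<rho>3)) else 0)"

text \<open>Equivariance of \<open>\<phi>\<close> and the two kernels contribute one sign each, and
  the product of three equal signs is that sign.\<close>

lemma alternating_hom_form:
  assumes \<phi>: "rep_hom symgroup specht_act V tensor_act W \<phi>"
  shows "alternating n (hom_form \<phi>)"
  unfolding alternating_def
proof (intro allI impI)
  fix w :: "(nat \<times> nat \<times> nat) list" and \<sigma> assume len: "length w = n" and \<sigma>: "\<sigma> permutes {..<n}"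
  define c1 c2 c3 where c: "c1 = proj1 w" "c2 = proj2 w" "c3 = proj3 w"
  have pc: "proj1 (permute_list \<sigma> w) = permute_list \<sigma> c1" "proj2 (permute_list \<sigma> w) = permute_list \<sigma> c2"
    "proj3 (permute_list \<sigma> w) = permute_list \<sigma> c3"
    using proj_permute_list[of \<sigma> w] \<sigma> len by (simp_all add: c)
  have lc: "length c1 = n" "length c2 = n" "length c3 = n" using len by (simp_all add: c)
  have adm: "admissible (permute_list \<sigma> w) \<longleftrightarrow> admissible w"
    unfolding admissible_def pc unfolding c[symmetric] using lc \<sigma> by (simp add: words_def)
  show "hom_form \<phi> (permute_list \<sigma> w) = of_int (sign \<sigma>) * hom_form \<phi> w"
  proof (cases "admissible w")
    case False
    then show ?thesis using adm by (simp add: hom_form_def)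
  next
    case True
    then have c1: "c1 \<in> C1" by (simp add: admissible_def c)
    have pV: "polytab n l (permute_list \<sigma> c1) \<in> V"
      using polytab_in_colspan permute_list_in_words[OF \<sigma> c1] by blast
    let ?s = "of_int (sign \<sigma>) :: complex"
    have eq: "\<phi> (polytab n l (permute_list \<sigma> c1)) (shift_tabloid \<sigma> R, shift_tabloid \<sigma> S) =
        ?s * \<phi> (polytab n l c1) (R, S)" for R S
    proof -
      have "tensor_act \<sigma> (\<phi> (polytab n l (permute_list \<sigma> c1))) =
          \<phi> (specht_act \<sigma> (polytab n l (permute_list \<sigma> c1)))"
        using rep_homD(4)[OF \<phi> _ pV] \<sigma> by simp
      also have "\<dots> = fun_scale ?s (\<phi> (polytab n l c1))"
        unfolding specht_act_polytab[OF \<sigma> lc(1)]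
        using rep_homD(3)[OF \<phi> polytab_in_colspan[OF c1]] .
      finally show ?thesis by (simp add: tensor_act_eq fun_scale_def fun_eq_iff)
    qed
    have "hom_form \<phi> (permute_list \<sigma> w) = (\<Sum>\<rho>2\<in>words n m. \<Sum>\<rho>3\<in>words n p.
        \<phi> (polytab n l (permute_list \<sigma> c1)) (row_tabloid \<rho>2, row_tabloid \<rho>3)
          * (asgn (zip (permute_list \<sigma> c2) \<rho>2) * asgn (zip (permute_list \<sigma> c3) \<rho>3)))"
      using True adm by (simp add: hom_form_def pc)
    also have "\<dots> = (\<Sum>\<rho>2\<in>words n m. \<Sum>\<rho>3\<in>words n p.
        \<phi> (polytab n l (permute_list \<sigma> c1)) (row_tabloid (permute_list \<sigma> \<rho>2), row_tabloid (permute_list \<sigma> \<rho>3))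
          * (asgn (zip (permute_list \<sigma> c2) (permute_list \<sigma> \<rho>2)) * asgn (zip (permute_list \<sigma> c3) (permute_list \<sigma> \<rho>3))))"
      by (rule sum2_permute_list_words[OF \<sigma>, symmetric])
    also have "\<dots> = (\<Sum>\<rho>2\<in>words n m. \<Sum>\<rho>3\<in>words n p.
        ?s * (\<phi> (polytab n l c1) (row_tabloid \<rho>2, row_tabloid \<rho>3) * (asgn (zip c2 \<rho>2) * asgn (zip c3 \<rho>3))))"
    proof (intro sum.cong refl)
      fix \<rho>2 \<rho>3 assume "\<rho>2 \<in> words n m" "\<rho>3 \<in> words n p"
      then have lr: "length \<rho>2 = n" "length \<rho>3 = n" by (simp_all add: words_def)
      show "\<phi> (polytab n l (permute_list \<sigma> c1)) (row_tabloid (permute_list \<sigma> \<rho>2), row_tabloid (permute_list \<sigma> \<rho>3))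
          * (asgn (zip (permute_list \<sigma> c2) (permute_list \<sigma> \<rho>2)) * asgn (zip (permute_list \<sigma> c3) (permute_list \<sigma> \<rho>3)))
        = ?s * (\<phi> (polytab n l c1) (row_tabloid \<rho>2, row_tabloid \<rho>3) * (asgn (zip c2 \<rho>2) * asgn (zip c3 \<rho>3)))"
        unfolding asgn_zip_permute[OF \<sigma> lc(2) lr(1)] asgn_zip_permute[OF \<sigma> lc(3) lr(2)]
          shift_row_tabloid[OF \<sigma> lr(1), symmetric] shift_row_tabloid[OF \<sigma> lr(2), symmetric] eq
        by (simp add: mult_ac sign_square_left)
    qed
    also have "\<dots> = ?s * hom_form \<phi> w"
      using True by (simp add: hom_form_def c sum_distrib_left)
    finally show ?thesis .
  qed
qed

text \<open>The image lies in the span of the tensor products of polytabloids and is orthogonal to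
  all of them; since these are real, it vanishes.\<close>

lemma hom_form_eq_0:
  assumes \<phi>: "rep_hom symgroup specht_act V tensor_act W \<phi>" and zero: "hom_form \<phi> = 0" and c: "c \<in> C1"
  shows "\<phi> (polytab n l c) = 0"
proof
  fix z
  let ?w = "\<phi> (polytab n l c)"
  have wW: "?w \<in> W" using rep_homD(1)[OF \<phi> polytab_in_colspan[OF c]] .
  let ?B = "{tens a b | a b. a \<in> polytab n m ` C2 \<and> b \<in> polytab n p ` C3}"
  have "?w z = 0"
  proof (rule real_span_orthogonal_eq_0[of ?w ?B "tabloids n m \<times> tabloids n p"])
    show "?w \<in> fun_space.span ?B"
      using wW unfolding colspan_def[of n m] colspan_def[of n p] tensor_space_span .
    show "finite (tabloids n m \<times> tabloids n p)" by simp
    show "cnj (b x) = b x" if "b \<in> ?B" for b x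
      using that by (auto simp: tens_def polytab_def if_distrib split: prod.splits cong: if_cong)
    show "?w x = 0" if "x \<notin> tabloids n m \<times> tabloids n p" for x
      by (rule tensor_space_supp[OF wW _ _ that]) (rule colspan_supp; assumption)+
    show "(\<Sum>x\<in>tabloids n m \<times> tabloids n p. b x * ?w x) = 0" if bB: "b \<in> ?B" for b
    proof -
      obtain c2 c3 where c23: "c2 \<in> C2" "c3 \<in> C3" "b = tens (polytab n m c2) (polytab n p c3)"
        using bB by blast
      have len: "length c = n" "length c2 = n" "length c3 = n"
        using c c23 by (simp_all add: words_def)
      let ?z = "zip c (zip c2 c3)"
      have "(\<Sum>x\<in>tabloids n m \<times> tabloids n p. b x * ?w x) =
          (\<Sum>\<rho>2\<in>words n m. \<Sum>\<rho>3\<in>words n p. b (row_tabloid \<rho>2, row_tabloid \<rho>3) * ?w (row_tabloid \<rho>2, row_tabloid \<rho>3))"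
        by (simp add: sum.cartesian_product[symmetric, of "\<lambda>R S. b (R, S) * ?w (R, S)", simplified] sum_tabloids)
      also have "\<dots> = (\<Sum>\<rho>2\<in>words n m. \<Sum>\<rho>3\<in>words n p.
          ?w (row_tabloid \<rho>2, row_tabloid \<rho>3) * (asgn (zip c2 \<rho>2) * asgn (zip c3 \<rho>3)))"
        by (intro sum.cong refl) (simp add: c23(3) tens_def polytab_row_tabloid mult.commute)
      also have "\<dots> = hom_form \<phi> ?z"
        unfolding hom_form_def admissible_def proj_zip[OF len] using c c23 by simp
      also have "\<dots> = 0" unfolding zero by simp
      finally show ?thesis .
    qed
  qed
  then show "?w z = 0 z" by simp
qed

lemma hom_form_sum:
  "hom_form (\<lambda>v. \<Sum>j\<in>J. fun_scale (a j) (\<phi> j v)) = (\<Sum>j\<in>J. fun_scale (a j) (hom_form (\<phi> j)))"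
proof
  fix w
  show "hom_form (\<lambda>v. \<Sum>j\<in>J. fun_scale (a j) (\<phi> j v)) w = (\<Sum>j\<in>J. fun_scale (a j) (hom_form (\<phi> j))) w"
  proof (cases "admissible w")
    case True
    let ?g = "\<lambda>j \<rho>2 \<rho>3. a j * (\<phi> j (polytab n l (proj1 w)) (row_tabloid \<rho>2, row_tabloid \<rho>3)
       * (asgn (zip (proj2 w) \<rho>2) * asgn (zip (proj3 w) \<rho>3)))"
    have "hom_form (\<lambda>v. \<Sum>j\<in>J. fun_scale (a j) (\<phi> j v)) w = (\<Sum>\<rho>2\<in>words n m. \<Sum>\<rho>3\<in>words n p. \<Sum>j\<in>J. ?g j \<rho>2 \<rho>3)"
      using True by (simp add: hom_form_def sum_apply fun_scale_def sum_distrib_right mult.assoc)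
    also have "\<dots> = (\<Sum>\<rho>2\<in>words n m. \<Sum>j\<in>J. \<Sum>\<rho>3\<in>words n p. ?g j \<rho>2 \<rho>3)"
      by (intro sum.cong refl) (rule sum.swap)
    also have "\<dots> = (\<Sum>j\<in>J. \<Sum>\<rho>2\<in>words n m. \<Sum>\<rho>3\<in>words n p. ?g j \<rho>2 \<rho>3)"
      by (rule sum.swap)
    also have "\<dots> = (\<Sum>j\<in>J. fun_scale (a j) (hom_form (\<phi> j))) w"
      using True by (simp add: hom_form_def sum_apply fun_scale_def sum_distrib_left)
    finally show ?thesis .
  qed (simp add: hom_form_def sum_apply fun_scale_def)
qed

text \<open>\<open>F\<close> serves as the kernel of a homomorphism: \<open>v\<close> is paired off
  in the first coordinate, and polytabloids are inserted for the other two. This goes in the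
  direction opposite to \<open>hom_form\<close>; that nothing is lost is shown under rigidity in
  \<open>form_hom_injective\<close>.\<close>

definition form_hom ::
    "((nat \<times> nat \<times> nat) list \<Rightarrow> complex) \<Rightarrow> ((nat \<Rightarrow> nat set) \<Rightarrow> complex)
      \<Rightarrow> (nat \<Rightarrow> nat set) \<times> (nat \<Rightarrow> nat set) \<Rightarrow> complex" where
  "form_hom F v = (\<lambda>(R, S). \<Sum>c1\<in>C1. \<Sum>c2\<in>C2. \<Sum>c3\<in>C3.
     row_pairing n l v c1 * F (zip c1 (zip c2 c3)) * (polytab n m c2 R * polytab n p c3 S))"

lemma form_hom_alt:
  "form_hom F v = (\<Sum>c1\<in>C1. \<Sum>c2\<in>C2. \<Sum>c3\<in>C3.
     fun_scale (row_pairing n l v c1 * F (zip c1 (zip c2 c3))) (tens (polytab n m c2) (polytab n p c3)))"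
  by (auto simp: form_hom_def sum_apply fun_scale_def tens_def fun_eq_iff)

lemma form_hom_sum: "form_hom (\<Sum>i\<in>I. fun_scale (a i) (F i)) v = (\<Sum>i\<in>I. fun_scale (a i) (form_hom (F i) v))"
proof
  fix z :: "(nat \<Rightarrow> nat set) \<times> (nat \<Rightarrow> nat set)"
  obtain R S where z: "z = (R, S)" by (cases z)
  let ?g = "\<lambda>i c1 c2 c3. a i * (row_pairing n l v c1 * F i (zip c1 (zip c2 c3)) * (polytab n m c2 R * polytab n p c3 S))"
  have "form_hom (\<Sum>i\<in>I. fun_scale (a i) (F i)) v z = (\<Sum>c1\<in>C1. \<Sum>c2\<in>C2. \<Sum>c3\<in>C3. \<Sum>i\<in>I. ?g i c1 c2 c3)"
    by (simp add: form_hom_def z sum_apply fun_scale_def sum_distrib_left sum_distrib_right mult_ac)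
  also have "\<dots> = (\<Sum>c1\<in>C1. \<Sum>c2\<in>C2. \<Sum>i\<in>I. \<Sum>c3\<in>C3. ?g i c1 c2 c3)"
    by (intro sum.cong refl) (rule sum.swap)
  also have "\<dots> = (\<Sum>c1\<in>C1. \<Sum>i\<in>I. \<Sum>c2\<in>C2. \<Sum>c3\<in>C3. ?g i c1 c2 c3)"
    by (intro sum.cong refl) (rule sum.swap)
  also have "\<dots> = (\<Sum>i\<in>I. \<Sum>c1\<in>C1. \<Sum>c2\<in>C2. \<Sum>c3\<in>C3. ?g i c1 c2 c3)"
    by (rule sum.swap)
  also have "\<dots> = (\<Sum>i\<in>I. fun_scale (a i) (form_hom (F i) v)) z"
    by (simp add: form_hom_def z sum_apply fun_scale_def sum_distrib_left)
  finally show "form_hom (\<Sum>i\<in>I. fun_scale (a i) (F i)) v z = (\<Sum>i\<in>I. fun_scale (a i) (form_hom (F i) v)) z" .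
qed

text \<open>After reindexing all three sums by \<open>\<sigma>\<close>, the four signs of
  \<open>F\<close>, of the row pairing and of the two polytabloids multiply to 1.\<close>

lemma rep_hom_form_hom:
  assumes F: "alternating n F"
  shows "rep_hom symgroup specht_act V tensor_act W (form_hom F)"
  unfolding rep_hom_def
proof (intro conjI ballI allI)
  show "form_hom F v \<in> W" for v
    unfolding form_hom_alt
    by (intro fun_space.subspace_sum fun_space.subspace_scale subspace_tensor_space
        tens_in_tensor_space polytab_in_colspan)
  show "form_hom F (u + v) = form_hom F u + form_hom F v" for u v
    by (auto simp: form_hom_def row_pairing_linear fun_eq_iff distrib_right sum.distrib)
  show "form_hom F (fun_scale k v) = fun_scale k (form_hom F v)" for k v
    unfolding form_hom_def row_pairing_linear
    by (auto simp: fun_scale_def fun_eq_iff sum_distrib_left mult.assoc)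
  fix \<sigma> v assume "\<sigma> \<in> symgroup"
  then have \<sigma>: "\<sigma> permutes {..<n}" by simp
  let ?s = "of_int (sign \<sigma>) :: complex"
  show "form_hom F (specht_act \<sigma> v) = tensor_act \<sigma> (form_hom F v)"
  proof
    fix z :: "(nat \<Rightarrow> nat set) \<times> (nat \<Rightarrow> nat set)"
    obtain R S where z: "z = (R, S)" by (cases z)
    let ?R = "shift_tabloid \<sigma> R" and ?S = "shift_tabloid \<sigma> S" and ?\<sigma> = "permute_list \<sigma>"
    let ?f = "\<lambda>c1 c2 c3. row_pairing n l v c1 * F (zip c1 (zip c2 c3)) * (polytab n m c2 ?R * polytab n p c3 ?S)"
    have "tensor_act \<sigma> (form_hom F v) z = (\<Sum>c1\<in>C1. \<Sum>c2\<in>C2. \<Sum>c3\<in>C3. ?f c1 c2 c3)"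
      by (simp add: tensor_act_eq form_hom_def z)
    also have "\<dots> = (\<Sum>c1\<in>C1. \<Sum>c2\<in>C2. \<Sum>c3\<in>C3. ?f (?\<sigma> c1) (?\<sigma> c2) (?\<sigma> c3))"
      by (rule sum3_permute_list_words[OF \<sigma>, symmetric])
    also have "\<dots> = (\<Sum>c1\<in>C1. \<Sum>c2\<in>C2. \<Sum>c3\<in>C3. row_pairing n l (specht_act \<sigma> v) c1 *
        F (zip c1 (zip c2 c3)) * (polytab n m c2 R * polytab n p c3 S))"
    proof (intro sum.cong refl)
      fix c1 c2 c3 assume "c1 \<in> C1" "c2 \<in> C2" "c3 \<in> C3"
      then have len: "length c1 = n" "length c2 = n" "length c3 = n" by (simp_all add: words_def)
      have "F (zip (?\<sigma> c1) (zip (?\<sigma> c2) (?\<sigma> c3))) = ?s * F (zip c1 (zip c2 c3))"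
        unfolding zip3_permute[OF \<sigma> len] using alternatingD[OF F _ \<sigma>] len by simp
      then show "?f (?\<sigma> c1) (?\<sigma> c2) (?\<sigma> c3) = row_pairing n l (specht_act \<sigma> v) c1 *
          F (zip c1 (zip c2 c3)) * (polytab n m c2 R * polytab n p c3 S)"
        unfolding row_pairing_permute[OF \<sigma> len(1)] polytab_shift[OF \<sigma> len(2)] polytab_shift[OF \<sigma> len(3)]
        by (simp add: mult_ac sign_square_left)
    qed
    also have "\<dots> = form_hom F (specht_act \<sigma> v) z" by (simp add: form_hom_def z)
    finally show "form_hom F (specht_act \<sigma> v) z = tensor_act \<sigma> (form_hom F v) z" by simp
  qed
qed

lemma rep_hom_generator:
  assumes \<theta>: "rep_hom symgroup specht_act V tensor_act W \<theta>" and c: "c \<in> C1" and zero: "\<theta> (polytab n l c) = 0"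
    and c': "c' \<in> C1"
  shows "\<theta> (polytab n l c') = 0"
proof -
  have "mset c = mset c'" using c c' by (simp add: words_def multiset_eq_iff count_mset)
  then obtain \<sigma> where \<sigma>: "\<sigma> permutes {..<n}" "permute_list \<sigma> c' = c"
    using mset_eq_permutation[of c c'] c' by (auto simp: words_def)
  have "fun_scale (of_int (sign \<sigma>)) (\<theta> (polytab n l c')) = \<theta> (specht_act \<sigma> (polytab n l c))"
    using specht_act_polytab[OF \<sigma>(1), of c' l] c' \<sigma>(2) rep_homD(3)[OF \<theta> polytab_in_colspan[OF c']]
    by (simp add: words_def)
  also have "\<dots> = 0"
    using rep_homD(4)[OF \<theta> _ polytab_in_colspan[OF c]] \<sigma>(1) zero by (simp add: tensor_act_linear)
  finally show ?thesis by (simp add: fun_space.scale_eq_0_iff)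
qed

end

section \<open>Rigidity and injectivity of the map from forms to homomorphisms\<close>

definition rigid :: "(nat \<Rightarrow> nat) \<Rightarrow> (nat \<Rightarrow> nat) \<Rightarrow> (nat \<Rightarrow> nat) \<Rightarrow> bool" where
  "rigid l m p \<longleftrightarrow> (\<forall>P i. finite P \<longrightarrow>
     \<not> (raised (col_length l) i (x_marginal P) \<and> y_marginal P = col_length m \<and> z_marginal P = col_length p) \<and>
     \<not> (x_marginal P = col_length l \<and> raised (col_length m) i (y_marginal P) \<and> z_marginal P = col_length p) \<and>
     \<not> (x_marginal P = col_length l \<and> y_marginal P = col_length m \<and> raised (col_length p) i (z_marginal P)))"

lemma map_zip_swap:
  assumes "length c1 = n" "length c2 = n" "length c3 = n"
  shows "map (\<lambda>(y, x, z). (x, y, z)) (zip c2 (zip c1 c3)) = zip c1 (zip c2 c3)"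
    and "map (\<lambda>(z, x, y). (x, y, z)) (zip c3 (zip c1 c2)) = zip c1 (zip c2 c3)"
  using assms by (auto intro!: nth_equalityI)

lemma marginals_zip:
  assumes "length c1 = n" "length c2 = n" "length c3 = n" "distinct (zip c1 (zip c2 c3))"
  shows "x_marginal (set (zip c1 (zip c2 c3))) = count_list c1"
    "y_marginal (set (zip c1 (zip c2 c3))) = count_list c2"
    "z_marginal (set (zip c1 (zip c2 c3))) = count_list c3"
  using marginals_distinct[OF assms(4)] unfolding proj_zip[OF assms(1-3)] by simp_all

context kronecker_setting
begin

text \<open>If lowering one letter left all points distinct, the new word would enumerate a point
  set with one marginal raised, against rigidity; so a point repeats and
  \<open>alternating_highest_weight\<close> applies. For the second and third coordinates the
  triples are rearranged so that the varying coordinate comes first.\<close>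

lemma highest_weight_slices:
  assumes F: "alternating n F" and rigid: "rigid l m p"
  shows "c2 \<in> C2 \<Longrightarrow> c3 \<in> C3 \<Longrightarrow>
      highest_weight n (col_length l) (\<lambda>c1. if c1 \<in> C1 then F (zip c1 (zip c2 c3)) else 0)"
    and "c1 \<in> C1 \<Longrightarrow> c3 \<in> C3 \<Longrightarrow>
      highest_weight n (col_length m) (\<lambda>c2. if c2 \<in> C2 then F (zip c1 (zip c2 c3)) else 0)"
    and "c1 \<in> C1 \<Longrightarrow> c2 \<in> C2 \<Longrightarrow>
      highest_weight n (col_length p) (\<lambda>c3. if c3 \<in> C3 then F (zip c1 (zip c2 c3)) else 0)"
proof -
  assume c: "c2 \<in> C2" "c3 \<in> C3"
  then have len: "length c2 = n" "length c3 = n" by (simp_all add: words_def)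
  show "highest_weight n (col_length l) (\<lambda>c1. if c1 \<in> C1 then F (zip c1 (zip c2 c3)) else 0)"
  proof (rule alternating_highest_weight[OF F])
    show "length (zip c2 c3) = n" using len by simp
    fix d k i assume k: "k < n" "d ! k = i" "d[k := Suc i] \<in> words n (col_length l)"
    then have d: "length d = n" "raised (col_length l) i (count_list d)"
      using raised_count_list[of k d i] by (auto simp: words_def)
    show "\<not> distinct (zip d (zip c2 c3))"
    proof
      assume dist: "distinct (zip d (zip c2 c3))"
      note marg = marginals_zip[OF d(1) len dist]
      show False
        using rigid[unfolded rigid_def, rule_format, of "set (zip d (zip c2 c3))" i] d(2) c
        unfolding marg by (simp add: words_def)
    qed
  qed
next
  assume c: "c1 \<in> C1" "c3 \<in> C3"
  then have len: "length c1 = n" "length c3 = n" by (simp_all add: words_def)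
  let ?f = "\<lambda>(y, x, z). (x, y, z)"
  have "highest_weight n (col_length m)
      (\<lambda>c2. if c2 \<in> C2 then F (map ?f (zip c2 (zip c1 c3))) else 0)"
  proof (rule alternating_highest_weight[OF alternating_map[OF F]])
    show "length (zip c1 c3) = n" using len by simp
    fix d k i assume k: "k < n" "d ! k = i" "d[k := Suc i] \<in> words n (col_length m)"
    then have d: "length d = n" "raised (col_length m) i (count_list d)"
      using raised_count_list[of k d i] by (auto simp: words_def)
    show "\<not> distinct (zip d (zip c1 c3))"
    proof
      assume "distinct (zip d (zip c1 c3))"
      then have "distinct (map ?f (zip d (zip c1 c3)))" by (auto simp: distinct_map inj_on_def)
      then have dist: "distinct (zip c1 (zip d c3))" using map_zip_swap(1)[OF len(1) d(1) len(2)] by simp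
      note marg = marginals_zip[OF len(1) d(1) len(2) dist]
      show False
        using rigid[unfolded rigid_def, rule_format, of "set (zip c1 (zip d c3))" i] d(2) c
        unfolding marg by (simp add: words_def)
    qed
  qed
  moreover have "(\<lambda>c2. if c2 \<in> C2 then F (map ?f (zip c2 (zip c1 c3))) else 0) =
      (\<lambda>c2. if c2 \<in> C2 then F (zip c1 (zip c2 c3)) else 0)"
  proof
    fix c2
    show "(if c2 \<in> C2 then F (map ?f (zip c2 (zip c1 c3))) else 0) =
        (if c2 \<in> C2 then F (zip c1 (zip c2 c3)) else 0)"
      using map_zip_swap(1)[OF len(1) _ len(2), of c2] by (simp add: words_def)
  qed
  ultimately show "highest_weight n (col_length m) (\<lambda>c2. if c2 \<in> C2 then F (zip c1 (zip c2 c3)) else 0)"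
    by simp
next
  assume c: "c1 \<in> C1" "c2 \<in> C2"
  then have len: "length c1 = n" "length c2 = n" by (simp_all add: words_def)
  let ?f = "\<lambda>(z, x, y). (x, y, z)"
  have "highest_weight n (col_length p)
      (\<lambda>c3. if c3 \<in> C3 then F (map ?f (zip c3 (zip c1 c2))) else 0)"
  proof (rule alternating_highest_weight[OF alternating_map[OF F]])
    show "length (zip c1 c2) = n" using len by simp
    fix d k i assume k: "k < n" "d ! k = i" "d[k := Suc i] \<in> words n (col_length p)"
    then have d: "length d = n" "raised (col_length p) i (count_list d)"
      using raised_count_list[of k d i] by (auto simp: words_def)
    show "\<not> distinct (zip d (zip c1 c2))"
    proof
      assume "distinct (zip d (zip c1 c2))"
      then have "distinct (map ?f (zip d (zip c1 c2)))" by (auto simp: distinct_map inj_on_def)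
      then have dist: "distinct (zip c1 (zip c2 d))" using map_zip_swap(2)[OF len d(1)] by simp
      note marg = marginals_zip[OF len d(1) dist]
      show False
        using rigid[unfolded rigid_def, rule_format, of "set (zip c1 (zip c2 d))" i] d(2) c
        unfolding marg by (simp add: words_def)
    qed
  qed
  moreover have "(\<lambda>c3. if c3 \<in> C3 then F (map ?f (zip c3 (zip c1 c2))) else 0) =
      (\<lambda>c3. if c3 \<in> C3 then F (zip c1 (zip c2 c3)) else 0)"
  proof
    fix c3
    show "(if c3 \<in> C3 then F (map ?f (zip c3 (zip c1 c2))) else 0) =
        (if c3 \<in> C3 then F (zip c1 (zip c2 c3)) else 0)"
      using map_zip_swap(2)[OF len, of c3] by (simp add: words_def)
  qed
  ultimately show "highest_weight n (col_length p) (\<lambda>c3. if c3 \<in> C3 then F (zip c1 (zip c2 c3)) else 0)"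
    by simp
qed

lemma form_hom_injective:
  assumes F: "alternating n F" and rigid: "rigid l m p" and c0: "c0 \<in> C1"
    and zero: "form_hom F (polytab n l c0) = 0"
    and c: "c1 \<in> C1" "c2 \<in> C2" "c3 \<in> C3"
  shows "F (zip c1 (zip c2 c3)) = 0"
proof -
  define H where "H = (\<lambda>c1 c2 c3. F (zip c1 (zip c2 c3)))"
  define k where "k = (\<lambda>c c1. row_pairing n l (polytab n l c) c1)"
  have zero': "(\<Sum>c1\<in>C1. \<Sum>c2\<in>C2. \<Sum>c3\<in>C3. k c c1 * H c1 c2 c3 * (asgn (zip c2 \<rho>2) * asgn (zip c3 \<rho>3))) = 0"
    if "c \<in> C1" "\<rho>2 \<in> words n m" "\<rho>3 \<in> words n p" for c \<rho>2 \<rho>3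
  proof -
    have "form_hom F (polytab n l c) (row_tabloid \<rho>2, row_tabloid \<rho>3) = 0"
      using rep_hom_generator[OF rep_hom_form_hom[OF F] c0 zero that(1)] by simp
    then show ?thesis
      using that(2,3) by (simp add: form_hom_def polytab_row_tabloid k_def H_def)
  qed
  have step3: "(\<Sum>c1\<in>C1. k c c1 * (\<Sum>c2\<in>C2. asgn (zip c2 \<rho>2) * H c1 c2 c3)) = 0"
    if "c \<in> C1" "\<rho>2 \<in> words n m" "c3 \<in> C3" for c \<rho>2 c3
  proof -
    let ?g = "\<lambda>c3. \<Sum>c1\<in>C1. k c c1 * (\<Sum>c2\<in>C2. asgn (zip c2 \<rho>2) * (if c3 \<in> C3 then H c1 c2 c3 else 0))"
    have "?g c3 = 0"
    proof (rule highest_weight_orthogonal_eq_0[OF part(3), where f = ?g])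
      show "highest_weight n (col_length p) ?g"
        unfolding H_def by (intro highest_weight_sum highest_weight_slices[OF F rigid])
      fix \<rho>3 assume \<rho>3: "\<rho>3 \<in> words n p"
      have "(\<Sum>c3\<in>C3. asgn (zip c3 \<rho>3) * ?g c3) =
          (\<Sum>c3\<in>C3. \<Sum>c1\<in>C1. \<Sum>c2\<in>C2. k c c1 * H c1 c2 c3 * (asgn (zip c2 \<rho>2) * asgn (zip c3 \<rho>3)))"
        by (intro sum.cong refl) (simp add: sum_distrib_left mult_ac)
      also have "\<dots> = (\<Sum>c1\<in>C1. \<Sum>c3\<in>C3. \<Sum>c2\<in>C2. k c c1 * H c1 c2 c3 * (asgn (zip c2 \<rho>2) * asgn (zip c3 \<rho>3)))"
        by (rule sum.swap)
      also have "\<dots> = (\<Sum>c1\<in>C1. \<Sum>c2\<in>C2. \<Sum>c3\<in>C3. k c c1 * H c1 c2 c3 * (asgn (zip c2 \<rho>2) * asgn (zip c3 \<rho>3)))"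
        by (rule sum.cong[OF refl], rule sum.swap)
      also have "\<dots> = 0" using zero'[OF that(1,2) \<rho>3] .
      finally show "(\<Sum>c3\<in>C3. asgn (zip c3 \<rho>3) * ?g c3) = 0" .
    qed
    then show ?thesis using that(3) by simp
  qed
  have step2: "(\<Sum>c1\<in>C1. k c c1 * H c1 c2 c3) = 0" if "c \<in> C1" "c2 \<in> C2" "c3 \<in> C3" for c c2 c3
  proof -
    let ?g = "\<lambda>c2. \<Sum>c1\<in>C1. k c c1 * (if c2 \<in> C2 then H c1 c2 c3 else 0)"
    have "?g c2 = 0"
    proof (rule highest_weight_orthogonal_eq_0[OF part(2), where f = ?g])
      show "highest_weight n (col_length m) ?g"
        unfolding H_def by (intro highest_weight_sum highest_weight_slices[OF F rigid] that(3))
      fix \<rho>2 assume \<rho>2: "\<rho>2 \<in> words n m"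
      have "(\<Sum>c2\<in>C2. asgn (zip c2 \<rho>2) * ?g c2) =
          (\<Sum>c2\<in>C2. \<Sum>c1\<in>C1. k c c1 * (asgn (zip c2 \<rho>2) * H c1 c2 c3))"
        by (intro sum.cong refl) (simp add: sum_distrib_left mult_ac)
      also have "\<dots> = (\<Sum>c1\<in>C1. \<Sum>c2\<in>C2. k c c1 * (asgn (zip c2 \<rho>2) * H c1 c2 c3))"
        by (rule sum.swap)
      also have "\<dots> = (\<Sum>c1\<in>C1. k c c1 * (\<Sum>c2\<in>C2. asgn (zip c2 \<rho>2) * H c1 c2 c3))"
        by (simp add: sum_distrib_left)
      also have "\<dots> = 0" using step3[OF that(1) \<rho>2 that(3)] .
      finally show "(\<Sum>c2\<in>C2. asgn (zip c2 \<rho>2) * ?g c2) = 0" .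
    qed
    then show ?thesis using that(2) by simp
  qed
  \<comment> \<open>One kernel factor of \<open>k\<close> is absorbed into \<open>u\<close>, an
    element of \<open>colspan n l\<close> orthogonal to all polytabloids; \<open>u = 0\<close> then
    says that the other factor annihilates a highest weight function of \<open>c1\<close>.\<close>
  define u where "u = (\<Sum>c1\<in>C1. fun_scale (H c1 c2 c3) (polytab n l c1))"
  have u_row: "u (row_tabloid \<rho>) = (\<Sum>c1\<in>C1. asgn (zip c1 \<rho>) * H c1 c2 c3)" if "\<rho> \<in> words n l" for \<rho>
    using that by (simp add: u_def sum_apply fun_scale_def polytab_row_tabloid mult.commute)
  have "u = 0"
  proof (rule colspan_orthogonal_eq_0)
    show "u \<in> V"
      unfolding u_def
      by (intro fun_space.subspace_sum fun_space.subspace_scale subspace_colspan polytab_in_colspan)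
    fix c' assume c': "c' \<in> C1"
    have "(\<Sum>\<rho>\<in>words n l. asgn (zip c' \<rho>) * u (row_tabloid \<rho>)) =
        (\<Sum>\<rho>\<in>words n l. \<Sum>c1\<in>C1. asgn (zip c1 \<rho>) * polytab n l c' (row_tabloid \<rho>) * H c1 c2 c3)"
      by (intro sum.cong refl) (simp add: u_row polytab_row_tabloid sum_distrib_left mult_ac)
    also have "\<dots> = (\<Sum>c1\<in>C1. \<Sum>\<rho>\<in>words n l. asgn (zip c1 \<rho>) * polytab n l c' (row_tabloid \<rho>) * H c1 c2 c3)"
      by (rule sum.swap)
    also have "\<dots> = (\<Sum>c1\<in>C1. k c' c1 * H c1 c2 c3)"
      by (simp add: k_def row_pairing_def sum_distrib_right)
    also have "\<dots> = 0" using step2[OF c' c(2,3)] .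
    finally show "(\<Sum>\<rho>\<in>words n l. asgn (zip c' \<rho>) * u (row_tabloid \<rho>)) = 0" .
  qed
  have "(if c1 \<in> C1 then H c1 c2 c3 else 0) = 0"
  proof (rule highest_weight_orthogonal_eq_0[OF part(1), where f = "\<lambda>c1. if c1 \<in> C1 then H c1 c2 c3 else 0"])
    show "highest_weight n (col_length l) (\<lambda>c1. if c1 \<in> C1 then H c1 c2 c3 else 0)"
      unfolding H_def by (rule highest_weight_slices(1)[OF F rigid c(2,3)])
    fix \<rho> assume "\<rho> \<in> words n l"
    then have "(\<Sum>c1\<in>C1. asgn (zip c1 \<rho>) * H c1 c2 c3) = 0"
      using u_row \<open>u = 0\<close> by simp
    then show "(\<Sum>c1\<in>C1. asgn (zip c1 \<rho>) * (if c1 \<in> C1 then H c1 c2 c3 else 0)) = 0" by simp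
  qed
  then show ?thesis using c(1) by (simp add: H_def)
qed

lemma invariant_W: "invariant_subspace symgroup tensor_act W"
  using invariant_colspan unfolding invariant_subspace_def
  by (intro invariant_tensor_space[unfolded invariant_subspace_def]) blast+

text \<open>\<open>hom_form\<close> allows at most one summand for each point set, and by rigidity
  \<open>form_hom\<close> provides at least one for each.\<close>

lemma card_specht_summands:
  assumes D: "irreducible_decomposition symgroup tensor_act W D" and rigid: "rigid l m p"
  shows "card {U \<in> D. isomorphic_reps symgroup tensor_act U specht_act V} = card point_sets"
proof -
  obtain c0 where c0: "c0 \<in> C1" using words_nonempty[OF part(1)] size by blast
  let ?e = "polytab n l c0"
  show ?thesis
  proof (rule card_isomorphic_summands[where e = ?e and \<Phi> = hom_form and y = orbit_fun
        and \<theta> = "\<lambda>P. form_hom (orbit_fun P)", OF D linear_action_tensor])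
    show irr: "irreducible_subspace symgroup specht_act V"
      using colspan_irreducible[OF part(1)] c0 by blast
    show "?e \<in> V" using polytab_in_colspan[OF c0] .
    have "polytab n l c0 (row_tabloid (row_word c0)) \<noteq> 0"
      using polytab_row_tabloid[OF row_word_in_words[OF part(1) c0]] distinct_zip_row_word by simp
    then show "?e \<noteq> 0" by (metis zero_fun_apply)
    show "\<exists>k. \<psi> ?e = fun_scale k ?e" if "rep_hom symgroup specht_act V specht_act V \<psi>" for \<psi>
      using colspan_endomorphism_scalar[OF part(1) c0 that] .
    show "finite point_sets" by (rule finite_point_sets)
    show "rep_hom symgroup specht_act V tensor_act W (form_hom (orbit_fun P))" for P
      by (rule rep_hom_form_hom[OF alternating_orbit_fun])
    show "a P = 0" if s: "(\<Sum>P\<in>point_sets. fun_scale (a P) (form_hom (orbit_fun P) ?e)) = 0" and P: "P \<in> point_sets" for a P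
    proof -
      let ?F = "\<Sum>P\<in>point_sets. fun_scale (a P) (orbit_fun P)"
      have alt: "alternating n ?F"
        unfolding alternating_def sum_apply fun_scale_def
        by (simp add: alternatingD[OF alternating_orbit_fun] sum_distrib_left mult_ac)
      have zero: "form_hom ?F ?e = 0" using s unfolding form_hom_sum .
      let ?w = "ref_list P"
      have fin: "finite P" using P by (simp add: point_sets_def)
      have "?F ?w = 0"
        using form_hom_injective[OF alt rigid c0 zero, of "proj1 ?w" "proj2 ?w" "proj3 ?w"]
          admissible_ref_list[OF P] unfolding admissible_def zip_proj by blast
      \<comment> \<open>At the reference order of \<open>P\<close> only \<open>orbit_fun P\<close>
        is nonzero, which isolates the coefficient \<open>a P\<close>.\<close>
      moreover have "?F ?w = (\<Sum>Q\<in>point_sets. if Q = P then a P * asgn ?w else 0)"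
        unfolding sum_apply using length_ref_list_point_set[OF P] ref_list[OF fin]
        by (intro sum.cong refl) (auto simp: fun_scale_def orbit_fun_def)
      ultimately have "a P * asgn ?w = 0" using P finite_point_sets by simp
      then show ?thesis using ref_list(2)[OF fin] by simp
    qed
    show "hom_form \<phi> \<in> fun_space.span (orbit_fun ` point_sets)"
      if "rep_hom symgroup specht_act V tensor_act W \<phi>" for \<phi>
      by (rule alternating_expansion[OF alternating_hom_form[OF that]]) (simp add: hom_form_def split: if_splits)
    show "hom_form (\<lambda>v. \<Sum>j\<in>J. fun_scale (a j) (\<phi> j v)) = (\<Sum>j\<in>J. fun_scale (a j) (hom_form (\<phi> j)))" for J a \<phi>
      by (rule hom_form_sum)
    show "\<phi> ?e = 0" if "rep_hom symgroup specht_act V tensor_act W \<phi>" "hom_form \<phi> = 0" for \<phi>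
      using hom_form_eq_0[OF that c0] .
  qed
qed

text \<open>\<open>THE\<close> demands that a decomposition exists and that all of them give the
  same number; the latter holds because \<open>card_specht_summands\<close> treats an arbitrary
  decomposition.\<close>

theorem kronecker_coeff_eq_t_count:
  assumes rigid: "rigid l m p"
  shows "kronecker_coeff l m p = t_count l m p"
proof -
  have t: "t_count l m p = card point_sets" by (simp add: t_count_def point_sets_def)
  have "\<exists>D. irreducible_decomposition symgroup tensor_act W D"
  proof (rule irreducible_decomposition_exists[OF unitary_tensor _ invariant_W])
    show "finite (tabloids n m \<times> tabloids n p)" by simp
    show "w x = 0" if "w \<in> W" "x \<notin> tabloids n m \<times> tabloids n p" for w x
      by (rule tensor_space_supp[OF that(1) _ _ that(2)]) (rule colspan_supp; assumption)+
  qed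
  then show ?thesis
    unfolding t kronecker_coeff_def irr_multiplicity_def specht_eq_colspan[OF part(1)]
      specht_eq_colspan[OF part(2)] specht_eq_colspan[OF part(3)] size
    using card_specht_summands[OF _ rigid] by (intro the_equality) auto
qed

end

section \<open>Point sets and marginals\<close>

lemma finite_simplex [simp]: "finite (simplex s)"
  by (rule finite_subset[of _ "{..<s} \<times> {..<s} \<times> {..<s}"]) (auto simp: simplex_def)

text \<open>A crude bound by the points on one axis. It bounds the candidates for
  \<open>GREATEST\<close> in \<open>p_min\<close> by \<open>n\<close>, so that the greatest one
  exists.\<close>

lemma le_card_simplex: "s \<le> card (simplex s)"
proof -
  have "card ((\<lambda>x. (x, 0, 0)) ` {..<s} :: (nat \<times> nat \<times> nat) set) \<le> card (simplex s)"
    by (intro card_mono[OF finite_simplex]) (auto simp: simplex_def)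
  then show ?thesis by (simp add: card_image inj_on_def)
qed

definition coord_sum :: "(nat \<times> nat \<times> nat) set \<Rightarrow> nat" where
  "coord_sum P = (\<Sum>(x, y, z)\<in>P. x + y + z)"

text \<open>The points of the simplex are exactly those for which \<open>x + y + z - r\<close> is negative, so the
  simplex minimizes the sum of \<open>x + y + z - r\<close> over all finite point sets.\<close>

lemma p_min_le_coord_sum:
  assumes "finite P" "card P = n"
  shows "p_min n \<le> coord_sum P"
proof -
  define r where "r = (GREATEST s. card (simplex s) \<le> n)"
  have r: "card (simplex r) \<le> n"
    unfolding r_def
  proof (rule GreatestI_nat)
    have "simplex 0 = {}" by (auto simp: simplex_def)
    then show "card (simplex 0) \<le> n" by simp
    show "y \<le> n" if "card (simplex y) \<le> n" for y using le_card_simplex[of y] that by simp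
  qed
  obtain b1 b2 b3 where b: "simplex_sum r = (b1, b2, b3)" by (cases "simplex_sum r")
  have "b1 + b2 + b3 = coord_sum (simplex r)"
  proof -
    have "b1 = (\<Sum>v\<in>simplex r. fst v)" "b2 = (\<Sum>v\<in>simplex r. fst (snd v))" "b3 = (\<Sum>v\<in>simplex r. snd (snd v))"
      using arg_cong[OF b, of fst] arg_cong[OF b, of "\<lambda>v. fst (snd v)"] arg_cong[OF b, of "\<lambda>v. snd (snd v)"]
      by (simp_all add: simplex_sum_def fst_sum snd_sum)
    then show ?thesis by (simp add: coord_sum_def sum.distrib case_prod_unfold)
  qed
  then have p: "p_min n = coord_sum (simplex r) + r * (n - card (simplex r))"
    unfolding p_min_def Let_def r_def[symmetric] b by simp
  let ?f = "\<lambda>(x, y, z). int (x + y + z) - int r"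
  have f: "sum ?f A = int (coord_sum A) - int r * int (card A)" if "finite A" for A
    using that by (simp add: coord_sum_def case_prod_unfold sum_subtractf)
  have "sum ?f (simplex r) \<le> sum ?f (P \<inter> simplex r)"
  proof -
    have "sum ?f (simplex r) = sum ?f (P \<inter> simplex r) + sum ?f (simplex r - P)"
      using sum.Int_Diff[OF finite_simplex, of ?f r P] by (simp only: Int_commute)
    moreover have "sum ?f (simplex r - P) \<le> 0" by (rule sum_nonpos) (auto simp: simplex_def)
    ultimately show ?thesis by simp
  qed
  also have "\<dots> \<le> sum ?f P"
    using assms(1) by (intro sum_mono2) (auto simp: simplex_def)
  finally have "int (coord_sum (simplex r)) - int r * int (card (simplex r)) \<le> int (coord_sum P) - int r * int n"
    using f assms by simp
  moreover have "int (p_min n) = int (coord_sum (simplex r)) + (int r * int n - int r * int (card (simplex r)))"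
  proof -
    have "int (n - card (simplex r)) = int n - int (card (simplex r))" using r by (rule of_nat_diff)
    then show ?thesis unfolding p of_nat_add of_nat_mult by (simp only: right_diff_distrib)
  qed
  ultimately have "int (p_min n) \<le> int (coord_sum P)" by linarith
  then show ?thesis by simp
qed

lemma sum_by_value:
  fixes f :: "'a \<Rightarrow> nat" and w :: "nat \<Rightarrow> nat"
  assumes "finite P" "\<And>v. v \<in> P \<Longrightarrow> f v < N"
  shows "(\<Sum>v\<in>P. w (f v)) = (\<Sum>j<N. w j * card {v \<in> P. f v = j})"
proof -
  have "(\<Sum>v\<in>P. w (f v)) = (\<Sum>v\<in>P. \<Sum>j<N. if f v = j then w j else 0)"
    using assms(2) by (intro sum.cong refl) simp
  also have "\<dots> = (\<Sum>j<N. \<Sum>v\<in>P. if f v = j then w j else 0)" by (rule sum.swap)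
  also have "\<dots> = (\<Sum>j<N. w j * card {v \<in> P. f v = j})"
    using assms(1) by (intro sum.cong refl) (simp add: sum.If_cases Int_def mult.commute)
  finally show ?thesis .
qed

lemma marginal_sums:
  assumes fin: "finite P" and N: "P \<subseteq> {..<N} \<times> {..<N} \<times> {..<N}"
  shows "card P = (\<Sum>j<N. x_marginal P j)" "card P = (\<Sum>j<N. y_marginal P j)"
    "card P = (\<Sum>j<N. z_marginal P j)"
    and "coord_sum P = (\<Sum>j<N. j * x_marginal P j) + (\<Sum>j<N. j * y_marginal P j) + (\<Sum>j<N. j * z_marginal P j)"
proof -
  have eq: "x_marginal P j = card {v \<in> P. fst v = j}" "y_marginal P j = card {v \<in> P. fst (snd v) = j}"
    "z_marginal P j = card {v \<in> P. snd (snd v) = j}" for j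
    unfolding x_marginal_def y_marginal_def z_marginal_def by (auto intro!: arg_cong[of _ _ card])
  have lt: "fst v < N" "fst (snd v) < N" "snd (snd v) < N" if "v \<in> P" for v using N that by auto
  note s = sum_by_value[of P fst N, OF fin lt(1)] sum_by_value[of P "\<lambda>v. fst (snd v)" N, OF fin lt(2)]
    sum_by_value[of P "\<lambda>v. snd (snd v)" N, OF fin lt(3)]
  show "card P = (\<Sum>j<N. x_marginal P j)" "card P = (\<Sum>j<N. y_marginal P j)" "card P = (\<Sum>j<N. z_marginal P j)"
    using s[of "\<lambda>_. 1"] by (simp_all add: eq)
  show "coord_sum P = (\<Sum>j<N. j * x_marginal P j) + (\<Sum>j<N. j * y_marginal P j) + (\<Sum>j<N. j * z_marginal P j)"
    using s[of "\<lambda>j. j"] by (simp add: eq coord_sum_def case_prod_unfold sum.distrib)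
qed

lemma raised_moment:
  assumes "raised f i g" "Suc i < N"
  shows "Suc (\<Sum>j<N. j * g j) = (\<Sum>j<N. j * f j)"
proof -
  have add: "(\<Sum>j<N. j * (h j + (if j = k then 1 else 0))) = (\<Sum>j<N. j * h j) + k" if "k < N"
    for h :: "nat \<Rightarrow> nat" and k
  proof -
    have "(\<Sum>j<N. j * (h j + (if j = k then 1 else 0))) = (\<Sum>j<N. j * h j + (if j = k then k else 0))"
      by (intro sum.cong refl) (auto simp: distrib_left)
    then show ?thesis using that by (simp add: sum.distrib)
  qed
  have "(\<Sum>j<N. j * g j) + Suc i = (\<Sum>j<N. j * f j) + i"
    using add[of "Suc i" g] add[of i f] assms by (simp add: raised_def)
  then show ?thesis by simp
qed

lemma psize_rows:
  assumes "\<And>i. i \<ge> M \<Longrightarrow> l i = 0"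
  shows "psize l = (\<Sum>i<M. l i)"
proof -
  have "{i. l i \<noteq> 0} \<subseteq> {..<M}" using assms by (auto intro: not_le_imp_less)
  then show ?thesis unfolding psize_def by (intro sum.mono_neutral_left) auto
qed

lemma partition_bound:
  assumes "partition l"
  shows "\<exists>M. \<forall>i\<ge>M. l i = 0"
proof -
  have "finite {i. l i \<noteq> 0}" using assms by (simp add: partition_def)
  then obtain M where "\<forall>i\<in>{i. l i \<noteq> 0}. i < M" using finite_nat_set_iff_bounded by blast
  then have "l i = 0" if "i \<ge> M" for i using that by (meson mem_Collect_eq not_le)
  then show ?thesis by blast
qed

lemma partition_le_first: "partition l \<Longrightarrow> l i \<le> l 0"
  by (simp add: partition_def antimonoD)

lemma col_length_eq_0: "partition l \<Longrightarrow> num_columns l \<le> j \<Longrightarrow> col_length l j = 0"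
  using less_col_length_iff[of l 0 j] by (simp add: num_columns_def)

lemma psize_columns:
  assumes l: "partition l" and N: "num_columns l \<le> N"
  shows "psize l = (\<Sum>j<N. col_length l j)"
proof -
  obtain M where M: "\<And>i. i \<ge> M \<Longrightarrow> l i = 0" using partition_bound[OF l] by blast
  have "psize l = (\<Sum>i<M. l i)" using psize_rows[OF M] .
  also have "\<dots> = (\<Sum>i<M. \<Sum>j<N. if j < l i then 1 else 0)"
  proof (intro sum.cong refl)
    fix i
    have "{j. j < N \<and> j < l i} = {..<l i}"
      using partition_le_first[OF l, of i] N by (auto simp: num_columns_def)
    then show "l i = (\<Sum>j<N. if j < l i then 1 else 0)" by (simp add: sum.If_cases Int_def)
  qed
  also have "\<dots> = (\<Sum>j<N. \<Sum>i<M. if j < l i then 1 else 0)" by (rule sum.swap)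
  also have "\<dots> = (\<Sum>j<N. col_length l j)"
  proof (intro sum.cong refl)
    fix j
    have "{i. i < M \<and> j < l i} = {i. j < l i}" using M by (metis not_le not_less_zero)
    then show "(\<Sum>i<M. if j < l i then 1 else 0) = col_length l j"
      by (simp add: sum.If_cases Int_def col_length_def)
  qed
  finally show ?thesis .
qed

lemma moment_columns:
  assumes l: "partition l" and N: "num_columns l \<le> N"
  shows "(\<Sum>j<N. j * col_length l j) = (\<Sum>j<num_columns l. j * col_length l j)"
  using N col_length_eq_0[OF l] by (intro sum.mono_neutral_right) auto

text \<open>Raising a marginal lowers the coordinate sum by one, below the minimum.\<close>

lemma simplex_like_rigid:
  assumes s: "simplex_like l m p"
  shows "rigid l m p"
  unfolding rigid_def
proof (intro allI impI)
  fix P :: "(nat \<times> nat \<times> nat) set" and i assume fin: "finite P"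
  have part: "partition l" "partition m" "partition p" and size: "psize l = psize m" "psize m = psize p"
    and mom: "(\<Sum>j<num_columns l. j * col_length l j) + (\<Sum>j<num_columns m. j * col_length m j)
      + (\<Sum>j<num_columns p. j * col_length p j) = p_min (psize l)"
    using s by (auto simp: simplex_like_def)
  have "finite (fst ` P \<union> (fst \<circ> snd) ` P \<union> (snd \<circ> snd) ` P)" using fin by simp
  then obtain N0 where N0: "\<forall>k\<in>fst ` P \<union> (fst \<circ> snd) ` P \<union> (snd \<circ> snd) ` P. k < N0"
    using finite_nat_set_iff_bounded by blast
  \<comment> \<open>Large enough for the coordinates of \<open>P\<close>, the columns of the three
    partitions and the index \<open>Suc i\<close>, so that every sum may run over the same
    range.\<close>
  define N where "N = N0 + num_columns l + num_columns m + num_columns p + i + 2"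
  have sub: "P \<subseteq> {..<N} \<times> {..<N} \<times> {..<N}"
  proof
    fix v assume v: "v \<in> P"
    then have "fst v < N0" "(fst \<circ> snd) v < N0" "(snd \<circ> snd) v < N0" using N0 by blast+
    then show "v \<in> {..<N} \<times> {..<N} \<times> {..<N}" by (cases v) (simp add: N_def)
  qed
  have N: "num_columns l \<le> N" "num_columns m \<le> N" "num_columns p \<le> N" "Suc i < N" by (simp_all add: N_def)
  note marg = marginal_sums[OF fin sub]
  have contra: False
    if "card P = psize l" "Suc (coord_sum P) = (\<Sum>j<N. j * col_length l j) + (\<Sum>j<N. j * col_length m j)
      + (\<Sum>j<N. j * col_length p j)"
    using p_min_le_coord_sum[OF fin that(1)] that(2) mom
    unfolding moment_columns[OF part(1) N(1)] moment_columns[OF part(2) N(2)] moment_columns[OF part(3) N(3)]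
    by simp
  note size_sums = psize_columns[OF part(1) N(1)] psize_columns[OF part(2) N(2)] psize_columns[OF part(3) N(3)]
  show "\<not> (raised (col_length l) i (x_marginal P) \<and> y_marginal P = col_length m \<and> z_marginal P = col_length p) \<and>
     \<not> (x_marginal P = col_length l \<and> raised (col_length m) i (y_marginal P) \<and> z_marginal P = col_length p) \<and>
     \<not> (x_marginal P = col_length l \<and> y_marginal P = col_length m \<and> raised (col_length p) i (z_marginal P))"
  proof (intro conjI notI; elim conjE)
    \<comment> \<open>The number of points is taken from a marginal that is not raised.\<close>
    assume *: "raised (col_length l) i (x_marginal P)" "y_marginal P = col_length m" "z_marginal P = col_length p"
    show False
      using contra marg(2,4) raised_moment[OF *(1) N(4)] size size_sums *(2,3) by simp
  next
    assume *: "x_marginal P = col_length l" "raised (col_length m) i (y_marginal P)" "z_marginal P = col_length p"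
    show False
      using contra marg(1,4) raised_moment[OF *(2) N(4)] size size_sums *(1,3) by simp
  next
    assume *: "x_marginal P = col_length l" "y_marginal P = col_length m" "raised (col_length p) i (z_marginal P)"
    show False
      using contra marg(1,4) raised_moment[OF *(3) N(4)] size size_sums *(1,2) by simp
  qed
qed

section \<open>Putting a full box in front of a point set\<close>

definition glue :: "nat \<Rightarrow> nat \<Rightarrow> nat \<Rightarrow> (nat \<times> nat \<times> nat) set \<Rightarrow> (nat \<times> nat \<times> nat) set" where
  "glue a b c P = {..<a} \<times> {..<b} \<times> {..<c} \<union> (\<lambda>(x, y, z). (x + a, y, z)) ` P"

definition unglue :: "nat \<Rightarrow> (nat \<times> nat \<times> nat) set \<Rightarrow> (nat \<times> nat \<times> nat) set" where
  "unglue a P = {(x, y, z). (x + a, y, z) \<in> P}"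

lemma unglue_glue: "unglue a (glue a b c P) = P"
  by (force simp: unglue_def glue_def)

lemma finite_glue: "finite P \<Longrightarrow> finite (glue a b c P)"
  by (simp add: glue_def)

lemma finite_unglue:
  assumes "finite P"
  shows "finite (unglue a P)"
proof -
  have "unglue a P = (\<lambda>(x, y, z). (x + a, y, z)) -` P" by (auto simp: unglue_def)
  then show ?thesis using assms by (auto intro!: finite_vimageI simp: inj_on_def)
qed

lemma glue_marginals:
  assumes "finite P"
  shows "x_marginal (glue a b c P) j = (if j < a then b * c else x_marginal P (j - a))"
    and "y_marginal (glue a b c P) j = y_marginal P j + (if j < b then a * c else 0)"
    and "z_marginal (glue a b c P) j = z_marginal P j + (if j < c then a * b else 0)"
proof -
  let ?s = "\<lambda>(x, y, z). (x + a, y, z) :: nat \<times> nat \<times> nat"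
  have img: "card (?s ` A) = card A" for A by (rule card_image) (auto simp: inj_on_def)
  show "x_marginal (glue a b c P) j = (if j < a then b * c else x_marginal P (j - a))"
  proof (cases "j < a")
    case True
    then have "{(x, y, z) \<in> glue a b c P. x = j} = {j} \<times> {..<b} \<times> {..<c}"
      by (auto simp: glue_def)
    then show ?thesis using True by (simp add: x_marginal_def card_cartesian_product)
  next
    case False
    then have "{(x, y, z) \<in> glue a b c P. x = j} = ?s ` {(x, y, z) \<in> P. x = j - a}"
      by (force simp: glue_def)
    then show ?thesis using False img[of "{(x, y, z) \<in> P. x = j - a}"] unfolding x_marginal_def by simp
  qed
  have "{(x, y, z) \<in> glue a b c P. y = j} =
      {..<a} \<times> ({j} \<inter> {..<b}) \<times> {..<c} \<union> ?s ` {(x, y, z) \<in> P. y = j}"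
    by (force simp: glue_def)
  moreover have "card (\<dots>) = card ({..<a} \<times> ({j} \<inter> {..<b}) \<times> {..<c}) + card (?s ` {(x, y, z) \<in> P. y = j})"
    using finite_subset[OF _ assms, of "{(x, y, z) \<in> P. y = j}"]
    by (intro card_Un_disjoint) auto
  ultimately show "y_marginal (glue a b c P) j = y_marginal P j + (if j < b then a * c else 0)"
    using img[of "{(x, y, z) \<in> P. y = j}"] unfolding y_marginal_def
    by (simp add: card_cartesian_product)
  have "{(x, y, z) \<in> glue a b c P. z = j} =
      {..<a} \<times> {..<b} \<times> ({j} \<inter> {..<c}) \<union> ?s ` {(x, y, z) \<in> P. z = j}"
    by (force simp: glue_def)
  moreover have "card (\<dots>) = card ({..<a} \<times> {..<b} \<times> ({j} \<inter> {..<c})) + card (?s ` {(x, y, z) \<in> P. z = j})"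
    using finite_subset[OF _ assms, of "{(x, y, z) \<in> P. z = j}"]
    by (intro card_Un_disjoint) auto
  ultimately show "z_marginal (glue a b c P) j = z_marginal P j + (if j < c then a * b else 0)"
    using img[of "{(x, y, z) \<in> P. z = j}"] unfolding z_marginal_def
    by (simp add: card_cartesian_product)
qed

lemma x_marginal_box:
  assumes "P \<subseteq> UNIV \<times> {..<b} \<times> {..<c}"
  shows "x_marginal P i \<le> b * c"
    and "b * c \<le> x_marginal P i \<Longrightarrow> {i} \<times> {..<b} \<times> {..<c} \<subseteq> P"
proof -
  let ?Q = "{i} \<times> {..<b} \<times> {..<c}"
  have sub: "{(x, y, z) \<in> P. x = i} \<subseteq> ?Q" using assms by auto
  have Q: "finite ?Q" "card ?Q = b * c" by (simp_all add: card_cartesian_product)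
  show "x_marginal P i \<le> b * c" unfolding x_marginal_def using card_mono[OF Q(1) sub] Q(2) by simp
  assume "b * c \<le> x_marginal P i"
  then have "{(x, y, z) \<in> P. x = i} = ?Q"
    using Q by (intro card_subset_eq[OF Q(1) sub]) (use card_mono[OF Q(1) sub] in \<open>simp add: x_marginal_def\<close>)
  then have "?Q \<subseteq> {(x, y, z) \<in> P. x = i}" by (rule equalityD2)
  also have "\<dots> \<subseteq> P" by auto
  finally show "?Q \<subseteq> P" .
qed

lemma glue_unglue:
  assumes "P \<subseteq> UNIV \<times> {..<b} \<times> {..<c}" "\<And>i. i < a \<Longrightarrow> b * c \<le> x_marginal P i"
  shows "glue a b c (unglue a P) = P"
proof
  have "{..<a} \<times> {..<b} \<times> {..<c} \<subseteq> P" using x_marginal_box(2)[OF assms(1) assms(2)] by blast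
  then show "glue a b c (unglue a P) \<subseteq> P" by (auto simp: glue_def unglue_def)
  show "P \<subseteq> glue a b c (unglue a P)"
  proof
    fix v assume v: "v \<in> P"
    obtain x y z where xyz: "v = (x, y, z)" by (cases v)
    show "v \<in> glue a b c (unglue a P)"
    proof (cases "x < a")
      case True
      then show ?thesis using v assms(1) by (auto simp: xyz glue_def)
    next
      case False
      then have "(x - a, y, z) \<in> unglue a P" using v by (simp add: unglue_def xyz)
      then show ?thesis using False by (force simp: glue_def xyz)
    qed
  qed
qed

lemma box_from_marginals:
  assumes "finite P" "\<And>j. j \<ge> b \<Longrightarrow> y_marginal P j = 0" "\<And>j. j \<ge> c \<Longrightarrow> z_marginal P j = 0"
  shows "P \<subseteq> UNIV \<times> {..<b} \<times> {..<c}"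
proof
  fix v assume v: "v \<in> P"
  obtain x y z where xyz: "v = (x, y, z)" by (cases v)
  have "finite {(x', y', z') \<in> P. y' = y}" "finite {(x', y', z') \<in> P. z' = z}"
    using assms(1) by (auto intro: finite_subset[of _ P])
  then have "y_marginal P y \<noteq> 0" "z_marginal P z \<noteq> 0"
    using v xyz by (auto simp: y_marginal_def z_marginal_def)
  then show "v \<in> UNIV \<times> {..<b} \<times> {..<c}" using assms(2)[of y] assms(3)[of z] xyz by (auto intro: not_le_imp_less)
qed

text \<open>The unit leaves \<open>Suc i\<close>, where \<open>f\<close> must be positive, and moves
  to a smaller index. So a point set with a raised y- or z-marginal stays inside the box.\<close>

lemma raised_eq_0:
  assumes "raised f i g" "\<And>j. j \<ge> b \<Longrightarrow> f j = 0"
  shows "Suc i < b" and "j \<ge> b \<Longrightarrow> g j = 0"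
proof -
  show i: "Suc i < b"
    using assms(1)[unfolded raised_def, rule_format, of "Suc i"] assms(2)[of "Suc i"] by (auto intro: not_le_imp_less)
  show "g j = 0" if "j \<ge> b"
    using assms(1)[unfolded raised_def, rule_format, of j] assms(2)[OF that] i that by (auto split: if_splits)
qed

lemma partition_prepend_parts:
  assumes m: "partition m" and b: "num_columns m \<le> b"
  shows "partition (prepend_parts k b m)"
    and "col_length (prepend_parts k b m) j = col_length m j + (if j < b then k else 0)"
    and "psize (prepend_parts k b m) = k * b + psize m"
proof -
  let ?q = "prepend_parts k b m"
  have anti: "m i \<le> m j" if "j \<le> i" for i j using m that by (simp add: partition_def antimonoD)
  have le_b: "m i \<le> b" for i using anti[of 0 i] b by (simp add: num_columns_def)
  obtain M where M: "\<And>i. i \<ge> M \<Longrightarrow> m i = 0" using partition_bound[OF m] by blast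
  have "?q i = 0" if "i \<ge> k + M" for i using that M[of "i - k"] by (simp add: prepend_parts_def)
  then have "{i. ?q i \<noteq> 0} \<subseteq> {..<k + M}" by (auto intro: not_le_imp_less)
  then have "finite {i. ?q i \<noteq> 0}" by (rule finite_subset) simp
  moreover have "antimono ?q"
    unfolding antimono_def using anti le_b by (auto simp: prepend_parts_def diff_le_mono)
  ultimately show q: "partition ?q" by (simp add: partition_def)
  have eq: "{i. j < ?q i} = {i. i < k \<and> j < b} \<union> (\<lambda>i. i + k) ` {i. j < m i}" for j
  proof (intro set_eqI)
    fix i
    have "i \<in> (\<lambda>i. i + k) ` {i. j < m i} \<longleftrightarrow> k \<le> i \<and> j < m (i - k)"
      by (auto simp: image_iff intro!: exI[of _ "i - k"])
    then show "i \<in> {i. j < ?q i} \<longleftrightarrow> i \<in> {i. i < k \<and> j < b} \<union> (\<lambda>i. i + k) ` {i. j < m i}"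
      by (auto simp: prepend_parts_def)
  qed
  show col: "col_length ?q j = col_length m j + (if j < b then k else 0)" for j
  proof -
    have "card {i. j < ?q i} = card {i. i < k \<and> j < b} + card ((\<lambda>i. i + k) ` {i. j < m i})"
      unfolding eq using finite_column[OF m] by (intro card_Un_disjoint) auto
    then show ?thesis by (simp add: col_length_def card_image)
  qed
  have "num_columns ?q \<le> b" using le_b by (simp add: num_columns_def prepend_parts_def)
  then show "psize ?q = k * b + psize m"
    using psize_columns[OF q] psize_columns[OF m b] by (simp add: col sum.distrib)
qed

text \<open>When \<open>l\<close> has at most \<open>k\<close> rows, which is the condition
  \<open>l k = 0\<close>, the construction puts \<open>a\<close> columns of length \<open>k\<close>
  in front. In general the first \<open>a\<close> columns have length at least \<open>k\<close>,
  which is enough to force full slices.\<close>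

lemma partition_add_to_first:
  assumes l: "partition l"
  shows "partition (add_to_first k a l)" and "psize (add_to_first k a l) = k * a + psize l"
    and "j < a \<Longrightarrow> k \<le> col_length (add_to_first k a l) j"
    and "a = 0 \<or> l k = 0 \<Longrightarrow> col_length (add_to_first k a l) (j + a) = col_length l j"
    and "l k = 0 \<Longrightarrow> j < a \<Longrightarrow> col_length (add_to_first k a l) j = k"
proof -
  let ?q = "add_to_first k a l"
  have anti: "l i \<le> l j" if "j \<le> i" for i j using l that by (simp add: partition_def antimonoD)
  obtain M where M: "\<And>i. i \<ge> M \<Longrightarrow> l i = 0" using partition_bound[OF l] by blast
  have sup: "?q i = 0" if "i \<ge> k + M" for i using that M by (simp add: add_to_first_def)
  then have "{i. ?q i \<noteq> 0} \<subseteq> {..<k + M}" by (auto intro: not_le_imp_less)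
  then have "finite {i. ?q i \<noteq> 0}" by (rule finite_subset) simp
  moreover have "antimono ?q"
    unfolding antimono_def using anti by (auto simp: add_to_first_def intro: add_mono trans_le_add2)
  ultimately show q: "partition ?q" by (simp add: partition_def)
  have "psize ?q = (\<Sum>i<k + M. if i < k then a else 0) + (\<Sum>i<k + M. l i)"
    using psize_rows[OF sup] by (simp add: add_to_first_def sum.distrib)
  also have "(\<Sum>i<k + M. if i < k then a else 0) = k * a"
  proof -
    have "{i. i < k + M \<and> i < k} = {..<k}" by auto
    then show ?thesis by (simp add: sum.If_cases Int_def)
  qed
  also have "(\<Sum>i<k + M. l i) = psize l" using psize_rows[of "k + M" l] M by simp
  finally show "psize ?q = k * a + psize l" .
  show "k \<le> col_length ?q j" if "j < a"
  proof -
    have "{..<k} \<subseteq> {i. j < ?q i}" using that by (auto simp: add_to_first_def)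
    then show ?thesis using card_mono[OF finite_column[OF q], of "{..<k}" j] by (simp add: col_length_def)
  qed
  have zero: "l i = 0" if "l k = 0" "i \<ge> k" for i using anti[OF that(2)] that(1) by simp
  show "col_length ?q (j + a) = col_length l j" if "a = 0 \<or> l k = 0"
  proof -
    have "j + a < ?q i \<longleftrightarrow> j < l i" for i
      using that zero[of i] by (cases "i < k") (auto simp: add_to_first_def)
    then show ?thesis by (simp add: col_length_def)
  qed
  show "col_length ?q j = k" if "l k = 0" "j < a"
  proof -
    have "{i. j < ?q i} = {..<k}"
      using that zero by (auto simp: add_to_first_def not_less)
    then show ?thesis by (simp add: col_length_def)
  qed
qed

locale stretched =
  fixes l m p :: "nat \<Rightarrow> nat" and a b c :: nat
  assumes part: "partition l" "partition m" "partition p"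
    and columns: "num_columns m \<le> b" "num_columns p \<le> c"
begin

abbreviation "lt \<equiv> add_to_first (b * c) a l"
abbreviation "mt \<equiv> prepend_parts (a * c) b m"
abbreviation "pt \<equiv> prepend_parts (a * b) c p"

lemma col_mt_0: "j \<ge> b \<Longrightarrow> col_length mt j = 0"
  and col_m_0: "j \<ge> b \<Longrightarrow> col_length m j = 0"
  using partition_prepend_parts(2)[OF part(2) columns(1)] col_length_eq_0[OF part(2)] columns(1) by simp_all

lemma col_pt_0: "j \<ge> c \<Longrightarrow> col_length pt j = 0"
  and col_p_0: "j \<ge> c \<Longrightarrow> col_length p j = 0"
  using partition_prepend_parts(2)[OF part(3) columns(2)] col_length_eq_0[OF part(3)] columns(2) by simp_all

text \<open>If \<open>l\<close> has more than \<open>b * c\<close> rows, then so does \<open>lt\<close>, whose columns are then not those of \<open>l\<close>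
  with \<open>a\<close> columns put in front; but then no point set fits in the box.\<close>

lemma unglue_point_set:
  assumes fin: "finite P" and box: "P \<subseteq> UNIV \<times> {..<b} \<times> {..<c}"
    and x: "\<And>j. j < a \<Longrightarrow> x_marginal P j = col_length lt j"
  shows "glue a b c (unglue a P) = P"
    and "col_length lt (j + a) = col_length l j"
    and "x_marginal (unglue a P) j = x_marginal P (j + a)"
    and "y_marginal P j = y_marginal (unglue a P) j + (if j < b then a * c else 0)"
    and "z_marginal P j = z_marginal (unglue a P) j + (if j < c then a * b else 0)"
proof -
  show g: "glue a b c (unglue a P) = P"
    using x partition_add_to_first(3)[OF part(1)] by (intro glue_unglue[OF box]) simp
  have "l (b * c) = 0" if "a \<noteq> 0"
  proof -
    have "col_length lt 0 \<le> b * c" using x[of 0] x_marginal_box(1)[OF box, of 0] that by simp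
    then have "\<not> 0 < lt (b * c)"
      using less_col_length_iff[OF partition_add_to_first(1)[OF part(1)], of "b * c" "b * c" a 0] by simp
    then show ?thesis by (simp add: add_to_first_def)
  qed
  then have "a = 0 \<or> l (b * c) = 0" by (cases "a = 0") simp_all
  then show "col_length lt (j + a) = col_length l j"
    by (rule partition_add_to_first(4)[OF part(1)])
  note marg = glue_marginals[OF finite_unglue[OF fin], of a b c a, unfolded g]
  show "x_marginal (unglue a P) j = x_marginal P (j + a)" using marg(1)[of "j + a"] by simp
  show "y_marginal P j = y_marginal (unglue a P) j + (if j < b then a * c else 0)" by (rule marg(2))
  show "z_marginal P j = z_marginal (unglue a P) j + (if j < c then a * b else 0)" by (rule marg(3))
qed

text \<open>\<open>glue\<close> and \<open>unglue\<close> are inverse to each other on the sets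
  counted. If \<open>l\<close> has more than \<open>b * c\<close> rows, both families are empty; the
  argument derives the bound on the rows from a given point set.\<close>

lemma t_count_stretched: "t_count lt mt pt = t_count l m p"
proof -
  let ?A = "{P. finite P \<and> x_marginal P = col_length l \<and> y_marginal P = col_length m \<and> z_marginal P = col_length p}"
  let ?B = "{P. finite P \<and> x_marginal P = col_length lt \<and> y_marginal P = col_length mt \<and> z_marginal P = col_length pt}"
  note col_mt = partition_prepend_parts(2)[OF part(2) columns(1), of "a * c"]
  note col_pt = partition_prepend_parts(2)[OF part(3) columns(2), of "a * b"]
  have "bij_betw (glue a b c) ?A ?B"
  proof (rule bij_betw_byWitness[where f' = "unglue a"])
    show "\<forall>P\<in>?A. unglue a (glue a b c P) = P" by (simp add: unglue_glue)
    have B: "glue a b c (unglue a P) = P \<and> unglue a P \<in> ?A" if "P \<in> ?B" for P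
    proof -
      have P: "finite P" "x_marginal P = col_length lt" "y_marginal P = col_length mt" "z_marginal P = col_length pt"
        using that by auto
      have box: "P \<subseteq> UNIV \<times> {..<b} \<times> {..<c}"
        using P col_mt_0 col_pt_0 by (intro box_from_marginals) auto
      note u = unglue_point_set[OF P(1) box]
      show ?thesis
        using u(1) u(2-5) finite_unglue[OF P(1)] unfolding P(2-4) col_mt col_pt by (auto simp: fun_eq_iff)
    qed
    then show "\<forall>P\<in>?B. glue a b c (unglue a P) = P" "unglue a ` ?B \<subseteq> ?A" by blast+
    show "glue a b c ` ?A \<subseteq> ?B"
    proof (rule image_subsetI)
      fix P assume "P \<in> ?A"
      then have P: "finite P" "x_marginal P = col_length l" "y_marginal P = col_length m" "z_marginal P = col_length p"
        by auto
      have box: "P \<subseteq> UNIV \<times> {..<b} \<times> {..<c}"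
        using P col_m_0 col_p_0 by (intro box_from_marginals) auto
      \<comment> \<open>A point set for the original triple lies over the rectangle, so its slice at
        0, and with it the first column of \<open>l\<close>, has at most \<open>b * c\<close>
        elements.\<close>
      have "l (b * c) = 0"
        using x_marginal_box(1)[OF box, of 0] less_col_length_iff[OF part(1), of "b * c" 0] P(2) by simp
      then have "col_length lt j = (if j < a then b * c else col_length l (j - a))" for j
        using partition_add_to_first(4)[OF part(1), of a "b * c" "j - a"] partition_add_to_first(5)[OF part(1), of "b * c" j a]
        by auto
      then show "glue a b c P \<in> ?B"
        using finite_glue[OF P(1)] glue_marginals[OF P(1), of a b c] P(2-4) col_mt col_pt
        by (auto simp: fun_eq_iff)
    qed
  qed
  then show ?thesis unfolding t_count_def by (simp add: bij_betw_same_card)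
qed

text \<open>A forbidden point set for the stretched triple unglues to one for the original triple.
  In the x-direction the index \<open>i\<close> becomes \<open>i - a\<close>; in the other two
  directions gluing changes marginals and column lengths by the same amount, so the index
  stays.\<close>

lemma rigid_stretched:
  assumes rigid: "rigid l m p"
  shows "rigid lt mt pt"
  unfolding rigid_def
proof (intro allI impI)
  fix P :: "(nat \<times> nat \<times> nat) set" and i assume fin: "finite P"
  note col_mt = partition_prepend_parts(2)[OF part(2) columns(1), of "a * c"]
  note col_pt = partition_prepend_parts(2)[OF part(3) columns(2), of "a * b"]
  let ?Q = "unglue a P"
  have rQ: "\<not> (raised (col_length l) k (x_marginal ?Q) \<and> y_marginal ?Q = col_length m \<and> z_marginal ?Q = col_length p)"
     "\<not> (x_marginal ?Q = col_length l \<and> raised (col_length m) k (y_marginal ?Q) \<and> z_marginal ?Q = col_length p)"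
     "\<not> (x_marginal ?Q = col_length l \<and> y_marginal ?Q = col_length m \<and> raised (col_length p) k (z_marginal ?Q))" for k
    using rigid finite_unglue[OF fin, of a] unfolding rigid_def by blast+
  show "\<not> (raised (col_length lt) i (x_marginal P) \<and> y_marginal P = col_length mt \<and> z_marginal P = col_length pt) \<and>
     \<not> (x_marginal P = col_length lt \<and> raised (col_length mt) i (y_marginal P) \<and> z_marginal P = col_length pt) \<and>
     \<not> (x_marginal P = col_length lt \<and> y_marginal P = col_length mt \<and> raised (col_length pt) i (z_marginal P))"
  proof (intro conjI notI; elim conjE)
    assume *: "raised (col_length lt) i (x_marginal P)" "y_marginal P = col_length mt" "z_marginal P = col_length pt"
    have box: "P \<subseteq> UNIV \<times> {..<b} \<times> {..<c}"
      using fin * col_mt_0 col_pt_0 by (intro box_from_marginals) auto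
    have eq: "x_marginal P j + (if j = Suc i then 1 else 0) = col_length lt j + (if j = i then 1 else 0)" for j
      using *(1) unfolding raised_def by blast
    \<comment> \<open>Otherwise slice \<open>i\<close> would have to hold more points than the
      \<open>b * c\<close> it has room for.\<close>
    have "a \<le> i"
    proof (rule ccontr)
      assume "\<not> a \<le> i"
      then have "b * c \<le> col_length lt i" using partition_add_to_first(3)[OF part(1)] by simp
      then show False using eq[of i] x_marginal_box(1)[OF box, of i] by simp
    qed
    then have "x_marginal P j = col_length lt j" if "j < a" for j using eq[of j] that by simp
    note u = unglue_point_set[OF fin box this]
    have "raised (col_length l) (i - a) (x_marginal ?Q)"
      unfolding raised_def
    proof
      fix j
      have "j + a = Suc i \<longleftrightarrow> j = Suc (i - a)" "j + a = i \<longleftrightarrow> j = i - a" using \<open>a \<le> i\<close> by auto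
      then show "x_marginal ?Q j + (if j = Suc (i - a) then 1 else 0) = col_length l j + (if j = i - a then 1 else 0)"
        using eq[of "j + a"] u(2,3)[of j] by simp
    qed
    moreover have "y_marginal ?Q = col_length m" "z_marginal ?Q = col_length p"
      using u(4,5) *(2,3) col_mt col_pt by (auto simp: fun_eq_iff)
    ultimately show False using rQ(1) by blast
  next
    assume *: "x_marginal P = col_length lt" "raised (col_length mt) i (y_marginal P)" "z_marginal P = col_length pt"
    have box: "P \<subseteq> UNIV \<times> {..<b} \<times> {..<c}"
      using fin * col_pt_0 raised_eq_0(2)[OF *(2) col_mt_0] by (intro box_from_marginals) auto
    note u = unglue_point_set[OF fin box]
    have i: "Suc i < b" using raised_eq_0(1)[OF *(2) col_mt_0] .
    have "raised (col_length m) i (y_marginal ?Q)"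
      unfolding raised_def
    proof
      fix j
      show "y_marginal ?Q j + (if j = Suc i then 1 else 0) = col_length m j + (if j = i then 1 else 0)"
        using *(2)[unfolded raised_def, rule_format, of j] u(4)[of j] col_mt[of j] *(1) by simp
    qed
    moreover have "x_marginal ?Q = col_length l" "z_marginal ?Q = col_length p"
      using u(2,3,5) *(1,3) col_pt by (auto simp: fun_eq_iff)
    ultimately show False using rQ(2) by blast
  next
    assume *: "x_marginal P = col_length lt" "y_marginal P = col_length mt" "raised (col_length pt) i (z_marginal P)"
    have box: "P \<subseteq> UNIV \<times> {..<b} \<times> {..<c}"
      using fin * col_mt_0 raised_eq_0(2)[OF *(3) col_pt_0] by (intro box_from_marginals) auto
    note u = unglue_point_set[OF fin box]
    have "raised (col_length p) i (z_marginal ?Q)"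
      unfolding raised_def
    proof
      fix j
      show "z_marginal ?Q j + (if j = Suc i then 1 else 0) = col_length p j + (if j = i then 1 else 0)"
        using *(3)[unfolded raised_def, rule_format, of j] u(5)[of j] col_pt[of j] *(1) by simp
    qed
    moreover have "x_marginal ?Q = col_length l" "y_marginal ?Q = col_length m"
      using u(2,3,4) *(1,2) col_mt by (auto simp: fun_eq_iff)
    ultimately show False using rQ(3) by blast
  qed
qed

end

theorem theorem4p5:
  fixes l m p lt mt pt :: "nat \<Rightarrow> nat" and n r a b c :: nat
  assumes "simplex_like l m p"
    and "psize l = n" and "psize m = n" and "psize p = n"
    and "r = (GREATEST s. real (s * (s + 1) * (s + 2)) / 6 \<le> real n)"
    and "num_columns l \<le> r + 1" and "num_columns m \<le> r + 1" and "num_columns p \<le> r + 1"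
    and "b \<ge> r + 1" and "c \<ge> r + 1"
    and "lt = add_to_first (b * c) a l"
    and "mt = prepend_parts (a * c) b m"
    and "pt = prepend_parts (a * b) c p"
  shows "kronecker_coeff lt mt pt = t_count lt mt pt
       \<and> t_count lt mt pt = t_count l m p
       \<and> t_count l m p = kronecker_coeff l m p"
proof -
  have part: "partition l" "partition m" "partition p" using assms(1) by (auto simp: simplex_like_def)
  \<comment> \<open>The columns of \<open>m\<close> and \<open>p\<close> number at most
    \<open>r + 1\<close>, which in turn is at most \<open>b\<close> and \<open>c\<close>.\<close>
  interpret S: stretched l m p a b c
    using part assms(7-10) by unfold_locales auto
  have rigid: "rigid l m p" by (rule simplex_like_rigid[OF assms(1)])
  interpret K: kronecker_setting l m p n
    using part assms(2-4) by unfold_locales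
  \<comment> \<open>Each of the three modifications adds \<open>a * b * c\<close> cells.\<close>
  interpret Kt: kronecker_setting lt mt pt "a * b * c + n"
    unfolding assms(11-13)
    using partition_add_to_first(1,2)[OF part(1), of "b * c" a]
      partition_prepend_parts(1,3)[OF part(2) S.columns(1), of "a * c"]
      partition_prepend_parts(1,3)[OF part(3) S.columns(2), of "a * b"] assms(2-4)
    by unfold_locales (simp_all add: mult_ac)
  show ?thesis
    using K.kronecker_coeff_eq_t_count[OF rigid] Kt.kronecker_coeff_eq_t_count
      S.rigid_stretched[OF rigid] S.t_count_stretched
    unfolding assms(11-13) by simp
qed

end
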